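(* Let $\Omega \subseteq \mathbb{C}^n$ be a bounded strongly pseudoconvex domain with $C^2$ boundary. Then there are an $\epsilon > 0$ and an a priori constant $K = K(\Omega)$ such that, if $P, Q \in \Omega$, then there is a Kobayashi chain from $P$ to $Q$ in $\Omega$ with elements $\varphi_1, \dots, \varphi_k$, where $k \le K$, such that the integrated Kobayashi distance of $P$ to $Q$ is within $\epsilon$ of the length given by the Kobayashi chain.
   Context: A domain in $\mathbb{C}^n$ is a connected open set. $D$ is the open unit disc in $\mathbb{C}$ and $\rho$ is the Poincaré distance on $D$ (the distance of the metric $|d\zeta|/(1-|\zeta|^2)$). The infinitesimal Kobayashi metric of $\Omega$ at $z \in \Omega$, $\xi \in \mathbb{C}^n$, is $$F_K^\Omega(z, \xi) = \inf\{\alpha > 0 : \exists\, f: D \to \Omega \text{ holomorphic with } f(0) = z,\ f'(0) = \xi/\alpha\}.$$ The integrated Kobayashi distance of $P$ to $Q$ is the infimum of $\int_0^1 F_K^\Omega(\gamma(t), \gamma'(t))\,dt$ over piecewise $C^1$ curves $\gamma: [0,1] \to \Omega$ from $P$ to $Q$. A Kobayashi chain from $P$ to $Q$ with elements $\varphi_1, \dots, \varphi_k$ consists of holomorphic maps $\varphi_j: D \to \Omega$ and points $a_j, b_j \in D$ ($1 \le j \le k$) with $\varphi_1(a_1) = P$, $\varphi_j(b_j) = \varphi_{j+1}(a_{j+1})$ for $1 \le j < k$, and $\varphi_k(b_k) = Q$; its length is $\sum_{j=1}^k \rho(a_j, b_j)$. *)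

theory Defs
  imports "HOL-Complex_Analysis.Complex_Analysis"
begin

section \<open>Lengths of curves and the induced distance\<close>

text \<open>
  The library predicate \<open>piecewise_C1_differentiable_on\<close> does not bound the derivative near the
  break points. Here the curve is \<open>C\<^sup>1\<close> up to the end points of each closed subinterval of a
  partition, with one-sided derivatives there.
\<close>

definition piecewise_C1_curve :: "(real \<Rightarrow> 'a::euclidean_space) \<Rightarrow> bool" where
  "piecewise_C1_curve \<gamma> \<longleftrightarrow>
     continuous_on {0..1} \<gamma> \<and>
     (\<exists>(m::nat) p. p 0 = 0 \<and> p m = 1 \<and>
        (\<forall>i<m. p i < p (Suc i) \<and>
           (\<exists>D. (\<forall>t\<in>{p i..p (Suc i)}.
                   (\<gamma> has_vector_derivative D t) (at t within {p i..p (Suc i)})) \<and>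
                continuous_on {p i..p (Suc i)} D)))"

text \<open>
  The infimum of the lengths, with respect to the infinitesimal metric \<open>F\<close>, of the curves in \<open>S\<close>
  from \<open>P\<close> to \<open>Q\<close>; it is infinite if there is no such curve. At the finitely many break points,
  and at \<open>0\<close> and \<open>1\<close>, the value of the derivative does not affect the integral.
\<close>

definition curves_between :: "'a::euclidean_space set \<Rightarrow> 'a \<Rightarrow> 'a \<Rightarrow> (real \<Rightarrow> 'a) set" where
  "curves_between S P Q = {\<gamma>. piecewise_C1_curve \<gamma> \<and> \<gamma> ` {0..1} \<subseteq> S \<and> \<gamma> 0 = P \<and> \<gamma> 1 = Q}"

definition integrated_dist ::
  "('a::euclidean_space \<Rightarrow> 'a \<Rightarrow> real) \<Rightarrow> 'a set \<Rightarrow> 'a \<Rightarrow> 'a \<Rightarrow> ennreal" where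
  "integrated_dist F S P Q =
     (INF \<gamma>\<in>curves_between S P Q.
        \<integral>\<^sup>+t\<in>{0..1}. ennreal (F (\<gamma> t) (vector_derivative \<gamma> (at t))) \<partial>lborel)"

definition poincare_dist :: "complex \<Rightarrow> complex \<Rightarrow> ennreal" where
  "poincare_dist = integrated_dist (\<lambda>\<zeta> v. cmod v / (1 - (cmod \<zeta>)\<^sup>2)) (ball 0 1)"


section \<open>The Kobayashi metric and Kobayashi chains\<close>

definition holomorphic_disc :: "(complex^'n) set \<Rightarrow> (complex \<Rightarrow> complex^'n) \<Rightarrow> bool" where
  "holomorphic_disc \<Omega> f \<longleftrightarrow>
     (\<forall>i. (\<lambda>\<zeta>. f \<zeta> $ i) holomorphic_on ball 0 1) \<and> f ` ball 0 1 \<subseteq> \<Omega>"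

definition disc_deriv :: "(complex \<Rightarrow> complex^'n) \<Rightarrow> complex \<Rightarrow> complex^'n" where
  "disc_deriv f \<zeta> = (\<chi> i. deriv (\<lambda>w. f w $ i) \<zeta>)"

definition kobayashi_metric :: "(complex^'n) set \<Rightarrow> complex^'n \<Rightarrow> complex^'n \<Rightarrow> real" where
  "kobayashi_metric \<Omega> z \<xi> =
     Inf {\<alpha>. \<alpha> > 0 \<and> (\<exists>f. holomorphic_disc \<Omega> f \<and> f 0 = z \<and> disc_deriv f 0 = \<xi> /\<^sub>R \<alpha>)}"

definition kobayashi_dist :: "(complex^'n) set \<Rightarrow> complex^'n \<Rightarrow> complex^'n \<Rightarrow> ennreal" where
  "kobayashi_dist \<Omega> = integrated_dist (kobayashi_metric \<Omega>) \<Omega>"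

definition kobayashi_chain ::
  "(complex^'n) set \<Rightarrow> complex^'n \<Rightarrow> complex^'n \<Rightarrow> nat \<Rightarrow> (nat \<Rightarrow> complex \<Rightarrow> complex^'n) \<Rightarrow>
   (nat \<Rightarrow> complex) \<Rightarrow> (nat \<Rightarrow> complex) \<Rightarrow> bool" where
  "kobayashi_chain \<Omega> P Q k \<phi> a b \<longleftrightarrow>
     k \<ge> 1 \<and>
     (\<forall>j\<in>{1..k}. holomorphic_disc \<Omega> (\<phi> j) \<and> a j \<in> ball 0 1 \<and> b j \<in> ball 0 1) \<and>
     \<phi> 1 (a 1) = P \<and>
     (\<forall>j\<in>{1..<k}. \<phi> j (b j) = \<phi> (Suc j) (a (Suc j))) \<and>
     \<phi> k (b k) = Q"

definition chain_length :: "nat \<Rightarrow> (nat \<Rightarrow> complex) \<Rightarrow> (nat \<Rightarrow> complex) \<Rightarrow> ennreal" where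
  "chain_length k a b = (\<Sum>j=1..k. poincare_dist (a j) (b j))"


section \<open>Strong pseudoconvexity\<close>

definition C2_on :: "('a::real_normed_vector \<Rightarrow> real) \<Rightarrow> 'a set \<Rightarrow> bool" where
  "C2_on r U \<longleftrightarrow>
     (\<exists>(r' :: 'a \<Rightarrow> ('a \<Rightarrow>\<^sub>L real)) (r'' :: 'a \<Rightarrow> ('a \<Rightarrow>\<^sub>L ('a \<Rightarrow>\<^sub>L real))).
        (\<forall>x\<in>U. (r has_derivative blinfun_apply (r' x)) (at x)) \<and>
        (\<forall>x\<in>U. (r' has_derivative blinfun_apply (r'' x)) (at x)) \<and>
        continuous_on U r'')"

definition C2_defining_function ::
  "(complex^'n) set \<Rightarrow> (complex^'n) set \<Rightarrow> (complex^'n \<Rightarrow> real) \<Rightarrow> bool" where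
  "C2_defining_function \<Omega> U r \<longleftrightarrow>
     open U \<and> frontier \<Omega> \<subseteq> U \<and> C2_on r U \<and> \<Omega> \<inter> U = {z\<in>U. r z < 0} \<and>
     (\<forall>p\<in>frontier \<Omega>. frechet_derivative r (at p) \<noteq> (\<lambda>v. 0))"

text \<open>
  The Wirtinger derivatives \<open>\<partial>/\<partial>z\<^sub>j = (\<partial>/\<partial>x\<^sub>j - \<i> \<partial>/\<partial>y\<^sub>j)/2\<close> and
  \<open>\<partial>/\<partial>(z\<^sub>j)\<^sup>* = (\<partial>/\<partial>x\<^sub>j + \<i> \<partial>/\<partial>y\<^sub>j)/2\<close>.
\<close>

definition d_z :: "'n \<Rightarrow> (complex^'n \<Rightarrow> complex) \<Rightarrow> complex^'n \<Rightarrow> complex" where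
  "d_z j f p = (frechet_derivative f (at p) (axis j 1)
                  - \<i> * frechet_derivative f (at p) (axis j \<i>)) / 2"

definition d_zbar :: "'n \<Rightarrow> (complex^'n \<Rightarrow> complex) \<Rightarrow> complex^'n \<Rightarrow> complex" where
  "d_zbar j f p = (frechet_derivative f (at p) (axis j 1)
                     + \<i> * frechet_derivative f (at p) (axis j \<i>)) / 2"

text \<open>
  For a \<open>C\<^sup>2\<close> function \<open>r\<close> the sum in \<open>levi_form\<close> is Hermitian, hence already real; taking the real
  part only adjusts the type.
\<close>

definition levi_form :: "(complex^'n \<Rightarrow> real) \<Rightarrow> complex^'n \<Rightarrow> complex^'n \<Rightarrow> real" where
  "levi_form r p w =
     Re (\<Sum>j\<in>UNIV. \<Sum>k\<in>UNIV. d_z j (d_zbar k (\<lambda>z. of_real (r z))) p * w $ j * cnj (w $ k))"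

definition complex_tangent :: "(complex^'n \<Rightarrow> real) \<Rightarrow> complex^'n \<Rightarrow> (complex^'n) set" where
  "complex_tangent r p = {w. (\<Sum>j\<in>UNIV. d_z j (\<lambda>z. of_real (r z)) p * w $ j) = 0}"

definition strongly_pseudoconvex_C2 :: "(complex^'n) set \<Rightarrow> bool" where
  "strongly_pseudoconvex_C2 \<Omega> \<longleftrightarrow>
     (\<exists>U r. C2_defining_function \<Omega> U r \<and>
        (\<forall>p\<in>frontier \<Omega>. \<forall>w\<in>complex_tangent r p. w \<noteq> 0 \<longrightarrow> levi_form r p w > 0))"

end

theory Submission
  imports Defs
begin

text \<open>
  The integrated distance never exceeds the length of a chain, so only short chains with few
  elements have to be found. Let \<open>d\<close> be the distance to the boundary. Near a boundary point \<open>p\<close>, a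
  modified Levi polynomial \<open>g\<^sub>p\<close> has \<open>Re g\<^sub>p \<le> r / 2 - c |z - p|\<^sup>2\<close> on the domain. A maximum of
  \<open>Re g\<^sub>p\<close> and a constant is plurisubharmonic on the whole domain, and this forces a disc with
  centre \<open>z\<close> near \<open>p\<close> to stay near \<open>p\<close> except for a boundary layer of width \<open>O(|g\<^sub>p z|)\<close>. The Schwarz
  lemma for the half plane then gives
  \<open>F\<^sub>K(z, \<xi>) \<ge> (1 - C |g\<^sub>p z|) |dg\<^sub>p \<xi>| / (2 |g\<^sub>p z|)\<close>, so a curve that starts at \<open>P\<close> close to \<open>p\<close>
  and leaves \<open>{|g\<^sub>p| < s}\<close> has length at least \<open>ln (s / d P) / 2 - C\<close>. If \<open>h\<close> is the anisotropic
  separation of \<open>P\<close> and \<open>Q\<close>, the regions for both points at the scale \<open>\<epsilon> h\<close> are disjoint, and the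
  distance is at least \<open>ln (h / d P) / 2 + ln (h / d Q) / 2 - C\<close>. Up to a constant this is the length
  of a chain that goes up from \<open>P\<close> to a height comparable with \<open>h\<close> in the complex normal line, across
  in one disc, and down to \<open>Q\<close>. If \<open>h\<close> is not small, the middle part runs through a compact core,
  where connectedness and compactness bound the number of discs.
\<close>

text \<open>Near the boundary both the distance and the chain lengths are unbounded, so a fixed
  relative error would be useless: the coefficient 1/2 of the logarithms has to be the same in the
  upper and in the lower bound, whereas constant factors inside a logarithm cost only a bounded
  amount. In the lower bound the relative error is \<open>C * cmod (g p z)\<close>, and integrated
  against \<open>d|g| / |g|\<close> along a curve it stays bounded. In the upper bound a single
  normal disc of fixed size, reaching a multiple of the boundary distance beyond the point, serves
  all heights at once, so the number of discs does not grow near the boundary. The peak functions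
  are controlled only within \<eta> of their boundary points. How far a disc strays from
  \<open>p\<close> is therefore read off from a small multiple of \<open>|z - p|^2\<close>: along
  the disc it is subharmonic, nonnegative, and lies below a superharmonic function whose value at
  the centre is at most \<open>cmod (g p z)\<close>. A Harnack estimate for such a pair of functions
  is the purpose of the first section.\<close>

section \<open>Subharmonic functions on the disc\<close>

text \<open>
  Such functions are subharmonic. Asking for holomorphic supports from below instead of the mean
  value inequality gives the maximum principle without any integration.
\<close>

definition holo_supported :: "(complex \<Rightarrow> real) \<Rightarrow> complex set \<Rightarrow> bool" where
  "holo_supported u S \<longleftrightarrow> continuous_on S u \<and>
     (\<forall>b\<in>S. \<exists>f e. e > 0 \<and> ball b e \<subseteq> S \<and> f holomorphic_on ball b e \<and> Re (f b) = u b \<and>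
        (\<forall>x\<in>ball b e. Re (f x) \<le> u x))"

lemma holo_supported_subset:
  assumes "holo_supported u S" "open T" "T \<subseteq> S"
  shows "holo_supported u T"
  unfolding holo_supported_def
proof (intro conjI ballI)
  show "continuous_on T u"
    using assms continuous_on_subset holo_supported_def by blast
next
  fix b assume b: "b \<in> T"
  obtain f e where f: "e > 0" "f holomorphic_on ball b e" "Re (f b) = u b" "\<forall>x\<in>ball b e. Re (f x) \<le> u x"
    using assms b unfolding holo_supported_def by blast
  obtain d where d: "d > 0" "ball b d \<subseteq> T"
    using assms b open_contains_ball by blast
  show "\<exists>f e. e > 0 \<and> ball b e \<subseteq> T \<and> f holomorphic_on ball b e \<and> Re (f b) = u b \<and>
        (\<forall>x\<in>ball b e. Re (f x) \<le> u x)"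
    apply (intro exI[of _ f] exI[of _ "min d e"])
    using f d by (auto intro: holomorphic_on_subset)
qed

lemma holo_supported_add:
  assumes "holo_supported u S" "holo_supported v S"
  shows "holo_supported (\<lambda>x. u x + v x) S"
  unfolding holo_supported_def
proof (intro conjI ballI)
  show "continuous_on S (\<lambda>x. u x + v x)"
    using assms by (auto simp: holo_supported_def intro!: continuous_intros)
next
  fix b assume b: "b \<in> S"
  obtain f e where f: "e > 0" "ball b e \<subseteq> S" "f holomorphic_on ball b e" "Re (f b) = u b"
      "\<forall>x\<in>ball b e. Re (f x) \<le> u x"
    using assms b unfolding holo_supported_def by blast
  obtain g d where g: "d > 0" "ball b d \<subseteq> S" "g holomorphic_on ball b d" "Re (g b) = v b"
      "\<forall>x\<in>ball b d. Re (g x) \<le> v x"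
    using assms b unfolding holo_supported_def by blast
  have h: "f holomorphic_on ball b (min d e)" "g holomorphic_on ball b (min d e)"
    using holomorphic_on_subset[OF f(3), of "ball b (min d e)"]
      holomorphic_on_subset[OF g(3), of "ball b (min d e)"] by (simp_all add: subset_ball)
  show "\<exists>f e. e > 0 \<and> ball b e \<subseteq> S \<and> f holomorphic_on ball b e \<and> Re (f b) = u b + v b \<and>
        (\<forall>x\<in>ball b e. Re (f x) \<le> u x + v x)"
  proof (intro exI conjI ballI)
    show "min d e > 0" using f(1) g(1) by simp
    show "ball b (min d e) \<subseteq> S" using f(2) by force
    show "(\<lambda>x. f x + g x) holomorphic_on ball b (min d e)" using holomorphic_on_add[OF h] .
    show "Re (f b + g b) = u b + v b" using f(4) g(4) by simp
    fix x assume "x \<in> ball b (min d e)"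
    then show "Re (f x + g x) \<le> u x + v x" using f(5) g(5) by (simp add: add_mono)
  qed
qed

lemma holo_supported_Re:
  assumes "F holomorphic_on S" "open S"
  shows "holo_supported (\<lambda>x. Re (F x)) S"
  unfolding holo_supported_def
proof (intro conjI ballI)
  show "continuous_on S (\<lambda>x. Re (F x))"
    using assms by (intro continuous_intros holomorphic_on_imp_continuous_on)
next
  fix b assume b: "b \<in> S"
  obtain d where d: "d > 0" "ball b d \<subseteq> S"
    using assms b open_contains_ball by blast
  show "\<exists>f e. e > 0 \<and> ball b e \<subseteq> S \<and> f holomorphic_on ball b e \<and> Re (f b) = Re (F b) \<and>
        (\<forall>x\<in>ball b e. Re (f x) \<le> Re (F x))"
    apply (intro exI[of _ F] exI[of _ d])
    using d assms by (auto intro: holomorphic_on_subset)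
qed

text \<open>The tangent plane of the convex function \<open>|z|^2\<close> at \<open>F b\<close> lies
  below it and is the real part of an affine function of \<open>z\<close>; composed with
  \<open>F\<close> it is the support at \<open>b\<close>.\<close>

lemma holo_supported_norm_power2:
  assumes "F holomorphic_on S" "open S"
  shows "holo_supported (\<lambda>x. (cmod (F x))\<^sup>2) S"
  unfolding holo_supported_def
proof (intro conjI ballI)
  show "continuous_on S (\<lambda>x. (cmod (F x))\<^sup>2)"
    using assms by (intro continuous_intros holomorphic_on_imp_continuous_on)
next
  fix b assume b: "b \<in> S"
  obtain d where d: "d > 0" "ball b d \<subseteq> S"
    using assms b open_contains_ball by blast
  have *: "2 * Re (cnj w * z) - (cmod w)\<^sup>2 \<le> (cmod z)\<^sup>2" for w z
  proof -
    have "0 \<le> (Re w - Re z)\<^sup>2 + (Im w - Im z)\<^sup>2" by simp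
    then show ?thesis
      unfolding cmod_power2 by (simp add: power2_eq_square algebra_simps)
  qed
  have **: "2 * Re (cnj w * w) - (cmod w)\<^sup>2 = (cmod w)\<^sup>2" for w
    unfolding cmod_power2 by (simp add: power2_eq_square)
  show "\<exists>f e. e > 0 \<and> ball b e \<subseteq> S \<and> f holomorphic_on ball b e \<and> Re (f b) = (cmod (F b))\<^sup>2 \<and>
        (\<forall>x\<in>ball b e. Re (f x) \<le> (cmod (F x))\<^sup>2)"
    apply (intro exI[of _ "\<lambda>x. 2 * (cnj (F b) * F x) - of_real ((cmod (F b))\<^sup>2)"] exI[of _ d])
    using d assms(1) * ** holomorphic_on_subset[OF assms(1) d(2)]
    by (auto intro!: holomorphic_intros simp del: of_real_power)
qed

lemma holo_supported_cmult:
  assumes "holo_supported u S" "c \<ge> 0"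
  shows "holo_supported (\<lambda>x. c * u x) S"
  unfolding holo_supported_def
proof (intro conjI ballI)
  show "continuous_on S (\<lambda>x. c * u x)"
    using assms by (auto simp: holo_supported_def intro!: continuous_intros)
next
  fix b assume b: "b \<in> S"
  obtain f e where f: "e > 0" "ball b e \<subseteq> S" "f holomorphic_on ball b e" "Re (f b) = u b"
      "\<forall>x\<in>ball b e. Re (f x) \<le> u x"
    using assms b unfolding holo_supported_def by blast
  show "\<exists>f e. e > 0 \<and> ball b e \<subseteq> S \<and> f holomorphic_on ball b e \<and> Re (f b) = c * u b \<and>
        (\<forall>x\<in>ball b e. Re (f x) \<le> c * u x)"
    apply (intro exI[of _ "\<lambda>x. of_real c * f x"] exI[of _ e])
    using f assms by (auto intro!: holomorphic_intros mult_left_mono)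
qed

lemma holo_supported_sum:
  assumes "finite I" "open S" "\<And>i. i \<in> I \<Longrightarrow> holo_supported (u i) S"
  shows "holo_supported (\<lambda>x. \<Sum>i\<in>I. u i x) S"
  using assms(1,3)
proof (induction I rule: finite_induct)
  case empty
  show ?case using holo_supported_Re[of "\<lambda>_. 0" S] assms(2) by simp
next
  case (insert i I)
  then show ?case by (simp add: holo_supported_add)
qed

text \<open>The maximum modulus principle for \<open>exp (f x)\<close>, whose modulus is
  \<open>exp (Re (f x))\<close>.\<close>

lemma Re_local_max_imp_const:
  assumes "f holomorphic_on ball b e" "\<And>x. x \<in> ball b e \<Longrightarrow> Re (f x) \<le> Re (f b)" "x \<in> ball b e"
  shows "Re (f x) = Re (f b)"
proof -
  have e: "e > 0" using assms(3) by (metis ball_eq_empty empty_iff not_le)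
  have "(\<lambda>x. exp (f x)) constant_on ball b e"
    by (rule maximum_modulus_principle[where U = "ball b e" and \<xi> = b])
       (use assms e in \<open>auto intro!: holomorphic_intros\<close>)
  then have "exp (f x) = exp (f b)"
    using assms(3) e unfolding constant_on_def by (metis centre_in_ball)
  then have "norm (exp (f x)) = norm (exp (f b))" by simp
  then show ?thesis by simp
qed

text \<open>At an interior maximum of \<open>u\<close> the supporting function also has maximal real
  part, hence constant real part, and so pins \<open>u\<close> from below nearby. The maximum points
  in the open disc thus form an open and closed set; if there is one, \<open>u\<close> is constant
  there and continuity carries the maximum to the circle.\<close>

lemma holo_supported_max_principle:
  assumes u: "holo_supported u (ball 0 R)" and cont: "continuous_on (cball 0 R) u" and R: "R > 0"
    and bd: "\<And>x. x \<in> sphere 0 R \<Longrightarrow> u x \<le> K" and z: "z \<in> cball 0 R"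
  shows "u z \<le> K"
proof -
  obtain b where b: "b \<in> cball 0 R" "\<And>x. x \<in> cball 0 R \<Longrightarrow> u x \<le> u b"
    using continuous_attains_sup[OF _ _ cont] R by (metis cball_eq_empty compact_cball not_le less_asym)
  have "u b \<le> K"
  proof (rule ccontr)
    assume n: "\<not> u b \<le> K"
    then have "cmod b \<noteq> R" using bd[of b] by auto
    then have bb: "b \<in> ball 0 R" using b(1) by auto
    define T where "T = {x\<in>ball 0 R. u x = u b}"
    have "continuous_on (ball 0 R) u" using u by (simp add: holo_supported_def)
    then have cl: "closedin (top_of_set (ball 0 R)) T"
      unfolding T_def using continuous_closedin_preimage_constant by fastforce
    have "\<exists>e>0. ball x e \<subseteq> T" if x: "x \<in> T" for x
    proof -
      obtain f e where f: "e > 0" "ball x e \<subseteq> ball 0 R" "f holomorphic_on ball x e" "Re (f x) = u x"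
        "\<forall>y\<in>ball x e. Re (f y) \<le> u y"
        using u x unfolding holo_supported_def T_def by blast
      have ux: "u x = u b" using x by (simp add: T_def)
      have m: "u y \<le> u b" if "y \<in> ball x e" for y
      proof -
        have "y \<in> cball 0 R" using f(2) that ball_subset_cball by blast
        then show ?thesis using b(2) by blast
      qed
      have "y \<in> T" if y: "y \<in> ball x e" for y
      proof -
        have "Re (f y) = Re (f x)"
          by (rule Re_local_max_imp_const[OF f(3) _ y]) (metis f(4,5) m order_trans ux)
        then have "u b \<le> u y" using f(4,5) y ux by metis
        then show ?thesis using m[OF y] f(2) y unfolding T_def by auto
      qed
      then show ?thesis using f(1) by blast
    qed
    then have "open T" unfolding open_contains_ball by blast
    then have op: "openin (top_of_set (ball 0 R)) T"
      by (rule open_subset[rotated]) (auto simp: T_def)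
    have "T = ball 0 R"
    proof -
      have "T = {} \<or> T = ball 0 R"
        using connected_clopen[of "ball (0::complex) R"] op cl connected_ball by blast
      moreover have "b \<in> T" using bb by (simp add: T_def)
      ultimately show ?thesis by blast
    qed
    then have eq: "u x = u b" if "x \<in> ball 0 R" for x using that T_def by blast
    have "u (of_real R) = u b"
    proof (rule continuous_constant_on_closure[of "ball 0 R" u "u b"])
      show "continuous_on (closure (ball 0 R)) u" using cont R by simp
      show "of_real R \<in> closure (ball (0::complex) R)" using R by simp
    qed (use eq in auto)
    moreover have "u (of_real R) \<le> K" using bd[of "of_real R"] R by simp
    ultimately show False using n by simp
  qed
  then show ?thesis using b(2)[OF z] by simp
qed

section \<open>Real parts of polynomials on a circle\<close>

text \<open>The real parts of polynomials. A product of two of them is in general not harmonic, but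
  on a circle around 0 it agrees with another one, which is enough for Stone-Weierstrass on that
  circle.\<close>

inductive re_poly :: "(complex \<Rightarrow> real) \<Rightarrow> bool" where
  monom: "re_poly (\<lambda>z. Re (c * z ^ k))"
| add: "re_poly f \<Longrightarrow> re_poly g \<Longrightarrow> re_poly (\<lambda>z. f z + g z)"

lemma re_poly_Re: "re_poly f \<Longrightarrow> \<exists>F. F holomorphic_on UNIV \<and> f = (\<lambda>z. Re (F z))"
proof (induction rule: re_poly.induct)
  case (monom c k)
  show ?case by (intro exI[of _ "\<lambda>z. c * z ^ k"]) (auto intro!: holomorphic_intros)
next
  case (add f g)
  then obtain F G where "F holomorphic_on UNIV" "f = (\<lambda>z. Re (F z))" "G holomorphic_on UNIV" "g = (\<lambda>z. Re (G z))"
    by blast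
  then show ?case by (intro exI[of _ "\<lambda>z. F z + G z"]) (auto intro!: holomorphic_intros)
qed

text \<open>\<open>Re A * Re B = Re (A * B / 2) + Re (A * cnj B / 2)\<close>, and on the circle
  \<open>z * cnj z\<close> is constant, which turns \<open>z ^ k * cnj (z ^ l)\<close> into a
  multiple of \<open>z ^ (k - l)\<close>.\<close>

lemma re_poly_mult_monom:
  assumes "l \<le> k"
  shows "\<exists>h. re_poly h \<and> (\<forall>z\<in>sphere 0 R. h z = Re (c * z ^ k) * Re (d * z ^ l))"
proof -
  define h where "h = (\<lambda>z. Re (c * d / 2 * z ^ (k + l)) + Re (c * cnj d / 2 * of_real (R\<^sup>2) ^ l * z ^ (k - l)))"
  have "re_poly h" unfolding h_def by (intro re_poly.intros)
  moreover have "h z = Re (c * z ^ k) * Re (d * z ^ l)" if "z \<in> sphere 0 R" for z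
  proof -
    have zz: "z * cnj z = of_real (R\<^sup>2)"
      using that by (simp add: complex_norm_square[symmetric])
    have "z ^ k * cnj (z ^ l) = of_real (R\<^sup>2) ^ l * z ^ (k - l)"
      (is "?L = ?D ^ l * _")
    proof -
      have "z ^ k = z ^ l * z ^ (k - l)" using assms by (simp flip: power_add)
      then have "?L = (z * cnj z) ^ l * z ^ (k - l)" by (simp add: power_mult_distrib)
      then show ?thesis unfolding zz .
    qed
    moreover have "(c * x) * (cnj d * y) / 2 = c * cnj d / 2 * (x * y)" for x y by simp
    ultimately have e: "c * cnj d / 2 * of_real (R\<^sup>2) ^ l * z ^ (k - l) = (c * z ^ k) * cnj (d * z ^ l) / 2"
      unfolding complex_cnj_mult mult.assoc[of "c * cnj d / 2"] by metis
    have e2: "c * d / 2 * z ^ (k + l) = (c * z ^ k) * (d * z ^ l) / 2"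
      by (simp add: power_add)
    have "Re (A * B / 2) + Re (A * cnj B / 2) = Re A * Re B" for A B :: complex
      by (simp add: field_simps)
    from this[of "c * z ^ k" "d * z ^ l"] show ?thesis unfolding h_def e e2 .
  qed
  ultimately show ?thesis by blast
qed

lemma re_poly_mult:
  assumes "re_poly f" "re_poly g"
  shows "\<exists>h. re_poly h \<and> (\<forall>z\<in>sphere 0 R. h z = f z * g z)"
  using assms
proof (induction f rule: re_poly.induct)
  case (monom c k)
  then show ?case
  proof (induction g rule: re_poly.induct)
    case m: (monom d l)
    show ?case
    proof (cases "l \<le> k")
      case True
      then show ?thesis by (rule re_poly_mult_monom)
    next
      case False
      then show ?thesis using re_poly_mult_monom[of k l R d c] by (simp add: mult.commute)
    qed
  next
    case (add f g)
    then obtain h1 h2 where "re_poly h1" "\<forall>z\<in>sphere 0 R. h1 z = Re (c * z ^ k) * f z"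
      "re_poly h2" "\<forall>z\<in>sphere 0 R. h2 z = Re (c * z ^ k) * g z" by blast
    then show ?case
      by (intro exI[of _ "\<lambda>z. h1 z + h2 z"]) (auto intro: re_poly.intros simp: distrib_left distrib_right simp del: times_complex.sel)
  qed
next
  case (add f1 f2)
  then obtain h1 h2 where "re_poly h1" "\<forall>z\<in>sphere 0 R. h1 z = f1 z * g z"
      "re_poly h2" "\<forall>z\<in>sphere 0 R. h2 z = f2 z * g z" by blast
  then show ?case
    by (intro exI[of _ "\<lambda>z. h1 z + h2 z"]) (auto intro: re_poly.intros simp: distrib_left distrib_right simp del: times_complex.sel)
qed

text \<open>Stone-Weierstrass on the circle. The approximant is entire, so approximately prescribed
  boundary values come together with holomorphy inside.\<close>

lemma Re_entire_approx_on_sphere: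
  fixes v :: "complex \<Rightarrow> real"
  assumes v: "continuous_on (sphere 0 R) v" and e: "e > 0"
  obtains F where "F holomorphic_on UNIV" "\<And>z. z \<in> sphere 0 R \<Longrightarrow> \<bar>v z - Re (F z)\<bar> < e"
proof -
  \<comment> \<open>Membership asks for agreement on the circle only, because that is where products
    of \<open>re_poly\<close> functions can be replaced by \<open>re_poly\<close> functions.\<close>
  define A where "A = {f. continuous_on (sphere 0 R) f \<and> (\<exists>h. re_poly h \<and> (\<forall>z\<in>sphere 0 R. h z = f z))}"
  have cont: "continuous_on X h" if h: "re_poly h" for h and X :: "complex set"
  proof -
    obtain F where "F holomorphic_on UNIV" "h = (\<lambda>z. Re (F z))" using re_poly_Re[OF h] by blast
    then show ?thesis
      by (auto intro!: continuous_intros holomorphic_on_imp_continuous_on intro: holomorphic_on_subset)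
  qed
  have inA: "h \<in> A" if "re_poly h" for h unfolding A_def using cont[OF that] that by blast
  have "function_ring_on A (sphere 0 R)"
  proof
    fix f g assume "f \<in> A" "g \<in> A"
    then obtain h k where hk: "re_poly h" "\<forall>z\<in>sphere 0 R. h z = f z" "re_poly k" "\<forall>z\<in>sphere 0 R. k z = g z"
      "continuous_on (sphere 0 R) f" "continuous_on (sphere 0 R) g"
      unfolding A_def by blast
    show "(\<lambda>x. f x + g x) \<in> A"
      unfolding A_def using hk by (auto intro!: continuous_intros exI[of _ "\<lambda>z. h z + k z"] re_poly.intros)
    show "(\<lambda>x. f x * g x) \<in> A"
      unfolding A_def using hk re_poly_mult[OF hk(1,3), of R] by (auto intro!: continuous_intros)
  next
    fix c :: real
    show "(\<lambda>_. c) \<in> A" using inA[OF re_poly.monom[of "of_real c" 0]] by simp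
  next
    fix x y :: complex assume "x \<noteq> y"
    \<comment> \<open>The second alternative separates by the imaginary part, since
      \<open>Re (- \<i> * x) = Im x\<close>.\<close>
    then consider "Re (1 * x ^ 1) \<noteq> Re (1 * y ^ 1)" | "Re (- \<i> * x ^ 1) \<noteq> Re (- \<i> * y ^ 1)"
      by (auto simp: complex_eq_iff)
    then show "\<exists>f\<in>A. f x \<noteq> f y"
    proof cases
      case 1 then show ?thesis by (rule bexI[OF _ inA[OF re_poly.monom]])
    next
      case 2 then show ?thesis by (rule bexI[OF _ inA[OF re_poly.monom]])
    qed
  next
    show "compact (sphere (0::complex) R)" by simp
  next
    fix f assume "f \<in> A"
    then show "continuous_on (sphere 0 R) f" by (simp add: A_def)
  qed
  then interpret function_ring_on A "sphere 0 R" .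
  obtain g where g: "g \<in> A" "\<forall>z\<in>sphere 0 R. \<bar>v z - g z\<bar> < e"
    using Stone_Weierstrass_basic[OF v e] by blast
  then obtain h where h: "re_poly h" "\<forall>z\<in>sphere 0 R. h z = g z" unfolding A_def by blast
  obtain F where F: "F holomorphic_on UNIV" "h = (\<lambda>z. Re (F z))" using re_poly_Re[OF h(1)] by blast
  show thesis by (rule that[OF F(1)]) (use g h F in auto)
qed

section \<open>Schwarz lemma and Harnack inequality\<close>

text \<open>The map that sends \<open>w\<close> to \<open>(w - F 0) / (w + cnj (F 0))\<close> takes
  the right half plane to the unit disc and \<open>F 0\<close> to 0. Both claims are the Schwarz
  lemma for its composition with \<open>F\<close>, rescaled from radius \<open>R\<close> to 1; the
  second one is Harnack's inequality.\<close>

lemma half_plane_schwarz: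
  assumes F: "F holomorphic_on ball 0 R" and R: "R > 0" and pos: "\<And>z. z \<in> ball 0 R \<Longrightarrow> Re (F z) > 0"
  shows "cmod (deriv F 0) * R \<le> 2 * Re (F 0)"
    and "b \<in> ball 0 R \<Longrightarrow> Re (F b) * (R - cmod b) \<le> Re (F 0) * (R + cmod b)"
proof -
  define f where "f = (\<lambda>z. (F (of_real R * z) - F 0) / (F (of_real R * z) + cnj (F 0)))"
  have in_ball: "of_real R * z \<in> ball 0 R" if "z \<in> ball 0 1" for z :: complex
    using that R by (simp add: norm_mult)
  have FR: "(\<lambda>z. F (of_real R * z)) holomorphic_on ball 0 1"
  proof -
    have "F \<circ> (\<lambda>z. of_real R * z) holomorphic_on ball 0 1"
      by (rule holomorphic_on_compose_gen[OF _ F]) (use in_ball in \<open>auto intro!: holomorphic_intros\<close>)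
    then show ?thesis by (simp add: o_def)
  qed
  have nz: "F (of_real R * z) + cnj (F 0) \<noteq> 0" if "z \<in> ball 0 1" for z
  proof -
    have "Re (F (of_real R * z) + cnj (F 0)) > 0"
      using pos[OF in_ball[OF that]] pos[of 0] R by simp
    then show ?thesis by force
  qed
  have holf: "f holomorphic_on ball 0 1"
    unfolding f_def using FR nz by (auto intro!: holomorphic_intros)
  have f0: "f 0 = 0" by (simp add: f_def)
  have lt: "cmod (A - B) < cmod (A + cnj B)" if "Re A > 0" "Re B > 0" for A B
  proof -
    have "(Re A - Re B)\<^sup>2 < (Re A + Re B)\<^sup>2"
      using that by (simp add: power2_eq_square algebra_simps)
    then have "(cmod (A - B))\<^sup>2 < (cmod (A + cnj B))\<^sup>2"
      unfolding cmod_power2 by simp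
    then show ?thesis by (metis norm_ge_zero power2_less_imp_less)
  qed
  have no: "norm (f z) < 1" if "norm z < 1" for z
  proof -
    have "cmod (F (of_real R * z) - F 0) < cmod (F (of_real R * z) + cnj (F 0))"
      using pos[OF in_ball] pos[of 0] R that by (intro lt) auto
    then show ?thesis unfolding f_def by (auto simp: norm_divide divide_less_eq_1)
  qed
  have pos0: "Re (F 0) > 0" using pos[of 0] R by simp
  have s: "F 0 + cnj (F 0) = of_real (2 * Re (F 0))" by (simp add: complex_eq_iff)
  have d0: "(F has_field_derivative deriv F 0) (at 0)"
    by (rule holomorphic_derivI[OF F]) (use R in auto)
  have "((\<lambda>z. F (of_real R * z)) has_field_derivative deriv F 0 * of_real R) (at 0)"
  proof -
    have "((\<lambda>z. of_real R * z) has_field_derivative of_real R) (at (0::complex))"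
      by (auto intro!: derivative_eq_intros)
    from DERIV_chain'[OF this, of F "deriv F 0"] d0 show ?thesis by (simp add: mult.commute)
  qed
  then have d1: "((\<lambda>z. F (of_real R * z) - F 0) has_field_derivative deriv F 0 * of_real R) (at 0)"
    and d2: "((\<lambda>z. F (of_real R * z) + cnj (F 0)) has_field_derivative deriv F 0 * of_real R) (at 0)"
    using DERIV_diff[OF _ DERIV_const[of "F 0"]] DERIV_add[OF _ DERIV_const[of "cnj (F 0)"]] by fastforce+
  have "F 0 + cnj (F 0) \<noteq> 0" using nz[of 0] by simp
  then have "(f has_field_derivative deriv F 0 * of_real R / (F 0 + cnj (F 0))) (at 0)"
    unfolding f_def using DERIV_divide[OF d1 d2] by simp
  then have "deriv f 0 = deriv F 0 * of_real R / of_real (2 * Re (F 0))"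
    unfolding s by (rule DERIV_imp_deriv)
  moreover have "norm (deriv f 0) \<le> 1"
    using Schwarz_Lemma(2)[OF holf f0 no, of 0] by simp
  ultimately have "cmod (deriv F 0) * R / (2 * Re (F 0)) \<le> 1"
    using R pos0 by (simp add: norm_divide norm_mult)
  then show "cmod (deriv F 0) * R \<le> 2 * Re (F 0)"
    using pos0 by (simp add: divide_le_eq)
  show "Re (F b) * (R - cmod b) \<le> Re (F 0) * (R + cmod b)" if b: "b \<in> ball 0 R"
  proof -
    define s where "s = cmod b / R"
    have s: "0 \<le> s" "s < 1" using b R by (auto simp: s_def)
    define u where "u = Re (F b)"
    define x where "x = Re (F 0)"
    have u: "u > 0" "x > 0" using pos[OF b] pos0 by (auto simp: u_def x_def)
    have "norm (f (b / of_real R)) \<le> norm (b / of_real R)"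
      by (rule Schwarz_Lemma(1)[OF holf f0 no]) (use b R in \<open>auto simp: norm_divide\<close>)
    then have "cmod (F b - F 0) \<le> s * cmod (F b + cnj (F 0))"
      using R nz[of "b / of_real R"] b unfolding f_def s_def
      by (simp add: norm_divide divide_le_eq split: if_splits)
    then have "(cmod (F b - F 0))\<^sup>2 \<le> (s * cmod (F b + cnj (F 0)))\<^sup>2"
      by (intro power_mono) auto
    then have le: "(u - x)\<^sup>2 + (Im (F b) - Im (F 0))\<^sup>2 \<le> s\<^sup>2 * ((u + x)\<^sup>2 + (Im (F b) - Im (F 0))\<^sup>2)"
      unfolding power_mult_distrib cmod_power2 u_def x_def by simp
    have "s\<^sup>2 * (Im (F b) - Im (F 0))\<^sup>2 \<le> (Im (F b) - Im (F 0))\<^sup>2"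
      using s by (simp add: mult_left_le_one_le power_le_one)
    then have "(u - x)\<^sup>2 \<le> (s * (u + x))\<^sup>2"
      using le distrib_left[of "s\<^sup>2" "(u + x)\<^sup>2" "(Im (F b) - Im (F 0))\<^sup>2"] power_mult_distrib[of s "u + x" 2] by linarith
    then have "u - x \<le> s * (u + x)"
      by (rule power2_le_imp_le) (use s u in simp)
    then have "u * (1 - s) \<le> x * (1 + s)" by (simp add: algebra_simps)
    then have "u * (1 - s) * R \<le> x * (1 + s) * R" using R by (intro mult_right_mono) auto
    moreover have "(1 - s) * R = R - cmod b" "(1 + s) * R = R + cmod b"
      using R by (simp_all add: s_def field_simps)
    ultimately show ?thesis unfolding u_def x_def by (simp only: mult.assoc)
  qed
qed

text \<open>
  The real part of an entire function that is close to \<open>v\<close> on a circle takes the place of the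
  Poisson integral of \<open>v\<close>; the bound is Harnack's inequality for it.
\<close>

lemma holo_supported_between_bound:
  assumes w: "holo_supported w (ball 0 1)" and v: "holo_supported (\<lambda>x. - v x) (ball 0 1)"
    and wv: "\<And>x. x \<in> ball 0 1 \<Longrightarrow> 0 \<le> w x \<and> w x \<le> v x" and b: "b \<in> ball 0 1"
  shows "w b * (1 - cmod b) \<le> v 0 * (1 + cmod b)"
proof -
  have step: "w b * (R - cmod b) \<le> (v 0 + e) * (R + cmod b)"
    if R: "cmod b < R" "R < 1" and e: "e > 0" for R e
  proof -
    have R0: "R > 0" using R norm_ge_zero[of b] by linarith
    have sub: "cball 0 R \<subseteq> ball (0::complex) 1" using R by auto
    have subb: "ball 0 R \<subseteq> ball (0::complex) 1" using R by auto
    have cv: "continuous_on (ball 0 1) v"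
      using v continuous_on_minus[of "ball 0 1" "\<lambda>x. - v x"] by (simp add: holo_supported_def)
    have cw: "continuous_on (ball 0 1) w" using w by (simp add: holo_supported_def)
    \<comment> \<open>The shift by \<open>e / 2\<close> makes the approximation one-sided:
      \<open>v < Re F < v + e\<close> on the circle. The maximum principle then gives
      \<open>w \<le> Re F \<le> v + e\<close> in the disc.\<close>
    have "continuous_on (sphere 0 R) (\<lambda>x. v x + e / 2)"
      using R by (intro continuous_intros continuous_on_subset[OF cv]) auto
    then obtain F where F: "F holomorphic_on UNIV"
        "\<And>z. z \<in> sphere 0 R \<Longrightarrow> \<bar>v z + e / 2 - Re (F z)\<bar> < e / 2"
      using Re_entire_approx_on_sphere[of R _ "e / 2"] e by (metis half_gt_zero)
    have Fh: "F holomorphic_on X" for X using F(1) holomorphic_on_subset by blast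
    have Fc: "continuous_on X (\<lambda>x. Re (F x))" for X
      using Fh[of X] by (intro continuous_intros holomorphic_on_imp_continuous_on)
    have mF: "(\<lambda>x. - F x) holomorphic_on X" for X using Fh[of X] by (rule holomorphic_on_minus)
    have wF: "w x - Re (F x) \<le> 0" if "x \<in> cball 0 R" for x
    proof (rule holo_supported_max_principle[OF _ _ R0 _ that])
      have "holo_supported (\<lambda>x. w x + Re (- F x)) (ball 0 R)"
        by (intro holo_supported_add holo_supported_Re[OF mF] holo_supported_subset[OF w])
           (use subb in auto)
      then show "holo_supported (\<lambda>x. w x - Re (F x)) (ball 0 R)" by simp
      show "continuous_on (cball 0 R) (\<lambda>x. w x - Re (F x))"
        by (intro continuous_intros Fc continuous_on_subset[OF cw sub])
      fix x :: complex assume x: "x \<in> sphere 0 R"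
      then have "x \<in> ball 0 1" using R by auto
      then show "w x - Re (F x) \<le> 0" using F(2)[OF x] wv[of x] by (auto simp: abs_if split: if_splits)
    qed
    have Fv: "Re (F x) - v x \<le> e" if "x \<in> cball 0 R" for x
    proof (rule holo_supported_max_principle[OF _ _ R0 _ that])
      have "holo_supported (\<lambda>x. Re (F x) + - v x) (ball 0 R)"
        by (intro holo_supported_add holo_supported_Re[OF Fh] holo_supported_subset[OF v])
           (use subb in auto)
      then show "holo_supported (\<lambda>x. Re (F x) - v x) (ball 0 R)" by simp
      show "continuous_on (cball 0 R) (\<lambda>x. Re (F x) - v x)"
        by (intro continuous_intros Fc continuous_on_subset[OF cv sub])
      fix x :: complex assume x: "x \<in> sphere 0 R"
      then show "Re (F x) - v x \<le> e" using F(2)[OF x] by (auto simp: abs_if split: if_splits)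
    qed
    have ge0: "Re (F x) \<ge> 0" if "x \<in> ball 0 R" for x
      using wF[of x] wv[of x] that R by auto
    \<comment> \<open>Only \<open>Re F \<ge> 0\<close> is known, while
      \<open>half_plane_schwarz\<close> asks for a positive real part; hence the shift by
      \<open>d\<close>, which tends to 0 afterwards.\<close>
    have har: "(Re (F b) + d) * (R - cmod b) \<le> (Re (F 0) + d) * (R + cmod b)" if "d > 0" for d
    proof -
      have hd: "(\<lambda>x. F x + of_real d) holomorphic_on ball 0 R" using Fh by (intro holomorphic_intros)
      have "Re (F b + of_real d) * (R - cmod b) \<le> Re (F 0 + of_real d) * (R + cmod b)"
      proof (rule half_plane_schwarz(2)[OF hd R0])
        fix z :: complex assume "z \<in> ball 0 R"
        then show "0 < Re (F z + of_real d)" using ge0[of z] that by simp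
      next
        show "b \<in> ball 0 R" using R by simp
      qed
      then show ?thesis by simp
    qed
    have "Re (F b) * (R - cmod b) \<le> Re (F 0) * (R + cmod b)"
    proof (rule field_le_epsilon)
      fix d :: real assume d: "d > 0"
      define d' where "d' = d / (R + cmod b)"
      have p: "R + cmod b > 0" using R0 norm_ge_zero[of b] by linarith
      have d': "d' > 0" using d p by (simp add: d'_def)
      have "Re (F b) * (R - cmod b) \<le> (Re (F b) + d') * (R - cmod b)"
        using R d' by (intro mult_right_mono) auto
      also have "\<dots> \<le> (Re (F 0) + d') * (R + cmod b)" by (rule har[OF d'])
      also have "\<dots> = Re (F 0) * (R + cmod b) + d" using p by (simp add: d'_def field_simps)
      finally show "Re (F b) * (R - cmod b) \<le> Re (F 0) * (R + cmod b) + d" .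
    qed
    moreover have "w b * (R - cmod b) \<le> Re (F b) * (R - cmod b)"
      using wF[of b] R by (intro mult_right_mono) auto
    moreover have "Re (F 0) * (R + cmod b) \<le> (v 0 + e) * (R + cmod b)"
      using Fv[of 0] R0 by (intro mult_right_mono) auto
    ultimately show ?thesis by linarith
  qed
  \<comment> \<open>Nothing is assumed at the unit circle, so the comparison was made on radius
    \<open>R < 1\<close>; now \<open>R\<close> tends to 1, and then \<open>e\<close> to 0.\<close>
  have step2: "w b * (1 - cmod b) \<le> (v 0 + e) * (1 + cmod b)" if e: "e > 0" for e
  proof (rule tendsto_le[of "at_left 1"])
    show "((\<lambda>R. w b * (R - cmod b)) \<longlongrightarrow> w b * (1 - cmod b)) (at_left 1)"
      by (intro tendsto_intros)
    show "((\<lambda>R. (v 0 + e) * (R + cmod b)) \<longlongrightarrow> (v 0 + e) * (1 + cmod b)) (at_left 1)"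
      by (intro tendsto_intros)
    have "cmod b < 1" using b by simp
    then show "eventually (\<lambda>R. w b * (R - cmod b) \<le> (v 0 + e) * (R + cmod b)) (at_left 1)"
      using step[OF _ _ e] by (auto simp: eventually_at_left[of "cmod b" 1])
  qed simp
  show ?thesis
  proof (rule tendsto_le[of "at_right 0"])
    show "((\<lambda>e. w b * (1 - cmod b)) \<longlongrightarrow> w b * (1 - cmod b)) (at_right 0)" by (intro tendsto_intros)
    have "((\<lambda>e. (v 0 + e) * (1 + cmod b)) \<longlongrightarrow> (v 0 + 0) * (1 + cmod b)) (at_right 0)"
      by (intro tendsto_intros)
    then show "((\<lambda>e. (v 0 + e) * (1 + cmod b)) \<longlongrightarrow> v 0 * (1 + cmod b)) (at_right 0)" by simp
    show "eventually (\<lambda>e. w b * (1 - cmod b) \<le> (v 0 + e) * (1 + cmod b)) (at_right 0)"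
      using step2 by (auto simp: eventually_at_right[of 0 1] intro: exI[of _ 1])
  qed simp
qed

section \<open>Lengths of curves\<close>

text \<open>
  The Kobayashi metric along a curve is not shown to be measurable, so that the integrals in
  \<open>integrated_dist\<close> are only lower integrals. This is why the next three lemmas do not assume
  measurability.
\<close>

lemma nn_integral_superadditive:
  "(\<integral>\<^sup>+x. f x \<partial>M) + (\<integral>\<^sup>+x. g x \<partial>M) \<le> (\<integral>\<^sup>+x. f x + g x \<partial>M)"
proof -
  define A where "A = (\<lambda>h::'a \<Rightarrow> ennreal. {s. simple_function M s \<and> s \<le> h})"
  have ne: "A h \<noteq> {}" for h
    unfolding A_def by (auto simp: le_fun_def intro!: exI[of _ "\<lambda>_. 0"])
  have eq: "integral\<^sup>N M h = (SUP s\<in>A h. integral\<^sup>S M s)" for h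
    by (simp add: nn_integral_def A_def)
  have "integral\<^sup>N M f + integral\<^sup>N M g = (SUP s\<in>A f. SUP t\<in>A g. integral\<^sup>S M s + integral\<^sup>S M t)"
    unfolding eq ennreal_SUP_add_left[OF ne, symmetric] ennreal_SUP_add_right[OF ne, symmetric] ..
  also have "\<dots> \<le> (\<integral>\<^sup>+x. f x + g x \<partial>M)"
  proof (intro SUP_least)
    fix s t assume st: "s \<in> A f" "t \<in> A g"
    then have sf: "simple_function M s" "simple_function M t" by (auto simp: A_def)
    have "integral\<^sup>S M s + integral\<^sup>S M t = (\<integral>\<^sup>+x. s x + t x \<partial>M)"
      using sf by (simp add: nn_integral_eq_simple_integral simple_integral_add simple_function_add)
    also have "\<dots> \<le> (\<integral>\<^sup>+x. f x + g x \<partial>M)"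
      using st by (intro nn_integral_mono add_mono) (auto simp: A_def le_fun_def)
    finally show "integral\<^sup>S M s + integral\<^sup>S M t \<le> (\<integral>\<^sup>+x. f x + g x \<partial>M)" .
  qed
  finally show ?thesis .
qed

lemma nn_integral_split_le:
  assumes A: "A \<in> sets M"
  shows "(\<integral>\<^sup>+x. f x \<partial>M) \<le> (\<integral>\<^sup>+x. f x * indicator A x \<partial>M) + (\<integral>\<^sup>+x. f x * indicator (- A) x \<partial>M)"
  unfolding nn_integral_def[of M f]
proof (rule SUP_least)
  fix s assume "s \<in> {g. simple_function M g \<and> g \<le> f}"
  then have s: "simple_function M s" "\<And>x. s x \<le> f x" by (auto simp: le_fun_def)
  then have m: "s \<in> borel_measurable M" by (simp add: borel_measurable_simple_function)
  have "integral\<^sup>S M s = (\<integral>\<^sup>+x. s x \<partial>M)" using s(1) by (simp add: nn_integral_eq_simple_integral)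
  also have "\<dots> = (\<integral>\<^sup>+x. s x * indicator A x + s x * indicator (space M - A) x \<partial>M)"
    by (intro nn_integral_cong) (auto split: split_indicator)
  also have "\<dots> = (\<integral>\<^sup>+x. s x * indicator A x \<partial>M) + (\<integral>\<^sup>+x. s x * indicator (space M - A) x \<partial>M)"
    using m A by (intro nn_integral_add) auto
  also have "\<dots> \<le> (\<integral>\<^sup>+x. f x * indicator A x \<partial>M) + (\<integral>\<^sup>+x. f x * indicator (- A) x \<partial>M)"
    using s(2) by (intro add_mono nn_integral_mono) (auto split: split_indicator)
  finally show "integral\<^sup>S M s \<le> (\<integral>\<^sup>+x. f x * indicator A x \<partial>M) + (\<integral>\<^sup>+x. f x * indicator (- A) x \<partial>M)" .
qed

lemma nn_integral_affine_le:
  fixes c :: real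
  assumes c: "c > 0"
  shows "(\<integral>\<^sup>+x. ennreal c * f (t + c * x) \<partial>lborel) \<le> (\<integral>\<^sup>+x. f x \<partial>lborel)"
  unfolding nn_integral_def[of lborel "\<lambda>x. ennreal c * f (t + c * x)"]
proof (rule SUP_least)
  fix s assume "s \<in> {g. simple_function lborel g \<and> g \<le> (\<lambda>x. ennreal c * f (t + c * x))}"
  then have s: "simple_function lborel s" "\<And>x. s x \<le> ennreal c * f (t + c * x)" by (auto simp: le_fun_def)
  have [measurable]: "s \<in> borel_measurable borel"
    using borel_measurable_simple_function[OF s(1)] by simp
  \<comment> \<open>The inverse substitution carries the simple function \<open>s\<close> to a
    measurable function below \<open>f\<close>, to which the usual change of variables
    applies.\<close>
  define u where "u = (\<lambda>y. ennreal (1 / c) * s ((y - t) / c))"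
  have [measurable]: "u \<in> borel_measurable borel" unfolding u_def by measurable
  have inv: "ennreal c * (ennreal (1 / c) * a) = a" "ennreal (1 / c) * (ennreal c * a) = a" for a
    using c by (simp_all flip: mult.assoc ennreal_mult')
  have su: "s x = ennreal c * u (t + c * x)" for x
    using c inv(1) by (simp add: u_def)
  have "u y \<le> f y" for y
  proof -
    have "u y \<le> ennreal (1 / c) * (ennreal c * f (t + c * ((y - t) / c)))"
      unfolding u_def by (intro mult_left_mono s(2)) simp
    also have "\<dots> = f y" using c inv(2) by simp
    finally show ?thesis .
  qed
  then have le: "(\<integral>\<^sup>+x. u x \<partial>lborel) \<le> (\<integral>\<^sup>+x. f x \<partial>lborel)" by (intro nn_integral_mono)
  have "integral\<^sup>S lborel s = (\<integral>\<^sup>+x. s x \<partial>lborel)" using s(1) by (simp add: nn_integral_eq_simple_integral)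
  also have "\<dots> = (\<integral>\<^sup>+x. ennreal c * u (t + c * x) \<partial>lborel)" by (simp add: su[symmetric])
  also have "\<dots> = ennreal c * (\<integral>\<^sup>+x. u (t + c * x) \<partial>lborel)" by (intro nn_integral_cmult) measurable
  also have "\<dots> = (\<integral>\<^sup>+x. u x \<partial>lborel)"
    using nn_integral_real_affine[of u c t] c by simp
  finally show "integral\<^sup>S lborel s \<le> (\<integral>\<^sup>+x. f x \<partial>lborel)" using le by simp
qed

text \<open>\<open>f'\<close> is a derivative off a finite set, possibly unbounded. The fundamental
  theorem for the gauge integral makes it measurable, so that \<open>\<bar>f'\<bar>\<close> is a
  measurable minorant of \<open>h\<close>; if it is not absolutely integrable, the right side is
  infinite.\<close>

lemma nn_integral_ge_increment:
  fixes f f' h :: "real \<Rightarrow> real"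
  assumes ab: "a \<le> b" and cont: "continuous_on {a..b} f" and S: "finite S"
    and der: "\<And>t. t \<in> {a<..<b} - S \<Longrightarrow> (f has_vector_derivative f' t) (at t)"
    and le: "\<And>t. t \<in> {a<..<b} - S \<Longrightarrow> \<bar>f' t\<bar> \<le> h t"
  shows "ennreal \<bar>f b - f a\<bar> \<le> (\<integral>\<^sup>+t\<in>{a<..<b}. ennreal (h t) \<partial>lborel)"
proof -
  have I: "(f' has_integral (f b - f a)) {a..b}"
    by (rule fundamental_theorem_of_calculus_interior_strong[OF S ab _ cont]) (use der in auto)
  have neg: "negligible (insert a (insert b S))" using S by (intro negligible_finite) simp
  define k where "k = (\<lambda>t. f' t * indicator ({a<..<b} - S) t)"
  have kI: "(k has_integral (f b - f a)) UNIV"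
  proof -
    have "((\<lambda>t. f' t * indicator {a..b} t) has_integral (f b - f a)) UNIV"
      using I has_integral_restrict_UNIV[of "{a..b}" f' "f b - f a"]
      by (simp add: indicator_def of_bool_def if_distrib cong: if_cong)
    then show ?thesis
      by (rule has_integral_spike[OF neg, rotated]) (auto simp: k_def split: split_indicator)
  qed
  have km: "k \<in> borel_measurable lebesgue"
    using has_integral_implies_lebesgue_measurable_real[OF kI] by simp
  have "(\<integral>\<^sup>+t. ennreal \<bar>k t\<bar> \<partial>lebesgue) \<le> (\<integral>\<^sup>+t\<in>{a<..<b}. ennreal (h t) \<partial>lebesgue)"
    by (intro nn_integral_mono) (use le in \<open>auto simp: k_def ennreal_leI split: split_indicator\<close>)
  moreover have "ennreal \<bar>f b - f a\<bar> \<le> (\<integral>\<^sup>+t. ennreal \<bar>k t\<bar> \<partial>lebesgue)"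
  proof (cases "integrable lebesgue k")
    case True
    have "f b - f a = integral\<^sup>L lebesgue k"
      using has_integral_unique[OF kI has_integral_integral_lebesgue[OF True]] .
    then have "\<bar>f b - f a\<bar> \<le> integral\<^sup>L lebesgue (\<lambda>t. \<bar>k t\<bar>)"
      using integral_abs_bound[of lebesgue k] by simp
    then have "ennreal \<bar>f b - f a\<bar> \<le> ennreal (integral\<^sup>L lebesgue (\<lambda>t. \<bar>k t\<bar>))" by (rule ennreal_leI)
    also have "\<dots> = (\<integral>\<^sup>+t. ennreal \<bar>k t\<bar> \<partial>lebesgue)"
      using True by (intro nn_integral_eq_integral[symmetric]) auto
    finally show ?thesis .
  next
    case False
    then have "(\<integral>\<^sup>+t. ennreal \<bar>k t\<bar> \<partial>lebesgue) = \<infinity>"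
      using km by (simp add: integrable_iff_bounded top.not_eq_extremum[symmetric])
    then show ?thesis by simp
  qed
  ultimately show ?thesis by (simp add: nn_integral_completion)
qed

section \<open>Piecewise C1 curves and the triangle inequality\<close>

lemma partition_cases:
  fixes p :: "nat \<Rightarrow> real"
  assumes "p 0 \<le> t" "t \<le> p m"
  obtains i where "i < m" "p i < t" "t < p (Suc i)" | i where "i \<le> m" "t = p i"
proof -
  define j where "j = (LEAST i. t \<le> p i)"
  have j: "t \<le> p j" unfolding j_def by (rule LeastI[of _ m]) (rule assms)
  have jm: "j \<le> m" unfolding j_def by (rule Least_le) (rule assms)
  show thesis
  proof (cases "t = p j")
    case True
    then show ?thesis using that(2) jm by blast
  next
    case False
    then have "j \<noteq> 0" using assms(1) j by (cases j) auto
    then obtain i where i: "j = Suc i" using not0_implies_Suc by blast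
    then have "\<not> t \<le> p i" unfolding j_def using not_less_Least[of i "\<lambda>i. t \<le> p i"] j_def by auto
    then show ?thesis using that(1)[of i] False j jm i by auto
  qed
qed

lemma piecewise_C1_curve_imp:
  assumes "piecewise_C1_curve \<gamma>"
  obtains S where "finite S" "continuous_on {0..1} \<gamma>" "0 \<in> S" "1 \<in> S"
    "\<And>t. t \<in> {0..1} - S \<Longrightarrow> (\<gamma> has_vector_derivative vector_derivative \<gamma> (at t)) (at t)"
proof -
  obtain m p where p: "p 0 = 0" "p m = 1"
    "\<And>i. i < m \<Longrightarrow> \<exists>D. \<forall>t\<in>{p i..p (Suc i)}. (\<gamma> has_vector_derivative D t) (at t within {p i..p (Suc i)})"
    and c: "continuous_on {0..1} \<gamma>"
    using assms unfolding piecewise_C1_curve_def by blast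
  show thesis
  proof (rule that[of "p ` {..m}"])
    fix t assume t: "t \<in> {0..1} - p ` {..m}"
    then obtain i where i: "i < m" "p i < t" "t < p (Suc i)"
      using partition_cases[of p t m] p by auto
    obtain D where "(\<gamma> has_vector_derivative D t) (at t within {p i..p (Suc i)})"
      using p(3)[OF i(1)] i by fastforce
    moreover have "at t within {p i..p (Suc i)} = at t"
      using i by (intro at_within_interior) (auto simp: interior_atLeastAtMost_real)
    ultimately show "(\<gamma> has_vector_derivative vector_derivative \<gamma> (at t)) (at t)"
      by (simp add: vector_derivative_at)
  qed (use c p in \<open>auto intro!: image_eqI[of _ p 0] image_eqI[of _ p m]\<close>)
qed

lemma piecewise_C1_curveI:
  assumes "\<And>t. t \<in> {0..1} \<Longrightarrow> (\<gamma> has_vector_derivative D t) (at t within {0..1})" "continuous_on {0..1} D"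
  shows "piecewise_C1_curve \<gamma>"
  unfolding piecewise_C1_curve_def
proof (intro conjI exI[of _ "1::nat"] exI[of _ real])
  show "continuous_on {0..1} \<gamma>"
    using assms(1) has_vector_derivative_continuous continuous_on_eq_continuous_within by blast
  show "\<forall>i<1. real i < real (Suc i) \<and> (\<exists>D. (\<forall>t\<in>{real i..real (Suc i)}.
      (\<gamma> has_vector_derivative D t) (at t within {real i..real (Suc i)})) \<and> continuous_on {real i..real (Suc i)} D)"
    using assms by (auto intro!: exI[of _ D])
qed auto

text \<open>For joining curves: \<open>c = 0\<close> serves the first half of the parameter interval
  and \<open>c = - 1\<close> the second.\<close>

lemma C1_piece_reparametrization:
  fixes g :: "real \<Rightarrow> 'a::real_normed_vector"
  assumes D: "\<And>t. t \<in> {u..v} \<Longrightarrow> (g has_vector_derivative D t) (at t within {u..v})" "continuous_on {u..v} D"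
    and j: "\<And>t. t \<in> {(u - c) / 2..(v - c) / 2} \<Longrightarrow> j t = g (2 * t + c)"
  shows "\<exists>D. (\<forall>t\<in>{(u - c) / 2..(v - c) / 2}. (j has_vector_derivative D t) (at t within {(u - c) / 2..(v - c) / 2})) \<and>
    continuous_on {(u - c) / 2..(v - c) / 2} D"
proof (intro exI conjI ballI)
  define I where "I = {(u - c) / 2..(v - c) / 2}"
  have sub: "(\<lambda>t. 2 * t + c) ` I \<subseteq> {u..v}" by (auto simp: I_def)
  fix t assume "t \<in> {(u - c) / 2..(v - c) / 2}"
  then have t: "t \<in> I" by (simp add: I_def)
  have "((\<lambda>t. 2 * t + c) has_vector_derivative 2) (at t within I)"
    by (auto intro!: derivative_eq_intros simp: has_real_derivative_iff_has_vector_derivative[symmetric])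
  moreover have "(g has_vector_derivative D (2 * t + c)) (at (2 * t + c) within (\<lambda>t. 2 * t + c) ` I)"
    by (rule has_vector_derivative_within_subset[OF D(1) sub]) (use sub t in blast)
  ultimately have "((\<lambda>t. g (2 * t + c)) has_vector_derivative 2 *\<^sub>R D (2 * t + c)) (at t within I)"
    using vector_diff_chain_within[of "\<lambda>t. 2 * t + c" 2 t I g "D (2 * t + c)"] by (simp add: o_def)
  then have "(j has_vector_derivative 2 *\<^sub>R D (2 * t + c)) (at t within I)"
    by (rule has_vector_derivative_transform[OF t, rotated]) (use j in \<open>simp add: I_def\<close>)
  then show "(j has_vector_derivative 2 *\<^sub>R D (2 * t + c)) (at t within {(u - c) / 2..(v - c) / 2})"
    by (simp add: I_def)
next
  show "continuous_on {(u - c) / 2..(v - c) / 2} (\<lambda>t. 2 *\<^sub>R D (2 * t + c))"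
    by (intro continuous_on_scaleR continuous_on_const continuous_on_compose2[OF D(2)])
       (auto intro!: continuous_intros)
qed

lemma piecewise_C1_curve_join:
  assumes g: "piecewise_C1_curve g" and h: "piecewise_C1_curve h" and eq: "g 1 = h 0"
  shows "piecewise_C1_curve (\<lambda>t. if t \<le> 1/2 then g (2 * t) else h (2 * t - 1))"
    (is "piecewise_C1_curve ?j")
proof -
  obtain m p where p: "p 0 = 0" "p m = 1" and cg: "continuous_on {0..1} g"
    and pm: "\<And>i. i < m \<Longrightarrow> p i < p (Suc i) \<and> (\<exists>D. (\<forall>t\<in>{p i..p (Suc i)}. (g has_vector_derivative D t) (at t within {p i..p (Suc i)})) \<and>
                continuous_on {p i..p (Suc i)} D)"
    using g unfolding piecewise_C1_curve_def by blast
  obtain n q where q: "q 0 = 0" "q n = 1" and ch: "continuous_on {0..1} h"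
    and qn: "\<And>i. i < n \<Longrightarrow> q i < q (Suc i) \<and> (\<exists>D. (\<forall>t\<in>{q i..q (Suc i)}. (h has_vector_derivative D t) (at t within {q i..q (Suc i)})) \<and>
                continuous_on {q i..q (Suc i)} D)"
    using h unfolding piecewise_C1_curve_def by blast
  have pmono: "p i \<le> p j" if "i \<le> j" "j \<le> m" for i j
    using that
  proof (induction j rule: dec_induct)
    case (step k) then show ?case using pm[of k] by fastforce
  qed simp
  have qmono: "q i \<le> q j" if "i \<le> j" "j \<le> n" for i j
    using that
  proof (induction j rule: dec_induct)
    case (step k) then show ?case using qn[of k] by fastforce
  qed simp
  have cont: "continuous_on {0..1} ?j"
  proof -
    have "{0..1} = {0..1/2} \<union> {1/2..1::real}" by auto
    moreover have "continuous_on ({0..1/2} \<union> {1/2..1::real}) ?j"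
    proof (rule continuous_on_cases)
      show "continuous_on {0..1/2} (\<lambda>t::real. g (2 * t))"
        by (rule continuous_on_compose2[OF cg]) (auto intro!: continuous_intros)
      show "continuous_on {1/2..1} (\<lambda>t::real. h (2 * t - 1))"
        by (rule continuous_on_compose2[OF ch]) (auto intro!: continuous_intros)
      have "t = 1/2" if "t \<in> {0..1/2} \<and> \<not> t \<le> 1/2 \<or> t \<in> {1/2..1} \<and> t \<le> 1/2" for t :: real
        using that by auto
      then show "\<forall>t. t \<in> {0..1/2} \<and> \<not> t \<le> 1/2 \<or> t \<in> {1/2..1} \<and> t \<le> 1/2 \<longrightarrow> g (2 * t) = h (2 * t - 1)"
        using eq by fastforce
    qed auto
    ultimately show ?thesis by simp
  qed
  define r where "r i = (if i \<le> m then p i / 2 else 1/2 + q (i - m) / 2)" for i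
  have piece: "r i < r (Suc i) \<and> (\<exists>D. (\<forall>t\<in>{r i..r (Suc i)}. (?j has_vector_derivative D t) (at t within {r i..r (Suc i)})) \<and>
                continuous_on {r i..r (Suc i)} D)" if i: "i < m + n" for i
  proof (cases "i < m")
    case True
    obtain D where D: "\<And>t. t \<in> {p i..p (Suc i)} \<Longrightarrow> (g has_vector_derivative D t) (at t within {p i..p (Suc i)})"
      "continuous_on {p i..p (Suc i)} D" and lt: "p i < p (Suc i)" using pm[OF True] by blast
    have r: "r i = p i / 2" "r (Suc i) = p (Suc i) / 2" using True by (auto simp: r_def)
    have le1: "p (Suc i) \<le> 1" using pmono[of "Suc i" m] True p by simp
    have "?j t = g (2 * t + 0)" if "t \<in> {(p i - 0) / 2..(p (Suc i) - 0) / 2}" for t using that le1 by auto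
    from C1_piece_reparametrization[of _ _ g D 0, OF D this] show ?thesis using lt by (simp add: r)
  next
    case False
    define l where "l = i - m"
    have l: "l < n" using i False by (simp add: l_def)
    obtain D where D: "\<And>t. t \<in> {q l..q (Suc l)} \<Longrightarrow> (h has_vector_derivative D t) (at t within {q l..q (Suc l)})"
      "continuous_on {q l..q (Suc l)} D" and lt: "q l < q (Suc l)" using qn[OF l] by blast
    have r: "r i = 1/2 + q l / 2" "r (Suc i) = 1/2 + q (Suc l) / 2"
      using False p q by (auto simp: r_def l_def Suc_diff_le)
    have ge0: "0 \<le> q l" using qmono[of 0 l] l q by simp
    have "?j t = h (2 * t + - 1)" if "t \<in> {(q l - - 1) / 2..(q (Suc l) - - 1) / 2}" for t
    proof -
      have "2 * t = 1 \<and> 2 * t - 1 = 0 \<or> \<not> t \<le> 1/2" using that ge0 by auto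
      then show ?thesis using eq by auto
    qed
    from C1_piece_reparametrization[of _ _ h D "- 1", OF D this] show ?thesis
      using lt by (simp add: r add_divide_distrib add.commute)
  qed
  have "r 0 = 0" "r (m + n) = 1" using p q by (cases n; simp add: r_def)+
  with piece cont show ?thesis unfolding piecewise_C1_curve_def by blast
qed

text \<open>Off the finitely many preimages of break points the chain rule doubles the velocity, and
  \<open>F\<close> turns this into a factor 2. The indicator shapes the bound so that
  \<open>nn_integral_affine_le\<close> can absorb that factor.\<close>

lemma reparametrized_speed_le:
  fixes F :: "'a::euclidean_space \<Rightarrow> 'a \<Rightarrow> real"
  assumes F: "\<And>z v. z \<in> S \<Longrightarrow> F z (2 *\<^sub>R v) \<le> 2 * F z v"
    and g: "piecewise_C1_curve g" "g ` {0..1} \<subseteq> S"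
    and I: "open I" "\<And>t. t \<in> I \<Longrightarrow> c + 2 * t \<in> {0..1}" "\<And>t. t \<in> I \<Longrightarrow> j t = g (c + 2 * t)"
  shows "AE t in lborel. t \<in> I \<longrightarrow> ennreal (F (j t) (vector_derivative j (at t))) \<le>
    ennreal 2 * (ennreal (F (g (c + 2 * t)) (vector_derivative g (at (c + 2 * t)))) * indicator {0..1} (c + 2 * t))"
proof -
  obtain A where A: "finite A" "\<And>t. t \<in> {0..1} - A \<Longrightarrow> (g has_vector_derivative vector_derivative g (at t)) (at t)"
    using piecewise_C1_curve_imp[OF g(1)] by metis
  have AE: "AE t in lborel. t \<notin> (\<lambda>t. (t - c) / 2) ` A"
    using A(1) by (intro AE_not_in finite_imp_null_set_lborel) simp
  show ?thesis
  proof (rule eventually_mono[OF AE], rule impI)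
    fix t assume tA: "t \<notin> (\<lambda>t. (t - c) / 2) ` A" and t: "t \<in> I"
    have nA: "c + 2 * t \<notin> A"
    proof
      assume "c + 2 * t \<in> A"
      then have "(c + 2 * t - c) / 2 \<in> (\<lambda>t. (t - c) / 2) ` A" by blast
      then show False using tA by simp
    qed
    have "((\<lambda>t. c + 2 * t) has_vector_derivative 2) (at t)"
      by (auto simp: has_real_derivative_iff_has_vector_derivative[symmetric] intro!: derivative_eq_intros)
    then have "((\<lambda>t. g (c + 2 * t)) has_vector_derivative 2 *\<^sub>R vector_derivative g (at (c + 2 * t))) (at t)"
      using vector_diff_chain_at[of "\<lambda>t. c + 2 * t" 2 t g "vector_derivative g (at (c + 2 * t))"]
        A(2)[of "c + 2 * t"] nA I(2)[OF t] by (simp add: o_def)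
    then have "(j has_vector_derivative 2 *\<^sub>R vector_derivative g (at (c + 2 * t))) (at t)"
      by (rule has_vector_derivative_transform_within_open[OF _ I(1) t]) (use I(3) in simp)
    then have "vector_derivative j (at t) = 2 *\<^sub>R vector_derivative g (at (c + 2 * t))"
      by (rule vector_derivative_at)
    moreover have "g (c + 2 * t) \<in> S" using g(2) I(2)[OF t] by blast
    ultimately have "F (j t) (vector_derivative j (at t)) \<le> 2 * F (g (c + 2 * t)) (vector_derivative g (at (c + 2 * t)))"
      using F[of "g (c + 2 * t)"] I(3)[OF t] by simp
    then have "ennreal (F (j t) (vector_derivative j (at t))) \<le>
        ennreal 2 * ennreal (F (g (c + 2 * t)) (vector_derivative g (at (c + 2 * t))))"
      by (subst ennreal_mult'[symmetric]) (auto intro: ennreal_leI)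
    then show "ennreal (F (j t) (vector_derivative j (at t))) \<le>
        ennreal 2 * (ennreal (F (g (c + 2 * t)) (vector_derivative g (at (c + 2 * t)))) * indicator {0..1} (c + 2 * t))"
      using I(2)[OF t] by simp
  qed
qed

text \<open>Two nearly optimal curves are run through one after the other at double speed. For a
  metric that is positively homogeneous the change of variables makes up for the doubled speed on
  each half.\<close>

lemma integrated_dist_triangle:
  fixes F :: "'a::euclidean_space \<Rightarrow> 'a \<Rightarrow> real"
  assumes F: "\<And>z v c. z \<in> S \<Longrightarrow> c > 0 \<Longrightarrow> F z (c *\<^sub>R v) \<le> c * F z v"
  shows "integrated_dist F S P R \<le> integrated_dist F S P Q + integrated_dist F S Q R"
proof -
  have main: "integrated_dist F S P R \<le>
      (\<integral>\<^sup>+t\<in>{0..1}. ennreal (F (g t) (vector_derivative g (at t))) \<partial>lborel) +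
      (\<integral>\<^sup>+t\<in>{0..1}. ennreal (F (h t) (vector_derivative h (at t))) \<partial>lborel)"
    if g: "g \<in> curves_between S P Q" and h: "h \<in> curves_between S Q R" for g h
  proof -
    define j where "j = (\<lambda>t::real. if t \<le> 1/2 then g (2 * t) else h (2 * t - 1))"
    have "piecewise_C1_curve j"
      unfolding j_def using g h by (intro piecewise_C1_curve_join) (auto simp: curves_between_def)
    moreover have "j ` {0..1} \<subseteq> S" using g h unfolding curves_between_def j_def by fastforce
    ultimately have j: "j \<in> curves_between S P R"
      using g h unfolding curves_between_def j_def by auto
    define G where "G = (\<lambda>t. ennreal (F (g t) (vector_derivative g (at t))) * indicator {0..1} t)"
    define H where "H = (\<lambda>t. ennreal (F (h t) (vector_derivative h (at t))) * indicator {0..1} t)"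
    define J where "J = (\<lambda>t. ennreal (F (j t) (vector_derivative j (at t))) * indicator {0..1} t)"
    have gh: "piecewise_C1_curve g" "g ` {0..1} \<subseteq> S" "piecewise_C1_curve h" "h ` {0..1} \<subseteq> S"
      using g h by (simp_all add: curves_between_def)
    have F2: "F z (2 *\<^sub>R v) \<le> 2 * F z v" if "z \<in> S" for z v using F[OF that, of 2 v] by simp
    have AE: "AE t in lborel. t \<notin> {0, 1/2, 1::real}"
      by (intro AE_not_in finite_imp_null_set_lborel) simp
    have 1: "AE t in lborel. J t * indicator {..1/2} t \<le> ennreal 2 * G (0 + 2 * t)"
    proof -
      have "AE t in lborel. t \<in> {0<..<1/2} \<longrightarrow> ennreal (F (j t) (vector_derivative j (at t))) \<le> ennreal 2 * G (0 + 2 * t)"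
        unfolding G_def by (rule reparametrized_speed_le[where F = F and S = S, OF F2 gh(1,2)]) (auto simp: j_def)
      then show ?thesis using AE
        by eventually_elim (auto simp: J_def split: split_indicator)
    qed
    have 2: "AE t in lborel. J t * indicator (- {..1/2}) t \<le> ennreal 2 * H (- 1 + 2 * t)"
    proof -
      have "AE t in lborel. t \<in> {1/2<..<1} \<longrightarrow> ennreal (F (j t) (vector_derivative j (at t))) \<le> ennreal 2 * H (- 1 + 2 * t)"
        unfolding H_def by (rule reparametrized_speed_le[where F = F and S = S, OF F2 gh(3,4)]) (auto simp: j_def)
      then show ?thesis using AE
        by eventually_elim (auto simp: J_def split: split_indicator)
    qed
    have "integrated_dist F S P R \<le> (\<integral>\<^sup>+t. J t \<partial>lborel)"
      unfolding integrated_dist_def J_def by (rule INF_lower[OF j])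
    also have "\<dots> \<le> (\<integral>\<^sup>+t. J t * indicator {..1/2} t \<partial>lborel) + (\<integral>\<^sup>+t. J t * indicator (- {..1/2}) t \<partial>lborel)"
      by (rule nn_integral_split_le) simp
    also have "\<dots> \<le> (\<integral>\<^sup>+t. ennreal 2 * G (0 + 2 * t) \<partial>lborel) + (\<integral>\<^sup>+t. ennreal 2 * H (- 1 + 2 * t) \<partial>lborel)"
      by (intro add_mono nn_integral_mono_AE 1 2)
    also have "\<dots> \<le> (\<integral>\<^sup>+t. G t \<partial>lborel) + (\<integral>\<^sup>+t. H t \<partial>lborel)"
      by (intro add_mono nn_integral_affine_le) auto
    finally show ?thesis by (simp add: G_def H_def)
  qed
  show ?thesis
  proof (rule ennreal_le_epsilon)
    fix e :: real
    assume fin: "integrated_dist F S P Q + integrated_dist F S Q R < top" and e: "0 < e"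
    define I where "I = (\<lambda>g. \<integral>\<^sup>+t\<in>{0..1}. ennreal (F (g t) (vector_derivative g (at t))) \<partial>lborel)"
    have eq: "integrated_dist F S P Q = (INF g\<in>curves_between S P Q. I g)" for P Q
      by (simp add: integrated_dist_def I_def)
    have ex: "\<exists>g\<in>curves_between S P Q. I g < integrated_dist F S P Q + ennreal (e / 2)"
      if "integrated_dist F S P Q < top" for P Q
    proof -
      have "integrated_dist F S P Q < integrated_dist F S P Q + ennreal (e / 2)"
        using that e by (cases "integrated_dist F S P Q") (auto simp: ennreal_plus[symmetric] ennreal_less_iff simp del: ennreal_plus)
      then show ?thesis unfolding eq[of P Q] by (simp add: INF_less_iff)
    qed
    obtain g where g: "g \<in> curves_between S P Q" "I g < integrated_dist F S P Q + ennreal (e / 2)"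
      using ex[of P Q] fin by (auto simp: less_top[symmetric])
    obtain h where h: "h \<in> curves_between S Q R" "I h < integrated_dist F S Q R + ennreal (e / 2)"
      using ex[of Q R] fin by (auto simp: less_top[symmetric])
    have "integrated_dist F S P R \<le> I g + I h" unfolding I_def by (rule main[OF g(1) h(1)])
    also have "\<dots> \<le> (integrated_dist F S P Q + ennreal (e / 2)) + (integrated_dist F S Q R + ennreal (e / 2))"
      using g(2) h(2) by (intro add_mono) auto
    also have "\<dots> = (integrated_dist F S P Q + integrated_dist F S Q R) + (ennreal (e / 2) + ennreal (e / 2))"
      by (simp only: ac_simps)
    also have "ennreal (e / 2) + ennreal (e / 2) = ennreal e" using e by (simp flip: ennreal_plus)
    finally show "integrated_dist F S P R \<le> integrated_dist F S P Q + integrated_dist F S Q R + ennreal e" .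
  qed
qed

section \<open>The Kobayashi metric and discs\<close>

lemma norm_vector_scalar_mult: "norm (c *s v) = cmod c * norm (v :: complex^'n)"
  by (simp add: norm_vec_def vector_scalar_mult_def norm_mult L2_set_right_distrib)

lemma of_real_vector_scalar_mult: "of_real x *s v = x *\<^sub>R (v :: complex^'n)"
  by (simp add: vec_eq_iff complex_eq_iff)

lemma holomorphic_disc_affine:
  fixes v :: "complex^'n"
  assumes "\<And>\<zeta>. cmod \<zeta> < 1 \<Longrightarrow> z + \<zeta> *s v \<in> \<Omega>"
  shows "holomorphic_disc \<Omega> (\<lambda>\<zeta>. z + \<zeta> *s v)" "disc_deriv (\<lambda>\<zeta>. z + \<zeta> *s v) \<zeta> = v"
proof -
  show "holomorphic_disc \<Omega> (\<lambda>\<zeta>. z + \<zeta> *s v)"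
    unfolding holomorphic_disc_def using assms by (auto intro!: holomorphic_intros)
  have "deriv (\<lambda>w. z $ i + w * v $ i) \<zeta> = v $ i" for i
    by (rule DERIV_imp_deriv) (auto intro!: derivative_eq_intros)
  then show "disc_deriv (\<lambda>\<zeta>. z + \<zeta> *s v) \<zeta> = v"
    by (simp add: disc_deriv_def vec_eq_iff)
qed

lemma kobayashi_metric_le:
  assumes "holomorphic_disc \<Omega> f" "f 0 = z" "\<alpha> > 0" "disc_deriv f 0 = \<xi> /\<^sub>R \<alpha>"
  shows "kobayashi_metric \<Omega> z \<xi> \<le> \<alpha>"
  unfolding kobayashi_metric_def
  by (rule cInf_lower) (use assms in \<open>auto intro!: bdd_belowI[of _ 0]\<close>)

text \<open>A lower bound of all competitors bounds the real infimum only if there is a competitor.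
  An affine disc inside a small ball around \<open>z\<close> provides one.\<close>

lemma kobayashi_metric_ge:
  assumes "open \<Omega>" "z \<in> \<Omega>"
    and "\<And>\<alpha> f. \<alpha> > 0 \<Longrightarrow> holomorphic_disc \<Omega> f \<Longrightarrow> f 0 = z \<Longrightarrow> disc_deriv f 0 = \<xi> /\<^sub>R \<alpha> \<Longrightarrow> \<beta> \<le> \<alpha>"
  shows "\<beta> \<le> kobayashi_metric \<Omega> z \<xi>"
  unfolding kobayashi_metric_def
proof (rule cInf_greatest)
  obtain e where e: "e > 0" "ball z e \<subseteq> \<Omega>" using assms(1,2) open_contains_ball by blast
  \<comment> \<open>The summand 1 keeps \<alpha> positive when \<open>\<xi> = 0\<close>.\<close>
  define \<alpha> where "\<alpha> = norm \<xi> / e + 1"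
  have \<alpha>: "\<alpha> > 0" using e by (simp add: \<alpha>_def add_nonneg_pos)
  have "norm \<xi> \<le> e * \<alpha>" using e by (simp add: \<alpha>_def field_simps)
  then have le: "norm (\<xi> /\<^sub>R \<alpha>) \<le> e" using \<alpha> by (simp add: field_simps)
  have "z + \<zeta> *s (\<xi> /\<^sub>R \<alpha>) \<in> \<Omega>" if "cmod \<zeta> < 1" for \<zeta>
  proof -
    have "cmod \<zeta> * norm (\<xi> /\<^sub>R \<alpha>) \<le> cmod \<zeta> * e" using le by (intro mult_left_mono) auto
    also have "\<dots> < e" using that e by simp
    finally have "z + \<zeta> *s (\<xi> /\<^sub>R \<alpha>) \<in> ball z e"
      by (simp only: mem_ball dist_norm norm_minus_commute) (simp add: norm_vector_scalar_mult)
    then show ?thesis using e by blast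
  qed
  from holomorphic_disc_affine[OF this]
  have "\<alpha> \<in> {\<alpha>. \<alpha> > 0 \<and> (\<exists>f. holomorphic_disc \<Omega> f \<and> f 0 = z \<and> disc_deriv f 0 = \<xi> /\<^sub>R \<alpha>)}"
    using \<alpha> by (intro CollectI conjI exI[of _ "\<lambda>\<zeta>. z + \<zeta> *s (\<xi> /\<^sub>R \<alpha>)"]) (auto simp: vec_eq_iff)
  then show "{\<alpha>. \<alpha> > 0 \<and> (\<exists>f. holomorphic_disc \<Omega> f \<and> f 0 = z \<and> disc_deriv f 0 = \<xi> /\<^sub>R \<alpha>)} \<noteq> {}" by blast
qed (use assms(3) in auto)

lemma kobayashi_metric_scaleR_le:
  assumes "open \<Omega>" "z \<in> \<Omega>" "c > 0"
  shows "kobayashi_metric \<Omega> z (c *\<^sub>R \<xi>) \<le> c * kobayashi_metric \<Omega> z \<xi>"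
proof -
  have "kobayashi_metric \<Omega> z (c *\<^sub>R \<xi>) / c \<le> kobayashi_metric \<Omega> z \<xi>"
  proof (rule kobayashi_metric_ge[OF assms(1,2)])
    fix \<alpha> f assume a: "\<alpha> > 0" "holomorphic_disc \<Omega> f" "f 0 = z" "disc_deriv f 0 = \<xi> /\<^sub>R \<alpha>"
    have "kobayashi_metric \<Omega> z (c *\<^sub>R \<xi>) \<le> c * \<alpha>"
      by (rule kobayashi_metric_le[OF a(2,3)]) (use a assms in \<open>auto simp: field_simps\<close>)
    then show "kobayashi_metric \<Omega> z (c *\<^sub>R \<xi>) / c \<le> \<alpha>" using assms(3) by (simp add: field_simps)
  qed
  then show ?thesis using assms(3) by (simp add: field_simps)
qed

text \<open>Precomposing \<phi> with the automorphism \<open>m\<close> of the disc that takes 0 to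
  \<zeta> recentres the disc at \<open>\<phi> \<zeta>\<close> and multiplies its derivative by
  \<open>1 - (cmod \<zeta>)^2\<close> up to rotation.\<close>

lemma kobayashi_metric_disc_deriv_le:
  assumes \<phi>: "holomorphic_disc \<Omega> \<phi>" and \<zeta>: "\<zeta> \<in> ball 0 1"
  shows "kobayashi_metric \<Omega> (\<phi> \<zeta>) (v *s disc_deriv \<phi> \<zeta>) \<le> cmod v / (1 - (cmod \<zeta>)\<^sup>2)"
proof -
  have \<zeta>1: "cmod \<zeta> < 1" using \<zeta> by simp
  then have pos: "1 - (cmod \<zeta>)\<^sup>2 > 0" by (simp add: abs_square_less_1)
  have hol: "(\<lambda>\<zeta>. \<phi> \<zeta> $ i) holomorphic_on ball 0 1" for i using \<phi> by (simp add: holomorphic_disc_def)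
  \<comment> \<open>The rotation by \<open>u\<close> gives the derivative at 0 the direction of
    \<open>v\<close>.\<close>
  define u where "u = (if v = 0 then 1 else v / of_real (cmod v))"
  have u: "cmod u = 1" by (simp add: u_def norm_divide)
  define m where "m = (\<lambda>w. (u * w + \<zeta>) / (1 + cnj \<zeta> * (u * w)))"
  have m1: "cmod (m w) < 1" if "cmod w < 1" for w
    using Moebius_function_norm_lt_1[of "-\<zeta>" "u * w" 0] \<zeta>1 that u
    by (simp add: Moebius_function_simple m_def norm_mult)
  have nz: "1 + cnj \<zeta> * (u * w) \<noteq> 0" if "cmod w < 1" for w
  proof
    assume "1 + cnj \<zeta> * (u * w) = 0"
    then have "cmod (cnj \<zeta> * (u * w)) = 1" by (metis add_eq_0_iff norm_minus_cancel norm_one)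
    moreover have "cmod (cnj \<zeta> * (u * w)) < 1 * 1"
      unfolding norm_mult complex_mod_cnj u using that \<zeta>1 by (intro mult_strict_mono') auto
    ultimately show False by simp
  qed
  have mh: "m holomorphic_on ball 0 1" unfolding m_def using nz by (auto intro!: holomorphic_intros)
  have m0: "m 0 = \<zeta>" by (simp add: m_def)
  have md: "(m has_field_derivative u * of_real (1 - (cmod \<zeta>)\<^sup>2)) (at 0)"
  proof -
    have "\<zeta> * cnj \<zeta> = of_real ((cmod \<zeta>)\<^sup>2)" by (simp add: complex_norm_square[symmetric])
    then show ?thesis unfolding m_def
      by (auto intro!: derivative_eq_intros simp: algebra_simps)
  qed
  define f where "f = (\<lambda>w. \<phi> (m w))"
  have f: "holomorphic_disc \<Omega> f"
    unfolding holomorphic_disc_def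
  proof (intro conjI allI)
    fix i
    have "(\<lambda>\<zeta>. \<phi> \<zeta> $ i) \<circ> m holomorphic_on ball 0 1"
      by (rule holomorphic_on_compose_gen[OF mh hol]) (use m1 in auto)
    then show "(\<lambda>\<zeta>. f \<zeta> $ i) holomorphic_on ball 0 1" by (simp add: f_def o_def)
    show "f ` ball 0 1 \<subseteq> \<Omega>" using \<phi> m1 unfolding holomorphic_disc_def f_def by fastforce
  qed
  have f': "disc_deriv f 0 = (u * of_real (1 - (cmod \<zeta>)\<^sup>2)) *s disc_deriv \<phi> \<zeta>"
    unfolding vec_eq_iff
  proof
    fix i
    have "((\<lambda>\<zeta>. \<phi> \<zeta> $ i) has_field_derivative deriv (\<lambda>\<zeta>. \<phi> \<zeta> $ i) \<zeta>) (at (m 0))"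
      unfolding m0 by (rule holomorphic_derivI[OF hol _ \<zeta>]) simp
    from DERIV_chain2[OF this md]
    have "deriv (\<lambda>w. f w $ i) 0 = deriv (\<lambda>\<zeta>. \<phi> \<zeta> $ i) \<zeta> * (u * of_real (1 - (cmod \<zeta>)\<^sup>2))"
      unfolding f_def by (rule DERIV_imp_deriv)
    then show "disc_deriv f 0 $ i = ((u * of_real (1 - (cmod \<zeta>)\<^sup>2)) *s disc_deriv \<phi> \<zeta>) $ i"
      by (simp add: disc_deriv_def mult.commute)
  qed
  show ?thesis
  proof (cases "v = 0")
    case False
    have "cmod v > 0" using False by simp
    show ?thesis
    proof (rule kobayashi_metric_le[OF f])
      show "0 < cmod v / (1 - (cmod \<zeta>)\<^sup>2)" using pos False by simp
      show "disc_deriv f 0 = (v *s disc_deriv \<phi> \<zeta>) /\<^sub>R (cmod v / (1 - (cmod \<zeta>)\<^sup>2))"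
        unfolding f' of_real_vector_scalar_mult[symmetric] using False by (simp add: vec_eq_iff u_def)
    qed (simp add: f_def m0)
  next
    case True
    show ?thesis
    proof (rule field_le_epsilon)
      fix e :: real assume e: "e > 0"
      \<comment> \<open>For \<open>v = 0\<close> the bound is 0, which is not an admissible value,
        but the constant disc admits every positive one.\<close>
      have c: "holomorphic_disc \<Omega> (\<lambda>w. \<phi> \<zeta>)"
        using \<phi> \<zeta> unfolding holomorphic_disc_def by (auto intro!: holomorphic_intros)
      have "kobayashi_metric \<Omega> (\<phi> \<zeta>) (v *s disc_deriv \<phi> \<zeta>) \<le> e"
        by (rule kobayashi_metric_le[OF c]) (use e True in \<open>auto simp: disc_deriv_def vec_eq_iff\<close>)
      then show "kobayashi_metric \<Omega> (\<phi> \<zeta>) (v *s disc_deriv \<phi> \<zeta>) \<le> cmod v / (1 - (cmod \<zeta>)\<^sup>2) + e"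
        using True by simp
    qed
  qed
qed

section \<open>Discs and chains do not increase distances\<close>

lemma holomorphic_disc_vector_derivative:
  fixes \<phi> :: "complex \<Rightarrow> complex^'n"
  assumes \<phi>: "holomorphic_disc \<Omega> \<phi>" and c: "(c has_vector_derivative d) (at t within X)" and ct: "c t \<in> ball 0 1"
  shows "((\<lambda>t. \<phi> (c t)) has_vector_derivative d *s disc_deriv \<phi> (c t)) (at t within X)"
proof -
  have lin: "bounded_linear (axis i :: complex \<Rightarrow> complex^'n)" for i
    unfolding linear_conv_bounded_linear[symmetric] by (rule linearI) (auto simp: vec_eq_iff axis_def)
  have comp: "((\<lambda>t. \<phi> (c t) $ i) has_vector_derivative d * disc_deriv \<phi> (c t) $ i) (at t within X)" for i
  proof -
    have "((\<lambda>\<zeta>. \<phi> \<zeta> $ i) has_field_derivative deriv (\<lambda>\<zeta>. \<phi> \<zeta> $ i) (c t)) (at (c t))"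
      by (rule holomorphic_derivI[OF _ _ ct]) (use \<phi> in \<open>auto simp: holomorphic_disc_def\<close>)
    then have "((\<lambda>\<zeta>. \<phi> \<zeta> $ i) has_field_derivative deriv (\<lambda>\<zeta>. \<phi> \<zeta> $ i) (c t)) (at (c t) within c ` X)"
      by (rule has_field_derivative_at_within)
    from field_vector_diff_chain_within[OF c this] show ?thesis
      by (simp add: o_def disc_deriv_def)
  qed
  have "((\<lambda>t. \<Sum>i\<in>UNIV. axis i (\<phi> (c t) $ i)) has_vector_derivative
      (\<Sum>i\<in>UNIV. axis i (d * disc_deriv \<phi> (c t) $ i))) (at t within X)"
    by (intro has_vector_derivative_sum bounded_linear.has_vector_derivative[OF lin comp])
  moreover have "(\<Sum>i\<in>UNIV. axis i (x $ i)) = x" for x :: "complex^'n"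
    by (simp add: vec_eq_iff axis_def if_distrib cong: if_cong)
  moreover have "(\<Sum>i\<in>UNIV. axis i (d * disc_deriv \<phi> (c t) $ i)) = d *s disc_deriv \<phi> (c t)"
    by (simp add: vec_eq_iff axis_def if_distrib cong: if_cong)
  ultimately show ?thesis by simp
qed

lemma continuous_on_disc_deriv:
  assumes "holomorphic_disc \<Omega> \<phi>"
  shows "continuous_on (ball 0 1) (disc_deriv \<phi>)"
  unfolding disc_deriv_def
proof (rule continuous_on_vec_lambda)
  fix i
  show "continuous_on (ball 0 1) (\<lambda>\<zeta>. deriv (\<lambda>w. \<phi> w $ i) \<zeta>)"
    by (intro holomorphic_on_imp_continuous_on holomorphic_deriv)
       (use assms in \<open>auto simp: holomorphic_disc_def\<close>)
qed

text \<open>A curve in the disc becomes an admissible curve in \<Omega> under \<phi>, and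
  \<open>kobayashi_metric_disc_deriv_le\<close> compares the two lengths pointwise off the break
  points.\<close>

lemma kobayashi_dist_disc_le:
  assumes \<phi>: "holomorphic_disc \<Omega> \<phi>"
  shows "kobayashi_dist \<Omega> (\<phi> a) (\<phi> b) \<le> poincare_dist a b"
  unfolding poincare_dist_def integrated_dist_def[of _ "ball 0 1"]
proof (rule INF_greatest)
  fix c assume c: "c \<in> curves_between (ball 0 1) a b"
  then have pc: "piecewise_C1_curve c" and cb: "c t \<in> ball 0 1" if "t \<in> {0..1}" for t
    using that unfolding curves_between_def by blast+
  have pc: "piecewise_C1_curve c" using c by (simp add: curves_between_def)
  have cont: "continuous_on {0..1} c" using pc by (simp add: piecewise_C1_curve_def)
  obtain m p where p: "p 0 = 0" "p m = 1"
    "\<And>i. i < m \<Longrightarrow> p i < p (Suc i) \<and> (\<exists>D. (\<forall>t\<in>{p i..p (Suc i)}. (c has_vector_derivative D t) (at t within {p i..p (Suc i)})) \<and>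
                continuous_on {p i..p (Suc i)} D)"
    using pc unfolding piecewise_C1_curve_def by metis
  have pmono: "p i \<le> p j" if "i \<le> j" "j \<le> m" for i j
    using that
  proof (induction j rule: dec_induct)
    case (step k) then show ?case using p(3)[of k] by fastforce
  qed simp
  have psub: "{p i..p (Suc i)} \<subseteq> {0..1}" if "i < m" for i
    using pmono[of 0 i] pmono[of "Suc i" m] p that by auto
  have cphi: "continuous_on (ball 0 1) \<phi>"
  proof -
    have "continuous_on (ball 0 1) (\<lambda>\<zeta>. \<chi> i. \<phi> \<zeta> $ i)"
      using \<phi> by (intro continuous_on_vec_lambda holomorphic_on_imp_continuous_on) (auto simp: holomorphic_disc_def)
    then show ?thesis by simp
  qed
  have "piecewise_C1_curve (\<lambda>t. \<phi> (c t))"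
    unfolding piecewise_C1_curve_def
  proof (intro conjI exI[of _ m] exI[of _ p] allI impI)
    show "continuous_on {0..1} (\<lambda>t. \<phi> (c t))"
      by (rule continuous_on_compose2[OF cphi cont]) (use cb in auto)
    fix i assume i: "i < m"
    then show "p i < p (Suc i)" using p(3) by blast
    obtain D where D: "\<And>t. t \<in> {p i..p (Suc i)} \<Longrightarrow> (c has_vector_derivative D t) (at t within {p i..p (Suc i)})"
      "continuous_on {p i..p (Suc i)} D" using p(3)[OF i] by blast
    have cc: "continuous_on {p i..p (Suc i)} c" using continuous_on_subset[OF cont psub[OF i]] .
    have cd: "continuous_on {p i..p (Suc i)} (\<lambda>t. disc_deriv \<phi> (c t))"
      by (rule continuous_on_compose2[OF continuous_on_disc_deriv[OF \<phi>] cc]) (use cb psub[OF i] in blast)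
    have "continuous_on {p i..p (Suc i)} (\<lambda>t. \<chi> j. D t * disc_deriv \<phi> (c t) $ j)"
      by (intro continuous_on_vec_lambda continuous_on_mult D(2) continuous_on_component cd)
    then have "continuous_on {p i..p (Suc i)} (\<lambda>t. D t *s disc_deriv \<phi> (c t))"
      by (simp add: vector_scalar_mult_def)
    then show "\<exists>D. (\<forall>t\<in>{p i..p (Suc i)}. ((\<lambda>t. \<phi> (c t)) has_vector_derivative D t) (at t within {p i..p (Suc i)})) \<and>
        continuous_on {p i..p (Suc i)} D"
      using holomorphic_disc_vector_derivative[OF \<phi> D(1)] cb psub[OF i]
      by (intro exI[of _ "\<lambda>t. D t *s disc_deriv \<phi> (c t)"]) blast
  qed (use p in auto)
  moreover have "(\<lambda>t. \<phi> (c t)) ` {0..1} \<subseteq> \<Omega>" using \<phi> cb unfolding holomorphic_disc_def by blast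
  ultimately have mem: "(\<lambda>t. \<phi> (c t)) \<in> curves_between \<Omega> (\<phi> a) (\<phi> b)"
    using c unfolding curves_between_def by auto
  obtain S where S: "finite S" "\<And>t. t \<in> {0..1} - S \<Longrightarrow> (c has_vector_derivative vector_derivative c (at t)) (at t)"
    using piecewise_C1_curve_imp[OF pc] by metis
  have AE: "AE t in lborel. t \<notin> S"
    using S(1) by (intro AE_not_in finite_imp_null_set_lborel)
  have "kobayashi_dist \<Omega> (\<phi> a) (\<phi> b) \<le>
      (\<integral>\<^sup>+t\<in>{0..1}. ennreal (kobayashi_metric \<Omega> (\<phi> (c t)) (vector_derivative (\<lambda>t. \<phi> (c t)) (at t))) \<partial>lborel)"
    unfolding kobayashi_dist_def integrated_dist_def by (rule INF_lower2[OF mem]) simp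
  also have "\<dots> \<le> (\<integral>\<^sup>+t\<in>{0..1}. ennreal (cmod (vector_derivative c (at t)) / (1 - (cmod (c t))\<^sup>2)) \<partial>lborel)"
  proof (intro nn_integral_mono_AE eventually_mono[OF AE])
    fix t assume t: "t \<notin> S"
    show "ennreal (kobayashi_metric \<Omega> (\<phi> (c t)) (vector_derivative (\<lambda>t. \<phi> (c t)) (at t))) * indicator {0..1} t
        \<le> ennreal (cmod (vector_derivative c (at t)) / (1 - (cmod (c t))\<^sup>2)) * indicator {0..1} t"
    proof (cases "t \<in> {0..1}")
      case True
      have "((\<lambda>t. \<phi> (c t)) has_vector_derivative vector_derivative c (at t) *s disc_deriv \<phi> (c t)) (at t)"
        using holomorphic_disc_vector_derivative[OF \<phi> S(2) cb[OF True]] True t by simp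
      then have "vector_derivative (\<lambda>t. \<phi> (c t)) (at t) = vector_derivative c (at t) *s disc_deriv \<phi> (c t)"
        by (rule vector_derivative_at)
      then show ?thesis
        using kobayashi_metric_disc_deriv_le[OF \<phi> cb[OF True]] by (auto intro!: mult_right_mono ennreal_leI)
    qed simp
  qed
  finally show "kobayashi_dist \<Omega> (\<phi> a) (\<phi> b) \<le>
    (\<integral>\<^sup>+t\<in>{0..1}. ennreal (cmod (vector_derivative c (at t)) / (1 - (cmod (c t))\<^sup>2)) \<partial>lborel)" .
qed

lemma kobayashi_dist_triangle:
  "open \<Omega> \<Longrightarrow> kobayashi_dist \<Omega> P R \<le> kobayashi_dist \<Omega> P Q + kobayashi_dist \<Omega> Q R"
  unfolding kobayashi_dist_def by (intro integrated_dist_triangle kobayashi_metric_scaleR_le)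

lemma kobayashi_dist_le_chain_length:
  assumes \<Omega>: "open \<Omega>" and ch: "kobayashi_chain \<Omega> P Q k \<phi> a b"
  shows "kobayashi_dist \<Omega> P Q \<le> chain_length k a b"
proof -
  have "j \<ge> 1 \<Longrightarrow> j \<le> k \<Longrightarrow> kobayashi_dist \<Omega> P (\<phi> j (b j)) \<le> chain_length j a b" for j
  proof (induction j rule: nat_induct)
    case (Suc j)
    have hd: "holomorphic_disc \<Omega> (\<phi> (Suc j))" using ch Suc.prems by (simp add: kobayashi_chain_def)
    show ?case
    proof (cases "j = 0")
      case True
      then show ?thesis
        using kobayashi_dist_disc_le[OF hd, of "a 1" "b 1"] ch by (simp add: kobayashi_chain_def chain_length_def)
    next
      case False
      have eq: "\<phi> j (b j) = \<phi> (Suc j) (a (Suc j))" using ch False Suc.prems by (simp add: kobayashi_chain_def)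
      have "kobayashi_dist \<Omega> P (\<phi> (Suc j) (b (Suc j))) \<le>
          kobayashi_dist \<Omega> P (\<phi> j (b j)) + kobayashi_dist \<Omega> (\<phi> j (b j)) (\<phi> (Suc j) (b (Suc j)))"
        by (rule kobayashi_dist_triangle[OF \<Omega>])
      also have "\<dots> \<le> chain_length j a b + poincare_dist (a (Suc j)) (b (Suc j))"
        unfolding eq using Suc False kobayashi_dist_disc_le[OF hd] eq by (intro add_mono) auto
      finally show ?thesis by (simp add: chain_length_def)
    qed
  qed simp
  from this[of k] show ?thesis using ch by (simp add: kobayashi_chain_def)
qed

text \<open>The length of the real segment, because \<open>artanh\<close> is an antiderivative of
  \<open>1 / (1 - x^2)\<close>. An upper bound suffices, as the Poincare distance enters only
  through chains that have to be short.\<close>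

lemma poincare_dist_of_real_le:
  assumes "-1 < x" "x \<le> y" "y < 1"
  shows "poincare_dist (of_real x) (of_real y) \<le> ennreal (artanh y - artanh x)"
proof -
  define c where "c = (\<lambda>t. complex_of_real (x + t * (y - x)))"
  have rng: "\<bar>x + t * (y - x)\<bar> < 1" if "t \<in> {0..1}" for t
  proof -
    have "x + t * (y - x) \<le> y" "x \<le> x + t * (y - x)"
      using that assms mult_left_le_one_le[of "y - x" t] by auto
    then show ?thesis using assms by auto
  qed
  have d: "(c has_vector_derivative of_real (y - x)) (at t within X)" for t X
    unfolding c_def
    by (rule has_vector_derivative_of_real) (auto intro!: derivative_eq_intros simp: has_real_derivative_iff_has_vector_derivative[symmetric])
  have "piecewise_C1_curve c" by (rule piecewise_C1_curveI[OF d]) auto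
  then have mem: "c \<in> curves_between (ball 0 1) (of_real x) (of_real y)"
    using rng by (auto simp: curves_between_def c_def simp flip: of_real_add of_real_mult of_real_diff)
  have vd: "vector_derivative c (at t) = of_real (y - x)" for t
    by (rule vector_derivative_at) (rule d)
  have nm: "cmod (c t) = \<bar>x + t * (y - x)\<bar>" for t by (simp only: c_def norm_of_real)
  have "poincare_dist (of_real x) (of_real y) \<le>
      (\<integral>\<^sup>+t\<in>{0..1}. ennreal (cmod (vector_derivative c (at t)) / (1 - (cmod (c t))\<^sup>2)) \<partial>lborel)"
    unfolding poincare_dist_def integrated_dist_def by (rule INF_lower[OF mem])
  also have "\<dots> = (\<integral>\<^sup>+t\<in>{0..1}. ennreal ((y - x) / (1 - (x + t * (y - x))\<^sup>2)) \<partial>lborel)"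
    using assms unfolding vd nm by (simp add: norm_of_real flip: of_real_diff)
  also have "\<dots> = ennreal (artanh (x + 1 * (y - x)) - artanh (x + 0 * (y - x)))"
  proof (rule nn_integral_FTC_Icc)
    show "(\<lambda>t. (y - x) / (1 - (x + t * (y - x))\<^sup>2)) \<in> borel_measurable borel" by measurable
  next
    fix t :: real assume t: "t \<in> {0..1}"
    then have r: "\<bar>x + t * (y - x)\<bar> < 1" using rng by simp
    show "((\<lambda>t. artanh (x + t * (y - x))) has_real_derivative (y - x) / (1 - (x + t * (y - x))\<^sup>2)) (at t)"
      by (rule DERIV_chain2[where g = "\<lambda>t. x + t * (y - x)", OF artanh_real_has_field_derivative[OF r], THEN DERIV_cong])
         (auto intro!: derivative_eq_intros)
    show "0 \<le> (y - x) / (1 - (x + t * (y - x))\<^sup>2)"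
      using r assms by (simp add: abs_square_less_1 less_imp_le)
  qed auto
  finally show ?thesis by simp
qed

section \<open>Defining functions and peak functions\<close>

text \<open>The Riesz representative of a functional; a vector is wanted in order to form Hermitian
  products and to move along the gradient.\<close>

definition rgrad :: "('a::euclidean_space \<Rightarrow>\<^sub>L real) \<Rightarrow> 'a" where
  "rgrad f = (\<Sum>b\<in>Basis. blinfun_apply f b *\<^sub>R b)"

lemma inner_rgrad: "rgrad f \<bullet> v = blinfun_apply f v"
proof -
  have "blinfun_apply f v = blinfun_apply f (\<Sum>b\<in>Basis. (v \<bullet> b) *\<^sub>R b)"
    by (simp add: euclidean_representation)
  also have "\<dots> = (\<Sum>b\<in>Basis. (v \<bullet> b) * blinfun_apply f b)"
    by (simp add: blinfun.sum_right blinfun.scaleR_right)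
  also have "\<dots> = rgrad f \<bullet> v"
    by (simp add: rgrad_def inner_sum_left inner_commute[of v] mult.commute)
  finally show ?thesis by simp
qed

lemma rgrad_diff: "rgrad f - rgrad g = rgrad (f - g)"
  by (simp add: rgrad_def blinfun.diff_left scaleR_diff_left sum_subtractf)

lemma norm_rgrad: "norm (rgrad f) = norm f"
proof (rule antisym)
  have "(norm (rgrad f))\<^sup>2 = blinfun_apply f (rgrad f)"
    by (simp add: inner_rgrad[symmetric] power2_norm_eq_inner)
  also have "\<dots> \<le> norm f * norm (rgrad f)" using norm_blinfun[of f "rgrad f"] by simp
  finally have "norm (rgrad f) * norm (rgrad f) \<le> norm f * norm (rgrad f)"
    by (simp add: power2_eq_square)
  then show "norm (rgrad f) \<le> norm f"
    by (cases "norm (rgrad f) = 0") (auto simp: mult_le_cancel_right)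
  show "norm f \<le> norm (rgrad f)"
    by (rule norm_blinfun_bound) (auto simp: inner_rgrad[symmetric] Cauchy_Schwarz_ineq2)
qed

section \<open>Taylor estimates\<close>

lemma first_order_taylor:
  fixes r :: "'a::euclidean_space \<Rightarrow> real"
  assumes d: "\<And>x. x \<in> cball z e \<Longrightarrow> (r has_derivative blinfun_apply (r' x)) (at x)"
    and d2: "\<And>x. x \<in> cball z e \<Longrightarrow> (r' has_derivative blinfun_apply (r'' x)) (at x)"
    and M: "\<And>x. x \<in> cball z e \<Longrightarrow> norm (r'' x) \<le> M" and v: "norm v \<le> e"
  shows "norm (r' (z + v) - r' z) \<le> M * norm v"
    and "\<bar>r (z + v) - r z - r' z v\<bar> \<le> M * (norm v)\<^sup>2"
proof -
  have lip: "norm (r' (z + u) - r' z) \<le> M * norm u" if "norm u \<le> e" for u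
  proof -
    have "norm (r' (z + u) - r' z) \<le> M * norm ((z + u) - z)"
    proof (rule differentiable_bound[where S = "cball z e" and f' = "\<lambda>x. blinfun_apply (r'' x)"])
      show "(r' has_derivative blinfun_apply (r'' x)) (at x within cball z e)" if "x \<in> cball z e" for x
        using d2[OF that] has_derivative_at_withinI by blast
      show "onorm (blinfun_apply (r'' x)) \<le> M" if "x \<in> cball z e" for x
        using M[OF that] by (simp add: norm_blinfun.rep_eq)
      show "z + u \<in> cball z e" using that by (simp add: dist_norm)
      show "z \<in> cball z e" using that norm_ge_zero[of u] by (simp del: norm_ge_zero)
    qed simp
    then show ?thesis by simp
  qed
  show "norm (r' (z + v) - r' z) \<le> M * norm v" by (rule lip[OF v])
  have M0: "M \<ge> 0" using M[of z] norm_ge_zero[of v] norm_ge_zero[of "r'' z"] v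
    by (meson centre_in_cball order_trans)
  have "norm ((r (z + v) - r' z (z + v)) - (r z - r' z z)) \<le> (M * norm v) * norm ((z + v) - z)"
  proof (rule differentiable_bound[where S = "cball z (norm v)" and f' = "\<lambda>x. blinfun_apply (r' x - r' z)"])
    fix x assume x: "x \<in> cball z (norm v)"
    then have xe: "x \<in> cball z e" using v by simp
    have "((\<lambda>x. r x - r' z x) has_derivative (\<lambda>h. r' x h - r' z h)) (at x)"
      by (intro has_derivative_diff d[OF xe] bounded_linear_imp_has_derivative blinfun.bounded_linear_right)
    moreover have DD: "blinfun_apply (r' x - r' z) = (\<lambda>h. r' x h - r' z h)" by (rule ext) (rule blinfun.diff_left)
    ultimately show "((\<lambda>x. r x - r' z x) has_derivative blinfun_apply (r' x - r' z)) (at x within cball z (norm v))"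
      unfolding DD by (auto intro: has_derivative_at_withinI)
    have "norm (r' (z + (x - z)) - r' z) \<le> M * norm (x - z)"
      by (rule lip) (use xe in \<open>simp add: dist_norm norm_minus_commute\<close>)
    also have "\<dots> \<le> M * norm v"
      using x M0 by (intro mult_left_mono) (auto simp: dist_norm norm_minus_commute)
    finally show "onorm (blinfun_apply (r' x - r' z)) \<le> M * norm v" by (simp add: norm_blinfun.rep_eq)
  qed (auto simp: dist_norm)
  then show "\<bar>r (z + v) - r z - r' z v\<bar> \<le> M * (norm v)\<^sup>2"
    by (simp add: blinfun.add_right power2_eq_square algebra_simps)
qed

text \<open>With \<open>r\<close> merely C2, the remainder is measured by the oscillation
  \<open>e\<close> of the second derivative. The mean value inequality is used twice, for
  \<open>r'\<close> minus its linear part and then for \<open>r\<close> along the segment.\<close>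

lemma second_order_taylor:
  fixes r :: "'a::euclidean_space \<Rightarrow> real"
  assumes d: "\<And>x. x \<in> cball p (norm w) \<Longrightarrow> (r has_derivative blinfun_apply (r' x)) (at x)"
    and d2: "\<And>x. x \<in> cball p (norm w) \<Longrightarrow> (r' has_derivative blinfun_apply (r'' x)) (at x)"
    and e: "\<And>x. x \<in> cball p (norm w) \<Longrightarrow> norm (r'' x - r'' p) \<le> e"
  shows "\<bar>r (p + w) - r p - r' p w - r'' p w w / 2\<bar> \<le> e * (norm w)\<^sup>2"
proof -
  have e0: "e \<ge> 0" using e[of p] by simp
  have seg: "p + t *\<^sub>R w \<in> cball p (norm w)" if "t \<in> {0..1}" for t
    using that by (simp add: dist_norm mult_left_le_one_le)
  have lip: "norm (r' (p + t *\<^sub>R w) - r' p - t *\<^sub>R r'' p w) \<le> e * norm w" if t: "t \<in> {0..1}" for t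
  proof -
    have "norm ((r' (p + t *\<^sub>R w) - r'' p (p + t *\<^sub>R w)) - (r' p - r'' p p)) \<le> e * norm ((p + t *\<^sub>R w) - p)"
    proof (rule differentiable_bound[where S = "cball p (norm w)" and f' = "\<lambda>x. blinfun_apply (r'' x - r'' p)"])
      fix x assume x: "x \<in> cball p (norm w)"
      have "((\<lambda>x. r' x - r'' p x) has_derivative (\<lambda>h. r'' x h - r'' p h)) (at x)"
        by (intro has_derivative_diff d2[OF x] bounded_linear_imp_has_derivative blinfun.bounded_linear_right)
      moreover have DD: "blinfun_apply (r'' x - r'' p) = (\<lambda>h. r'' x h - r'' p h)" by (rule ext) (rule blinfun.diff_left)
      ultimately show "((\<lambda>x. r' x - r'' p x) has_derivative blinfun_apply (r'' x - r'' p)) (at x within cball p (norm w))"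
        unfolding DD by (auto intro: has_derivative_at_withinI)
      show "onorm (blinfun_apply (r'' x - r'' p)) \<le> e" using e[OF x] by (simp add: norm_blinfun.rep_eq)
    qed (use seg[OF t] in auto)
    also have "\<dots> \<le> e * norm w" using t e0 by (auto intro!: mult_left_mono mult_left_le_one_le)
    finally show ?thesis by (simp add: blinfun.add_right blinfun.scaleR_right algebra_simps)
  qed
  define h where "h = (\<lambda>t. r (p + t *\<^sub>R w) - t * r' p w - t\<^sup>2 / 2 * r'' p w w)"
  have "norm (h 1 - h 0) \<le> (e * norm w * norm w) * norm (1 - 0 :: real)"
  proof (rule differentiable_bound[where S = "{0..1}" and
        f' = "\<lambda>t s. s * (r' (p + t *\<^sub>R w) w - r' p w - t * r'' p w w)"])
    fix t :: real assume t: "t \<in> {0..1}"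
    have "((\<lambda>t. r (p + t *\<^sub>R w)) has_derivative (\<lambda>s. r' (p + t *\<^sub>R w) (s *\<^sub>R w))) (at t within {0..1})"
      by (rule has_derivative_compose[where f = "\<lambda>t. p + t *\<^sub>R w", OF _ d[OF seg[OF t]]])
         (auto intro!: derivative_eq_intros)
    moreover have "((\<lambda>t. t * r' p w + t\<^sup>2 / 2 * r'' p w w) has_derivative (\<lambda>s. s * (r' p w + t * r'' p w w))) (at t within {0..1})"
      by (auto intro!: derivative_eq_intros simp: algebra_simps)
    ultimately have "((\<lambda>t. r (p + t *\<^sub>R w) - (t * r' p w + t\<^sup>2 / 2 * r'' p w w)) has_derivative
       (\<lambda>s. r' (p + t *\<^sub>R w) (s *\<^sub>R w) - s * (r' p w + t * r'' p w w))) (at t within {0..1})"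
      by (rule has_derivative_diff)
    then show "(h has_derivative (\<lambda>s. s * (r' (p + t *\<^sub>R w) w - r' p w - t * r'' p w w))) (at t within {0..1})"
      by (simp add: h_def blinfun.scaleR_right algebra_simps)
    have "\<bar>r' (p + t *\<^sub>R w) w - r' p w - t * r'' p w w\<bar> = norm ((r' (p + t *\<^sub>R w) - r' p - t *\<^sub>R r'' p w) w)"
      by (simp add: blinfun.diff_left blinfun.scaleR_left)
    also have "\<dots> \<le> norm (r' (p + t *\<^sub>R w) - r' p - t *\<^sub>R r'' p w) * norm w" by (rule norm_blinfun)
    also have "\<dots> \<le> e * norm w * norm w" using lip[OF t] by (intro mult_right_mono) auto
    finally have b: "\<bar>r' (p + t *\<^sub>R w) w - r' p w - t * r'' p w w\<bar> \<le> e * norm w * norm w" .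
    show "onorm (\<lambda>s. s * (r' (p + t *\<^sub>R w) w - r' p w - t * r'' p w w)) \<le> e * norm w * norm w"
      by (rule onorm_le) (use b in \<open>simp add: abs_mult mult.commute mult_left_mono\<close>)
  qed auto
  then show ?thesis by (simp add: h_def power2_eq_square algebra_simps)
qed

text \<open>Where \<open>L\<close> is not positive, \<open>A\<close> has a positive minimum by
  compactness, and a large multiple of it outweighs \<open>L\<close>. It serves to turn positivity
  of the Levi form on complex tangent vectors into uniform positivity of a modified form.\<close>

lemma compact_positive_combination:
  fixes L A :: "'a::metric_space \<Rightarrow> real"
  assumes S: "compact S" and L: "continuous_on S L" and A: "continuous_on S A"
    and A0: "\<And>x. x \<in> S \<Longrightarrow> A x \<ge> 0" and pos: "\<And>x. x \<in> S \<Longrightarrow> A x = 0 \<Longrightarrow> L x > 0"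
  shows "\<exists>K c. K \<ge> 0 \<and> c > 0 \<and> (\<forall>x\<in>S. L x + K * A x \<ge> c)"
proof (cases "S = {}")
  case True then show ?thesis by (auto intro: exI[of _ 1])
next
  case False
  have "\<exists>K\<ge>0. \<forall>x\<in>S. L x + K * A x > 0"
  proof (cases "\<exists>x\<in>S. L x \<le> 0")
    case True
    define T where "T = {x\<in>S. L x \<le> 0}"
    have "closedin (top_of_set S) (S \<inter> L -` {..0})" by (rule continuous_closedin_preimage[OF L]) simp
    then have "compact (S \<inter> L -` {..0})" using S closedin_compact by blast
    moreover have "S \<inter> L -` {..0} = T" by (auto simp: T_def)
    ultimately have cT: "compact T" by simp
    have neT: "T \<noteq> {}" using True by (auto simp: T_def)
    have TS: "T \<subseteq> S" by (auto simp: T_def)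
    obtain x0 where x0: "x0 \<in> T" "\<And>x. x \<in> T \<Longrightarrow> A x0 \<le> A x"
      using continuous_attains_inf[OF cT neT continuous_on_subset[OF A TS]] by blast
    obtain x1 where x1: "x1 \<in> T" "\<And>x. x \<in> T \<Longrightarrow> L x1 \<le> L x"
      using continuous_attains_inf[OF cT neT continuous_on_subset[OF L TS]] by blast
    have a0: "A x0 > 0" using x0(1) A0[of x0] pos[of x0] unfolding T_def by force
    \<comment> \<open>Chosen so that on \<open>T\<close>, where \<open>L \<ge> L x1\<close> and
      \<open>A \<ge> A x0\<close>, the sum is at least 1.\<close>
    define K where "K = (1 - L x1) / A x0"
    have l0: "K \<ge> 0" using x1(1) a0 by (simp add: K_def T_def)
    have "L x + K * A x > 0" if x: "x \<in> S" for x
    proof (cases "x \<in> T")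
      case True
      have "K * A x \<ge> K * A x0" using x0(2)[OF True] l0 by (rule mult_left_mono)
      also have "K * A x0 = 1 - L x1" using a0 by (simp add: K_def)
      finally show ?thesis using x1(2)[OF True] by simp
    next
      case False
      then have "L x > 0" using x by (auto simp: T_def)
      then show ?thesis using l0 A0[OF x] by (simp add: add_pos_nonneg)
    qed
    then show ?thesis using l0 by blast
  next
    case False
    then show ?thesis by (intro exI[of _ 0]) auto
  qed
  then obtain K where l: "K \<ge> 0" "\<And>x. x \<in> S \<Longrightarrow> L x + K * A x > 0" by blast
  have "continuous_on S (\<lambda>x. L x + K * A x)" by (intro continuous_intros L A)
  then obtain y where "y \<in> S" "\<And>x. x \<in> S \<Longrightarrow> L y + K * A y \<le> L x + K * A x"
    using continuous_attains_inf[OF S False] by blast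
  then show ?thesis using l by (intro exI[of _ K] exI[of _ "L y + K * A y"]) auto
qed

section \<open>Hermitian product, Levi form and Levi polynomial\<close>

text \<open>The conjugate is on the first factor, so that the value depends holomorphically on
  \<open>v\<close>. If \<open>G\<close> is the real gradient of \<open>r\<close>, this is twice the
  (1,0)-part of \<open>dr\<close> at \<open>v\<close>.\<close>

definition herm :: "complex^'n \<Rightarrow> complex^'n \<Rightarrow> complex" where
  "herm G v = (\<Sum>j\<in>UNIV. cnj (G $ j) * v $ j)"

lemma Re_herm: "Re (herm G v) = G \<bullet> v"
  by (simp add: herm_def inner_vec_def inner_complex_def)

lemma herm_scale: "herm G (c *s v) = c * herm G v"
  by (simp add: herm_def sum_distrib_left algebra_simps)

lemma herm_diff: "herm G (v - w) = herm G v - herm G w" "herm (G - H) v = herm G v - herm H v"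
  by (simp_all add: herm_def sum_subtractf algebra_simps)

lemma herm_self: "herm G G = of_real ((norm G)\<^sup>2)"
proof -
  have "cnj x * x = of_real ((cmod x)\<^sup>2)" for x by (simp add: complex_norm_square mult.commute del: of_real_power)
  then show ?thesis
    unfolding herm_def norm_vec_def L2_set_def by (simp add: sum_nonneg del: of_real_power)
qed

lemma norm_herm_le: "cmod (herm G v) \<le> norm G * norm v"
proof -
  have "cmod (herm G v) \<le> (\<Sum>j\<in>UNIV. cmod (G $ j) * cmod (v $ j))"
    unfolding herm_def by (rule order_trans[OF norm_sum]) (simp add: norm_mult)
  also have "\<dots> \<le> norm G * norm v"
    unfolding norm_vec_def by (rule order_trans[OF _ L2_set_mult_ineq]) simp
  finally show ?thesis .
qed

lemma axis_expansion:
  "(w :: complex^'n) = (\<Sum>j\<in>UNIV. Re (w $ j) *\<^sub>R axis j 1 + Im (w $ j) *\<^sub>R axis j \<i>)"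
  by (auto simp: vec_eq_iff axis_def complex_eq_iff if_distrib cong: if_cong)

lemma bilinear_axis_expansion:
  fixes B :: "(complex^'n) \<Rightarrow>\<^sub>L ((complex^'n) \<Rightarrow>\<^sub>L real)"
  shows "B w w = (\<Sum>j\<in>UNIV. \<Sum>k\<in>UNIV.
     Re (w $ j) * Re (w $ k) * B (axis j 1) (axis k 1) + Re (w $ j) * Im (w $ k) * B (axis j 1) (axis k \<i>)
     + Im (w $ j) * Re (w $ k) * B (axis j \<i>) (axis k 1) + Im (w $ j) * Im (w $ k) * B (axis j \<i>) (axis k \<i>))"
  apply (subst (1 2) axis_expansion[of w])
  apply (simp only: blinfun.sum_right blinfun.sum_left blinfun.add_right blinfun.add_left
      blinfun.scaleR_right blinfun.scaleR_left real_scaleR_def sum_distrib_left)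
  apply (subst sum.swap)
  apply (intro sum.cong refl)
  apply (simp add: algebra_simps sum.distrib)
  done

text \<open>Adding the Hessian at \<open>w\<close> and at \<open>\<i> *s w\<close> cancels the parts
  that are complex quadratic in \<open>w\<close> or in its conjugate; the mixed derivatives
  remain.\<close>

lemma levi_form_eq:
  fixes r :: "complex^'n \<Rightarrow> real"
  assumes U: "open U" "p \<in> U"
    and d: "\<And>x. x \<in> U \<Longrightarrow> (r has_derivative blinfun_apply (r' x)) (at x)"
    and d2: "(r' has_derivative blinfun_apply (r'' p)) (at p)"
  shows "levi_form r p w = (r'' p w w + r'' p (\<i> *s w) (\<i> *s w)) / 4"
proof -
  have fd: "frechet_derivative (\<lambda>z. complex_of_real (r z)) (at x) = (\<lambda>v. of_real (r' x v))" if "x \<in> U" for x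
    by (rule frechet_derivative_at[symmetric]) (intro has_derivative_of_real d that)
  define h where "h = (\<lambda>k x. (complex_of_real (r' x (axis k 1)) + \<i> * of_real (r' x (axis k \<i>))) / 2)"
  have dzb: "d_zbar k (\<lambda>z. of_real (r z)) x = h k x" if "x \<in> U" for k x
    by (simp add: d_zbar_def fd[OF that] h_def)
  have "(d_zbar k (\<lambda>z. of_real (r z)) has_derivative
      (\<lambda>v. (complex_of_real (r'' p v (axis k 1)) + \<i> * of_real (r'' p v (axis k \<i>))) / 2)) (at p)" for k
  \<comment> \<open>The formula \<open>dzb\<close> holds on the open set \<open>U\<close> and not
    just at \<open>p\<close>, so it may be differentiated once more.\<close>
  proof (rule has_derivative_transform_within_open[OF _ U])
    have b: "((\<lambda>x. r' x a) has_derivative (\<lambda>v. r'' p v a)) (at p)" for a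
      by (rule bounded_linear.has_derivative[OF blinfun.bounded_linear_left d2])
    show "(h k has_derivative (\<lambda>v. (complex_of_real (r'' p v (axis k 1)) + \<i> * of_real (r'' p v (axis k \<i>))) / 2)) (at p)"
      unfolding h_def
      by (intro has_derivative_add has_derivative_of_real b has_derivative_mult_right
          bounded_linear.has_derivative[OF bounded_linear_divide])
  qed (use dzb in auto)
  then have fd2: "frechet_derivative (d_zbar k (\<lambda>z. of_real (r z))) (at p) =
      (\<lambda>v. (complex_of_real (r'' p v (axis k 1)) + \<i> * of_real (r'' p v (axis k \<i>))) / 2)" for k
    by (rule frechet_derivative_at[symmetric])
  show ?thesis
    unfolding levi_form_def d_z_def fd2 bilinear_axis_expansion[of "r'' p" w]
      bilinear_axis_expansion[of "r'' p" "\<i> *s w"] Re_sum sum.distrib[symmetric] sum_divide_distrib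
    by (intro sum.cong refl) (simp add: field_simps)
qed

lemma complex_tangent_iff:
  fixes r :: "complex^'n \<Rightarrow> real"
  assumes d: "(r has_derivative blinfun_apply r') (at p)"
  shows "w \<in> complex_tangent r p \<longleftrightarrow> herm (rgrad r') w = 0"
proof -
  have fd: "frechet_derivative (\<lambda>z. complex_of_real (r z)) (at p) = (\<lambda>v. of_real (r' v))"
    by (rule frechet_derivative_at[symmetric]) (intro has_derivative_of_real d)
  have dz: "d_z j (\<lambda>z. of_real (r z)) p = cnj (rgrad r' $ j) / 2" for j
  proof -
    have "rgrad r' \<bullet> axis j a = rgrad r' $ j \<bullet> a" for a
      by (simp add: inner_vec_def axis_def if_distrib cong: if_cong)
    then show ?thesis
      unfolding d_z_def fd inner_rgrad[symmetric] by (simp add: inner_complex_def complex_eq_iff)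
  qed
  have eq: "(\<Sum>j\<in>UNIV. d_z j (\<lambda>z. of_real (r z)) p * w $ j) = herm (rgrad r') w / 2"
    unfolding dz herm_def sum_divide_distrib by simp
  show ?thesis unfolding complex_tangent_def mem_Collect_eq eq by simp
qed

text \<open>
  If \<open>G\<close> and \<open>B\<close> are the first and the second derivative of \<open>r\<close> at \<open>p\<close>, then
  \<open>herm G w + quad B w\<close> is the Levi polynomial: its real part and the Levi form at \<open>w\<close> add up to
  the second order Taylor polynomial of \<open>r (p + w)\<close>.
\<close>

definition quad :: "((complex^'n) \<Rightarrow>\<^sub>L ((complex^'n) \<Rightarrow>\<^sub>L real)) \<Rightarrow> complex^'n \<Rightarrow> complex" where
  "quad B w = (\<Sum>j\<in>UNIV. \<Sum>k\<in>UNIV.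
     Complex (B (axis j 1) (axis k 1) - B (axis j \<i>) (axis k \<i>))
             (- (B (axis j 1) (axis k \<i>) + B (axis j \<i>) (axis k 1))) / 4 * (w $ j * w $ k))"

lemma Re_quad: "Re (quad B w) = (B w w - B (\<i> *s w) (\<i> *s w)) / 4"
  unfolding quad_def bilinear_axis_expansion[of B w] bilinear_axis_expansion[of B "\<i> *s w"]
    Re_sum sum_subtractf[symmetric] sum_divide_distrib
  by (intro sum.cong refl) (simp add: field_simps)

lemma quad_scale: "quad B (c *s w) = c\<^sup>2 * quad B w"
  unfolding quad_def sum_distrib_left by (intro sum.cong refl) (simp add: power2_eq_square)

text \<open>\<open>quad B\<close> is homogeneous of degree two, so a rotation of \<open>w\<close> by
  the unit number \<open>u\<close>, a square root of \<open>cnj q / |q|\<close>, makes its value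
  real and nonnegative. There \<open>Re_quad\<close> bounds it by the Hessian.\<close>

lemma norm_quad_le: "cmod (quad B w) \<le> norm B * (norm w)\<^sup>2"
proof (cases "quad B w = 0")
  case False
  define q where "q = quad B w"
  define u where "u = csqrt (cnj q / of_real (cmod q))"
  have u2: "u\<^sup>2 = cnj q / of_real (cmod q)" by (simp add: u_def)
  have "(cmod u)\<^sup>2 = 1" using False by (simp add: norm_power[symmetric] u2 norm_divide q_def)
  then have u1: "cmod u = 1" by (simp add: power2_eq_1_iff) (smt (verit) norm_ge_zero)
  have "quad B (u *s w) = cnj q * q / of_real (cmod q)" by (simp add: quad_scale u2 q_def)
  also have "cnj q * q = of_real (cmod q) * of_real (cmod q)"
    using complex_norm_square[of q] by (simp add: mult.commute power2_eq_square)
  finally have "quad B (u *s w) = of_real (cmod q)" using False by (simp add: q_def)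
  then have "cmod q = Re (quad B (u *s w))" by simp
  also have "\<dots> \<le> (\<bar>B (u *s w) (u *s w)\<bar> + \<bar>B (\<i> *s (u *s w)) (\<i> *s (u *s w))\<bar>) / 4"
    unfolding Re_quad by simp
  also have "\<dots> \<le> (norm B * (norm w)\<^sup>2 + norm B * (norm w)\<^sup>2) / 4"
  proof -
    have "\<bar>B x x\<bar> \<le> norm B * (norm w)\<^sup>2" if "norm x = norm w" for x
    proof -
      have "\<bar>B x x\<bar> \<le> norm (B x) * norm x" using norm_blinfun[of "B x" x] by simp
      also have "\<dots> \<le> (norm B * norm x) * norm x" by (intro mult_right_mono norm_blinfun) auto
      finally show ?thesis using that by (simp add: power2_eq_square mult.assoc)
    qed
    then show ?thesis using u1 by (intro divide_right_mono add_mono) (auto simp: norm_vector_scalar_mult norm_mult)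
  qed
  also have "\<dots> \<le> norm B * (norm w)\<^sup>2" by simp
  finally show ?thesis by (simp add: q_def)
qed simp

text \<open>All that is used later of the geometry. \<rho> is the width of the collar in which
  \<open>r\<close> and its gradient \<open>G\<close> are controlled, \<open>m\<close> and
  \<open>M\<close> bound the gradient, and \<open>M\<close> is also the common constant of the error
  terms. \<open>g p\<close> is the peak function at \<open>p\<close>, usable within \<eta> of
  \<open>p\<close>, with coercivity \<open>c\<close>. Base point \<open>z\<close> and displacement
  \<open>v\<close> are separate, as later arguments expand \<open>r\<close> at interior points
  too.\<close>

locale spc_domain =
  fixes \<Omega> :: "(complex^'n) set" and r :: "complex^'n \<Rightarrow> real" and G :: "complex^'n \<Rightarrow> complex^'n"
    and g :: "complex^'n \<Rightarrow> complex^'n \<Rightarrow> complex" and \<rho> m M c \<eta> :: real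
  assumes open_dom: "open \<Omega>" and connected_dom: "connected \<Omega>" and bounded_dom: "bounded \<Omega>"
    and dom_nonempty: "\<Omega> \<noteq> {}"
    and const_bounds: "0 < \<rho>" "\<rho> \<le> 1" "0 < m" "m \<le> 1" "1 \<le> M" "0 < c" "0 < \<eta>" "\<eta> \<le> \<rho>"
    and mem_iff: "\<And>z v. infdist z (frontier \<Omega>) \<le> \<rho> \<Longrightarrow> norm v \<le> \<rho> \<Longrightarrow> z + v \<in> \<Omega> \<longleftrightarrow> r (z + v) < 0"
    and r_taylor: "\<And>z v. infdist z (frontier \<Omega>) \<le> \<rho> \<Longrightarrow> norm v \<le> \<rho> \<Longrightarrow>
        \<bar>r (z + v) - r z - G z \<bullet> v\<bar> \<le> M * (norm v)\<^sup>2"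
    and G_lipschitz: "\<And>z v. infdist z (frontier \<Omega>) \<le> \<rho> \<Longrightarrow> norm v \<le> \<rho> \<Longrightarrow> norm (G (z + v) - G z) \<le> M * norm v"
    and G_bounds: "\<And>z. infdist z (frontier \<Omega>) \<le> \<rho> \<Longrightarrow> m \<le> norm (G z) \<and> norm (G z) \<le> M"
    and r_frontier: "\<And>p. p \<in> frontier \<Omega> \<Longrightarrow> r p = 0"
    and g_holomorphic: "\<And>p f S. (\<And>i. (\<lambda>\<zeta>. f \<zeta> $ i) holomorphic_on S) \<Longrightarrow> (\<lambda>\<zeta>. g p (f \<zeta>)) holomorphic_on S"
    and g_differentiable: "\<And>p z. g p differentiable (at z)"
    and g_upper: "\<And>p z. p \<in> frontier \<Omega> \<Longrightarrow> z \<in> \<Omega> \<Longrightarrow> norm (z - p) \<le> \<eta> \<Longrightarrow>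
        Re (g p z) \<le> r z / 2 - c * (norm (z - p))\<^sup>2"
    and g_approx: "\<And>p z. p \<in> frontier \<Omega> \<Longrightarrow> norm (z - p) \<le> \<eta> \<Longrightarrow>
        cmod (g p z - herm (G p) (z - p)) \<le> M * (norm (z - p))\<^sup>2"

text \<open>
  The last term of the peak function is the holomorphic part of \<open>2 * l * r\<^sup>2\<close>. Passing from \<open>r\<close> to
  \<open>r + 2 * l * r\<^sup>2\<close> makes the Levi form positive in the complex normal direction too.
\<close>

lemma peak_function_upper:
  fixes w :: "complex^'n" and B :: "(complex^'n) \<Rightarrow>\<^sub>L ((complex^'n) \<Rightarrow>\<^sub>L real)"
  assumes l: "l \<ge> 0" and M: "M \<ge> 1" and c0: "c0 > 0"
    and rneg: "r < 0" and w1: "norm w \<le> 1"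
    and t1: "\<bar>r - G \<bullet> w\<bar> \<le> M * (norm w)\<^sup>2" and GM: "norm G \<le> M"
    and t2: "\<bar>r - G \<bullet> w - B w w / 2\<bar> \<le> c0 / 4 * (norm w)\<^sup>2"
    and L: "(B w w + B (\<i> *s w) (\<i> *s w)) / 4 + l * (cmod (herm G w))\<^sup>2 \<ge> c0 * (norm w)\<^sup>2"
    and w2: "8 * l * M * norm w \<le> 1" and w3: "24 * l * M\<^sup>2 * norm w \<le> c0"
  shows "Re (herm G w + quad B w + of_real l * (herm G w)\<^sup>2) \<le> r / 2 - c0 / 2 * (norm w)\<^sup>2"
proof -
  define n where "n = norm w"
  define a where "a = G \<bullet> w"
  have n0: "n \<ge> 0" by (simp add: n_def)
  have a: "\<bar>a\<bar> \<le> M * n"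
    using Cauchy_Schwarz_ineq2[of G w] mult_right_mono[OF GM, of "norm w"] by (simp add: a_def n_def)
  have nn: "n\<^sup>2 \<le> n" using w1 n0 by (simp add: n_def power2_eq_square mult_left_le_one_le)
  have ra: "\<bar>r\<bar> \<le> 2 * (M * n)"
  proof -
    have "M * n\<^sup>2 \<le> M * n" using nn M by (intro mult_left_mono) auto
    then show ?thesis using t1 a unfolding a_def[symmetric] n_def[symmetric] by linarith
  qed
  have h: "(cmod (herm G w))\<^sup>2 + Re ((herm G w)\<^sup>2) = 2 * a\<^sup>2"
    unfolding cmod_power2 Re_power2 Re_herm a_def by simp
  \<comment> \<open>Half of \<open>r\<close> is sacrificed to the correction
    \<open>2 * l * r^2\<close>, which is of higher order near the boundary. This is why only
    \<open>r / 2\<close> remains in the bound.\<close>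
  have r2: "2 * l * r\<^sup>2 \<le> - r / 2"
  proof -
    have "2 * l * r\<^sup>2 = (2 * l * \<bar>r\<bar>) * \<bar>r\<bar>" by (simp add: power2_eq_square)
    also have "\<dots> \<le> (2 * l * (2 * (M * n))) * \<bar>r\<bar>" using ra l by (intro mult_right_mono mult_left_mono) auto
    also have "\<dots> \<le> 1 / 2 * \<bar>r\<bar>" using w2 by (intro mult_right_mono) (auto simp: n_def)
    finally show ?thesis using rneg by simp
  qed
  \<comment> \<open>\<open>a\<close> is the linear part of \<open>r\<close>, so \<open>a - r\<close>
    is of second order and \<open>a^2 - r^2\<close> of third order in \<open>w\<close>; for small
    \<open>w\<close> a quarter of the coercivity covers it. Another quarter goes to the Taylor
    remainder \<open>t2\<close>.\<close>
  have d2: "2 * l * (a\<^sup>2 - r\<^sup>2) \<le> c0 / 4 * n\<^sup>2"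
  proof -
    have "a\<^sup>2 - r\<^sup>2 = (a - r) * (a + r)" by (simp add: power2_eq_square algebra_simps)
    also have "\<dots> \<le> \<bar>a - r\<bar> * \<bar>a + r\<bar>" using abs_ge_self[of "(a - r) * (a + r)"] by (simp add: abs_mult)
    also have "\<dots> \<le> (M * n\<^sup>2) * (3 * (M * n))"
      using t1 a ra unfolding a_def[symmetric] n_def[symmetric] by (intro mult_mono) auto
    finally have "2 * l * (a\<^sup>2 - r\<^sup>2) \<le> 2 * l * ((M * n\<^sup>2) * (3 * (M * n)))" using l by (intro mult_left_mono) auto
    also have "\<dots> = (24 * l * M\<^sup>2 * n) / 4 * n\<^sup>2" by (simp add: power2_eq_square)
    also have "\<dots> \<le> c0 / 4 * n\<^sup>2"
      using w3[folded n_def] by (intro mult_right_mono divide_right_mono) simp_all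
    finally show ?thesis .
  qed
  have "Re (herm G w + quad B w + of_real l * (herm G w)\<^sup>2) =
      a + (B w w / 2 - (B w w + B (\<i> *s w) (\<i> *s w)) / 4) + l * (2 * a\<^sup>2 - (cmod (herm G w))\<^sup>2)"
  proof -
    have "Re (herm G w + quad B w + of_real l * (herm G w)\<^sup>2) = a + Re (quad B w) + l * Re ((herm G w)\<^sup>2)"
      by (simp add: Re_herm a_def)
    moreover have "Re ((herm G w)\<^sup>2) = 2 * a\<^sup>2 - (cmod (herm G w))\<^sup>2" using h by linarith
    moreover have "Re (quad B w) = B w w / 2 - (B w w + B (\<i> *s w) (\<i> *s w)) / 4"
      by (simp add: Re_quad field_simps)
    ultimately show ?thesis by presburger
  qed
  also have "\<dots> = (a + B w w / 2) - ((B w w + B (\<i> *s w) (\<i> *s w)) / 4 + l * (cmod (herm G w))\<^sup>2)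
      + 2 * l * r\<^sup>2 + 2 * l * (a\<^sup>2 - r\<^sup>2)" by (simp add: algebra_simps)
  also have "\<dots> \<le> r / 2 - c0 / 2 * n\<^sup>2"
    using t2 L r2 d2 unfolding a_def[symmetric] n_def[symmetric] by linarith
  finally show ?thesis by (simp add: n_def)
qed

text \<open>The boundary is compact, so all pointwise properties of the defining function become
  uniform on a collar, and the peak functions can be built with constants independent of the
  boundary point.\<close>

lemma spc_domain_exists:
  fixes \<Omega> :: "(complex^'n) set"
  assumes op: "open \<Omega>" and con: "connected \<Omega>" and bdd: "bounded \<Omega>" and ne: "\<Omega> \<noteq> {}"
    and spc: "strongly_pseudoconvex_C2 \<Omega>"
  shows "\<exists>r G g \<rho> m M c \<eta>. spc_domain \<Omega> r G g \<rho> m M c \<eta>"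
proof -
  define A where "A = frontier \<Omega>"
  obtain U r where "C2_defining_function \<Omega> U r"
    and levi: "\<And>p w. p \<in> A \<Longrightarrow> w \<in> complex_tangent r p \<Longrightarrow> w \<noteq> 0 \<Longrightarrow> levi_form r p w > 0"
    using spc unfolding strongly_pseudoconvex_C2_def A_def by blast
  then have U: "open U" "A \<subseteq> U" "\<Omega> \<inter> U = {z\<in>U. r z < 0}" and "C2_on r U"
    and gne: "\<And>p. p \<in> A \<Longrightarrow> frechet_derivative r (at p) \<noteq> (\<lambda>v. 0)"
    unfolding C2_defining_function_def A_def by auto
  then obtain r' :: "complex^'n \<Rightarrow> ((complex^'n) \<Rightarrow>\<^sub>L real)" and r''
    where d: "\<And>x. x \<in> U \<Longrightarrow> (r has_derivative blinfun_apply (r' x)) (at x)"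
      and d2: "\<And>x. x \<in> U \<Longrightarrow> (r' has_derivative blinfun_apply (r'' x)) (at x)"
      and c2: "continuous_on U r''"
    unfolding C2_on_def by blast
  have cA: "compact A" using bdd by (simp add: A_def compact_frontier_bounded)
  have neA: "A \<noteq> {}"
  proof
    assume "A = {}"
    then have "\<Omega> = UNIV" using ne frontier_eq_empty[of \<Omega>] by (simp add: A_def)
    then show False using bdd not_bounded_UNIV by metis
  qed
  have clA: "closed A" by (simp add: A_def)
  have near: "\<exists>p\<in>A. dist z p = infdist z A" for z
    using infdist_attains_inf[OF clA neA, of z] by metis
  obtain e where e: "e > 0" "(\<Union>x\<in>A. ball x e) \<subseteq> U"
    using compact_subset_open_imp_ball_epsilon_subset[OF cA U(1,2)] by blast
  define X where "X = {z. infdist z A \<le> e / 2}"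
  have cX: "compact X" unfolding X_def by (rule compact_infdist_le[OF neA cA]) (use e in simp)
  have XU: "X \<subseteq> U"
  proof
    fix z assume "z \<in> X"
    then obtain p where "p \<in> A" "dist z p \<le> e / 2" using near[of z] by (auto simp: X_def)
    then have "z \<in> ball p e" using e(1) by (simp add: dist_commute)
    then show "z \<in> U" using e(2) \<open>p \<in> A\<close> by blast
  qed
  have AX: "A \<subseteq> X" using e(1) by (auto simp: X_def)
  have c1: "continuous_on U r'" using d2 has_derivative_continuous continuous_at_imp_continuous_on by blast
  have "bounded (r'' ` X)" "bounded (r' ` X)"
    using compact_continuous_image[OF continuous_on_subset[OF c2 XU] cX]
      compact_continuous_image[OF continuous_on_subset[OF c1 XU] cX] compact_imp_bounded by blast+
  then obtain M1 M2 where M12: "\<And>x. x \<in> X \<Longrightarrow> norm (r'' x) \<le> M1" "\<And>x. x \<in> X \<Longrightarrow> norm (r' x) \<le> M2"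
    unfolding bounded_iff by (metis imageI)
  define N where "N = max 1 (max M1 M2)"
  have N: "N \<ge> 1" "\<And>x. x \<in> X \<Longrightarrow> norm (r'' x) \<le> N" "\<And>x. x \<in> X \<Longrightarrow> norm (r' x) \<le> N"
    using M12 by (fastforce simp: N_def)+
  define G where "G = (\<lambda>z. rgrad (r' z))"
  have Gi: "G z \<bullet> v = r' z v" for z v by (simp add: G_def inner_rgrad)
  have cG: "continuous_on U G"
    unfolding G_def rgrad_def by (intro continuous_intros c1)
  have Gpos: "norm (G p) > 0" if "p \<in> A" for p
  proof -
    have "frechet_derivative r (at p) = blinfun_apply (r' p)"
      using d[of p] that U(2) frechet_derivative_at by (metis subsetD)
    then have "r' p \<noteq> 0" using gne[OF that] by (auto simp: zero_blinfun.rep_eq)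
    then show ?thesis by (simp add: G_def norm_rgrad)
  qed
  obtain p0 where p0: "p0 \<in> A" "\<And>p. p \<in> A \<Longrightarrow> norm (G p0) \<le> norm (G p)"
    using continuous_attains_inf[OF cA neA continuous_on_norm[OF continuous_on_subset[OF cG U(2)]]] by blast
  define m0 where "m0 = min 1 (norm (G p0))"
  have m0: "m0 > 0" "m0 \<le> 1" "\<And>p. p \<in> A \<Longrightarrow> m0 \<le> norm (G p)"
    using Gpos[OF p0(1)] p0(2) by (auto simp: m0_def min_le_iff_disj)
  \<comment> \<open>\<open>e / 4\<close> keeps points within \<open>2 * \<rho>\<close> of the
    boundary inside \<open>X\<close>; \<open>m0 / (2 * N)\<close> lets the gradient lose at most
    half of its least norm on the boundary.\<close>
  define \<rho> where "\<rho> = min 1 (min (e / 4) (m0 / (2 * N)))"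
  have rho: "\<rho> > 0" "\<rho> \<le> 1" "\<rho> \<le> e / 4" "\<rho> \<le> m0 / (2 * N)" using e(1) m0 N(1) by (auto simp: \<rho>_def)
  have cbX: "cball z \<rho> \<subseteq> X" if "infdist z A \<le> \<rho>" for z
  proof
    fix x assume "x \<in> cball z \<rho>"
    then have "infdist x A \<le> \<rho> + \<rho>" using infdist_triangle[of x A z] that by (simp add: dist_commute)
    then show "x \<in> X" using rho(3) by (simp add: X_def)
  qed
  have tay: "norm (G (z + v) - G z) \<le> N * norm v" "\<bar>r (z + v) - r z - G z \<bullet> v\<bar> \<le> N * (norm v)\<^sup>2"
    if z: "infdist z A \<le> \<rho>" and v: "norm v \<le> \<rho>" for z v
  proof -
    have *: "x \<in> U" "norm (r'' x) \<le> N" if "x \<in> cball z \<rho>" for x using cbX[OF z] XU N(2) that by blast+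
    from first_order_taylor[of z \<rho> r r' r'' N v] d d2 * v
    show "norm (G (z + v) - G z) \<le> N * norm v" "\<bar>r (z + v) - r z - G z \<bullet> v\<bar> \<le> N * (norm v)\<^sup>2"
      by (auto simp: G_def rgrad_diff norm_rgrad inner_rgrad)
  qed
  have memi: "z + v \<in> \<Omega> \<longleftrightarrow> r (z + v) < 0" if z: "infdist z A \<le> \<rho>" and v: "norm v \<le> \<rho>" for z v
  proof -
    have "z + v \<in> cball z \<rho>" using v by (simp add: dist_norm)
    then have "z + v \<in> U" using cbX[OF z] XU by blast
    then show ?thesis using U(3) by blast
  qed
  have Gb: "m0 / 2 \<le> norm (G z)" "norm (G z) \<le> N" if z: "infdist z A \<le> \<rho>" for z
  proof -
    obtain p where p: "p \<in> A" "dist z p \<le> \<rho>" using near[of z] z by auto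
    have "norm (G (p + (z - p)) - G p) \<le> N * norm (z - p)"
      by (rule tay(1)) (use p rho in \<open>auto simp: dist_norm\<close>)
    also have "\<dots> \<le> N * (m0 / (2 * N))"
      using p(2) rho(4) N(1) by (intro mult_left_mono) (auto simp: dist_norm)
    also have "\<dots> = m0 / 2" using N(1) by simp
    finally have "norm (G z - G p) \<le> m0 / 2" by simp
    then show "m0 / 2 \<le> norm (G z)"
      using m0(3)[OF p(1)] norm_triangle_ineq2[of "G p" "G z"] by (simp add: norm_minus_commute)
    have "z \<in> X" using cbX[OF z] rho(1) by auto
    then show "norm (G z) \<le> N" using N(3) by (simp add: G_def norm_rgrad)
  qed
  \<comment> \<open>\<Omega> is open, so \<open>p\<close> lies outside it and
    \<open>r p \<ge> 0\<close>; a positive value would persist nearby and keep \<Omega> away from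
    \<open>p\<close>.\<close>
  have rA: "r p = 0" if p: "p \<in> A" for p
  proof -
    have pU: "p \<in> U" using p U(2) by blast
    have "p \<notin> \<Omega>" using p op by (auto simp: A_def frontier_def interior_open)
    then have ge: "r p \<ge> 0" using U(3) pU by force
    have "r p \<le> 0"
    proof (rule ccontr)
      assume n: "\<not> r p \<le> 0"
      have "isCont r p" using d[OF pU] has_derivative_continuous by blast
      then have "eventually (\<lambda>x. r x > 0) (nhds p)"
        using n by (intro order_tendstoD(1)[of r "r p" "nhds p" 0]) (auto simp: isCont_def tendsto_at_iff_tendsto_nhds)
      moreover have "eventually (\<lambda>x. x \<in> U) (nhds p)" using U(1) pU by (rule eventually_nhds_in_open)
      ultimately have "eventually (\<lambda>x. r x > 0 \<and> x \<in> U) (nhds p)" by eventually_elim simp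
      then obtain S where S: "open S" "p \<in> S" "\<And>x. x \<in> S \<Longrightarrow> r x > 0 \<and> x \<in> U"
        unfolding eventually_nhds by blast
      have "p \<in> closure \<Omega>" using p by (simp add: A_def frontier_def)
      then obtain x where "x \<in> S" "x \<in> \<Omega>" 
        using open_Int_closure_eq_empty[OF S(1), of \<Omega>] S(2) by blast
      then show False using S(3)[of x] U(3) by force
    qed
    then show ?thesis using ge by simp
  qed
  define L where "L = (\<lambda>p w. (r'' p w w + r'' p (\<i> *s w) (\<i> *s w)) / 4)"
  \<comment> \<open>The zero set of \<open>herm (G p)\<close> is the complex tangent space, where
    the Levi form is positive. On pairs of a boundary point and a unit vector, a compact set, a
    multiple of the squared normal component makes the sum uniformly positive.\<close>
  have "\<exists>K c. K \<ge> 0 \<and> c > 0 \<and> (\<forall>x\<in>A \<times> sphere 0 1. L (fst x) (snd x) + K * (cmod (herm (G (fst x)) (snd x)))\<^sup>2 \<ge> c)"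
  proof (rule compact_positive_combination)
    show "compact (A \<times> sphere (0::complex^'n) 1)" using cA by (intro compact_Times) auto
    have cr: "continuous_on (A \<times> sphere (0::complex^'n) 1) (\<lambda>x. r'' (fst x))"
      by (rule continuous_on_compose2[OF c2]) (use U(2) in \<open>auto intro!: continuous_intros\<close>)
    have ci: "continuous_on (A \<times> sphere (0::complex^'n) 1) (\<lambda>x. \<i> *s snd x)"
      unfolding vector_scalar_mult_def
      by (intro continuous_on_vec_lambda continuous_intros)
    show "continuous_on (A \<times> sphere 0 1) (\<lambda>x. L (fst x) (snd x))"
      unfolding L_def by (intro continuous_intros cr ci) auto
    have cGf: "continuous_on (A \<times> sphere (0::complex^'n) 1) (\<lambda>x. G (fst x))"
      by (rule continuous_on_compose2[OF cG]) (use U(2) in \<open>auto intro!: continuous_intros\<close>)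
    show "continuous_on (A \<times> sphere 0 1) (\<lambda>x. (cmod (herm (G (fst x)) (snd x)))\<^sup>2)"
      unfolding herm_def by (intro continuous_intros cGf)
  next
    fix x :: "(complex^'n) \<times> (complex^'n)" assume x: "x \<in> A \<times> sphere 0 1"
      and h: "(cmod (herm (G (fst x)) (snd x)))\<^sup>2 = 0"
    then have p: "fst x \<in> A" "snd x \<noteq> 0" by auto
    have "snd x \<in> complex_tangent r (fst x)"
      using complex_tangent_iff[where p = "fst x" and w = "snd x", OF d] p(1) U(2) h by (auto simp: G_def)
    from levi[OF p(1) this p(2)] show "L (fst x) (snd x) > 0"
      using levi_form_eq[where p = "fst x" and w = "snd x" and r = r and r' = r' and r'' = r'', OF U(1) _ d d2] p(1) U(2) by (auto simp: L_def)
  qed auto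
  then obtain l c0 where l: "l \<ge> 0" "c0 > 0"
    and pos1: "\<And>p w. p \<in> A \<Longrightarrow> norm w = 1 \<Longrightarrow> L p w + l * (cmod (herm (G p) w))\<^sup>2 \<ge> c0" by fastforce
  have pos: "L p w + l * (cmod (herm (G p) w))\<^sup>2 \<ge> c0 * (norm w)\<^sup>2" if p: "p \<in> A" for p w
  proof (cases "w = 0")
    case True
    then show ?thesis by (simp add: L_def vec_eq_iff[of "\<i> *s 0" 0] herm_def blinfun.zero_left)
  next
    case False
    define n where "n = norm w"
    define u where "u = w /\<^sub>R n"
    have n: "n > 0" using False by (simp add: n_def)
    have wu: "w = n *\<^sub>R u" "norm u = 1" using n by (auto simp: u_def n_def)
    have iw: "\<i> *s w = n *\<^sub>R (\<i> *s u)" unfolding wu(1) by (simp add: vec_eq_iff)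
    have hw: "herm (G p) w = of_real n * herm (G p) u"
      unfolding wu(1) of_real_vector_scalar_mult[symmetric] by (rule herm_scale)
    have "L p w + l * (cmod (herm (G p) w))\<^sup>2 = n\<^sup>2 * (L p u + l * (cmod (herm (G p) u))\<^sup>2)"
      unfolding L_def iw hw unfolding wu(1)
      by (simp add: blinfun.scaleR_left blinfun.scaleR_right norm_mult power2_eq_square algebra_simps)
    also have "\<dots> \<ge> n\<^sup>2 * c0" using pos1[OF p wu(2)] by (intro mult_left_mono) auto
    finally show ?thesis by (simp add: n_def mult.commute)
  qed
  have "uniformly_continuous_on X r''"
    by (rule compact_uniformly_continuous[OF continuous_on_subset[OF c2 XU] cX])
  then obtain \<delta> where \<delta>: "\<delta> > 0" "\<And>x p. x \<in> X \<Longrightarrow> p \<in> X \<Longrightarrow> dist x p < \<delta> \<Longrightarrow> dist (r'' x) (r'' p) < c0 / 4"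
    unfolding uniformly_continuous_on_def using l(2) by (metis zero_less_divide_iff zero_less_numeral)
  \<comment> \<open>The bounds keep the peak functions inside the collar, the oscillation of
    \<open>r''\<close> below \<open>c0 / 4\<close>, and meet the last two conditions of
    \<open>peak_function_upper\<close>. The summands 1 guard against \<open>l = 0\<close>.\<close>
  define \<eta> where "\<eta> = min \<rho> (min (\<delta> / 2) (min (1 / (8 * l * N + 1)) (c0 / (24 * l * N\<^sup>2 + 1))))"
  have lN: "8 * l * N \<ge> 0" "24 * l * N\<^sup>2 \<ge> 0" using l N(1) by auto
  have dp: "8 * l * N + 1 > 0" "24 * l * N\<^sup>2 + 1 > 0" using lN by linarith+
  have eta: "\<eta> > 0" "\<eta> \<le> \<rho>" "\<eta> \<le> \<delta> / 2" "\<eta> \<le> 1 / (8 * l * N + 1)" "\<eta> \<le> c0 / (24 * l * N\<^sup>2 + 1)"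
    subgoal using rho \<delta>(1) l(2) dp by (simp add: \<eta>_def)
    unfolding \<eta>_def by (meson min.cobounded1 min.cobounded2 order_trans)+
  define g where "g = (\<lambda>p z. herm (G p) (z - p) + quad (r'' p) (z - p) + of_real l * (herm (G p) (z - p))\<^sup>2)"
  have gup: "Re (g p z) \<le> r z / 2 - c0 / 2 * (norm (z - p))\<^sup>2"
    if p: "p \<in> A" and z: "z \<in> \<Omega>" and zp: "norm (z - p) \<le> \<eta>" for p z
  proof -
    define w where "w = z - p"
    have ip: "infdist p A \<le> \<rho>" using p rho(1) by simp
    have w\<rho>: "norm w \<le> \<rho>" using zp eta(2) by (simp add: w_def)
    have zw: "p + w = z" by (simp add: w_def)
    have "Re (herm (G p) w + quad (r'' p) w + of_real l * (herm (G p) w)\<^sup>2) \<le> r z / 2 - c0 / 2 * (norm w)\<^sup>2"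
    proof (rule peak_function_upper[OF l(1) N(1) l(2)])
      show "r z < 0" using memi[OF ip w\<rho>] z zw by simp
      show "norm w \<le> 1" using w\<rho> rho(2) by simp
      show "\<bar>r z - G p \<bullet> w\<bar> \<le> N * (norm w)\<^sup>2" using tay(2)[OF ip w\<rho>] rA[OF p] zw by simp
      show "norm (G p) \<le> N" by (rule Gb(2)[OF ip])
      have sub: "cball p (norm w) \<subseteq> X" using cbX[OF ip] w\<rho> by auto
      have "\<bar>r (p + w) - r p - r' p w - r'' p w w / 2\<bar> \<le> c0 / 4 * (norm w)\<^sup>2"
      proof (rule second_order_taylor)
        fix x assume x: "x \<in> cball p (norm w)"
        then have xX: "x \<in> X" using sub by blast
        show "(r has_derivative blinfun_apply (r' x)) (at x)" using d xX XU by blast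
        show "(r' has_derivative blinfun_apply (r'' x)) (at x)" using d2 xX XU by blast
        have "dist x p < \<delta>" using x zp eta(3) \<delta>(1) by (simp add: dist_commute w_def)
        then show "norm (r'' x - r'' p) \<le> c0 / 4" using \<delta>(2)[OF xX _ , of p] p AX by (auto simp: dist_norm)
      qed
      then show "\<bar>r z - G p \<bullet> w - r'' p w w / 2\<bar> \<le> c0 / 4 * (norm w)\<^sup>2" using rA[OF p] zw by (simp add: Gi)
      show "c0 * (norm w)\<^sup>2 \<le> (r'' p w w + r'' p (\<i> *s w) (\<i> *s w)) / 4 + l * (cmod (herm (G p) w))\<^sup>2"
        using pos[OF p, of w] by (simp add: L_def)
      have nw: "norm w \<le> \<eta>" using zp by (simp add: w_def)
      have "8 * l * N * norm w \<le> 8 * l * N * (1 / (8 * l * N + 1))"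
        using nw eta(4) lN(1) by (intro mult_left_mono) auto
      also have "\<dots> \<le> 1" using dp(1) by (simp add: divide_le_eq)
      finally show "8 * l * N * norm w \<le> 1" .
      have "24 * l * N\<^sup>2 * norm w \<le> 24 * l * N\<^sup>2 * (c0 / (24 * l * N\<^sup>2 + 1))"
        using nw eta(5) lN(2) by (intro mult_left_mono) auto
      also have "\<dots> \<le> c0" using dp(2) l(2) by (simp add: divide_le_eq algebra_simps)
      finally show "24 * l * N\<^sup>2 * norm w \<le> c0" .
    qed
    then show ?thesis by (simp add: g_def w_def)
  qed
  \<comment> \<open>\<open>N\<close> covers the quadratic part \<open>quad\<close> of the peak
    function and \<open>l * N^2\<close> its squared linear part.\<close>
  define M where "M = N + l * N\<^sup>2"
  have MN: "N \<le> M" using l N(1) by (simp add: M_def)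
  have gap: "cmod (g p z - herm (G p) (z - p)) \<le> M * (norm (z - p))\<^sup>2" if p: "p \<in> A" for p z
  proof -
    have ip: "infdist p A \<le> \<rho>" using p rho(1) by simp
    have "cmod (herm (G p) (z - p)) \<le> N * norm (z - p)"
      by (rule order_trans[OF norm_herm_le mult_right_mono[OF Gb(2)[OF ip]]]) simp
    then have h: "(cmod (herm (G p) (z - p)))\<^sup>2 \<le> (N * norm (z - p))\<^sup>2" by (intro power_mono) auto
    have q: "cmod (quad (r'' p) (z - p)) \<le> N * (norm (z - p))\<^sup>2"
      by (rule order_trans[OF norm_quad_le mult_right_mono]) (use N(2) AX p in auto)
    have "cmod (g p z - herm (G p) (z - p)) \<le> cmod (quad (r'' p) (z - p)) + cmod (of_real l * (herm (G p) (z - p))\<^sup>2)"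
      unfolding g_def by (rule order_trans[OF _ norm_triangle_ineq]) simp
    also have "cmod (of_real l * (herm (G p) (z - p))\<^sup>2) = l * (cmod (herm (G p) (z - p)))\<^sup>2"
      using l by (simp add: norm_mult norm_power)
    also have "cmod (quad (r'' p) (z - p)) + l * (cmod (herm (G p) (z - p)))\<^sup>2
        \<le> N * (norm (z - p))\<^sup>2 + l * (N * norm (z - p))\<^sup>2"
      using q h l by (intro add_mono mult_left_mono) auto
    finally show ?thesis by (simp add: M_def power_mult_distrib algebra_simps)
  qed
  have "spc_domain \<Omega> r G g \<rho> (m0 / 2) M (c0 / 2) \<eta>"
  proof
    show "0 < \<rho>" "\<rho> \<le> 1" "0 < m0 / 2" "m0 / 2 \<le> 1" "1 \<le> M" "0 < c0 / 2" "0 < \<eta>" "\<eta> \<le> \<rho>"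
      using rho m0 N MN l eta by auto
    fix z v :: "complex^'n" assume zv: "infdist z (frontier \<Omega>) \<le> \<rho>" "norm v \<le> \<rho>"
    show "z + v \<in> \<Omega> \<longleftrightarrow> r (z + v) < 0" using memi zv by (simp add: A_def)
    have "N * (norm v)\<^sup>2 \<le> M * (norm v)\<^sup>2" "N * norm v \<le> M * norm v" using MN by (intro mult_right_mono; simp)+
    then show "\<bar>r (z + v) - r z - G z \<bullet> v\<bar> \<le> M * (norm v)\<^sup>2" "norm (G (z + v) - G z) \<le> M * norm v"
      using tay zv unfolding A_def by (meson order_trans)+
  next
    fix z assume "infdist z (frontier \<Omega>) \<le> \<rho>"
    then show "m0 / 2 \<le> norm (G z) \<and> norm (G z) \<le> M" using Gb MN unfolding A_def by (meson order_trans)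
  next
    fix p :: "complex^'n" and f :: "complex \<Rightarrow> complex^'n" and S
    assume "\<And>i. (\<lambda>\<zeta>. f \<zeta> $ i) holomorphic_on S"
    then show "(\<lambda>\<zeta>. g p (f \<zeta>)) holomorphic_on S"
      unfolding g_def herm_def quad_def vector_minus_component by (intro holomorphic_intros)
  next
    fix p z :: "complex^'n"
    have "(\<lambda>z. z $ i) differentiable (at z)" for i
      by (intro bounded_linear_imp_differentiable bounded_linear_vec_nth)
    then show "g p differentiable (at z)"
      unfolding g_def herm_def quad_def vector_minus_component power2_eq_square
      by (intro differentiable_add differentiable_mult differentiable_sum differentiable_diff differentiable_const) auto
  qed (use op con bdd ne rA gup gap in \<open>auto simp: A_def\<close>)
  then show ?thesis by blast
qed

section \<open>Localization of discs near the boundary\<close>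

text \<open>\<open>ennreal\<close> sends negative numbers to 0. The lower bounds for lengths may be
  negative, and this allows them to be split all the same.\<close>

lemma ennreal_add_le: "ennreal (a + b) \<le> ennreal a + ennreal b"
proof (cases "a \<ge> 0 \<and> b \<ge> 0")
  case False
  then have "a + b \<le> a \<or> a + b \<le> b" by auto
  then have "ennreal (a + b) \<le> ennreal a \<or> ennreal (a + b) \<le> ennreal b" using ennreal_leI by blast
  then show ?thesis by (meson add_increasing add_increasing2 zero_le)
qed (simp add: ennreal_plus)

context spc_domain
begin

section \<open>Defining function, peak functions and distance to the boundary\<close>

abbreviation dd :: "complex^'n \<Rightarrow> real" where "dd z \<equiv> infdist z (frontier \<Omega>)"

lemma frontier_nonempty: "frontier \<Omega> \<noteq> {}"
proof
  assume "frontier \<Omega> = {}"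
  then have "\<Omega> = UNIV" using dom_nonempty frontier_eq_empty[of \<Omega>] by simp
  then show False using bounded_dom not_bounded_UNIV by metis
qed

lemma nearest_frontier_point:
  obtains p where "p \<in> frontier \<Omega>" "norm (z - p) = dd z"
  using infdist_attains_inf[OF frontier_closed frontier_nonempty, of z] by (metis dist_norm)

lemma dd_le: "p \<in> frontier \<Omega> \<Longrightarrow> dd z \<le> norm (z - p)"
  using infdist_le[of p "frontier \<Omega>" z] by (simp add: dist_norm)

lemma dd_pos: "z \<in> \<Omega> \<Longrightarrow> dd z > 0"
  using infdist_pos_not_in_closed[OF frontier_closed frontier_nonempty] open_dom
  by (simp add: frontier_def interior_open)

lemma ball_dd_subset: 
  assumes "z \<in> \<Omega>" shows "ball z (dd z) \<subseteq> \<Omega>"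
proof (rule ccontr)
  assume "\<not> ball z (dd z) \<subseteq> \<Omega>"
  moreover have "z \<in> ball z (dd z) \<inter> \<Omega>" using dd_pos[OF assms] assms by simp
  ultimately have "ball z (dd z) \<inter> frontier \<Omega> \<noteq> {}"
    using connected_Int_frontier[of "ball z (dd z)" \<Omega>] connected_ball by blast
  then obtain p where "p \<in> frontier \<Omega>" "dist z p < dd z" by auto
  then show False using dd_le[of p z] by (simp add: dist_norm)
qed

lemma r_neg: "z \<in> \<Omega> \<Longrightarrow> dd z \<le> \<rho> \<Longrightarrow> r z < 0"
  using mem_iff[of z 0] const_bounds by simp

definition "\<kappa> = m\<^sup>2 / (4 * M)"

lemma kappa_pos: "\<kappa> > 0" using const_bounds by (simp add: \<kappa>_def)

text \<open>Moving from \<open>z\<close> along the gradient by less than \<open>dd z\<close> stays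
  in \<Omega>, so \<open>r\<close> is still negative there; hence \<open>r z\<close> lies below 0 by
  at least the increase along the way.\<close>

lemma r_le:
  assumes z: "z \<in> \<Omega>" "dd z \<le> \<rho>"
  shows "r z \<le> - \<kappa> * dd z"
proof -
  \<comment> \<open>The step is shorter than \<open>dd z\<close>, and so short that the quadratic
    Taylor error takes at most half of the linear increase \<open>t * m\<close>.\<close>
  define t where "t = dd z * (m / (2 * M))"
  have dz: "dd z > 0" "dd z \<le> 1" using dd_pos z const_bounds by auto
  have mM: "0 < m / (2 * M)" "m / (2 * M) < 1" using const_bounds by (auto simp: divide_less_eq)
  have t: "t > 0" "t < dd z" "t \<le> m / (2 * M)"
    using mult_pos_pos[OF dz(1) mM(1)] mult_strict_left_mono[OF mM(2) dz(1)]
      mult_right_mono[OF dz(2) less_imp_le[OF mM(1)]] by (auto simp: t_def)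
  have Gb: "m \<le> norm (G z)" "norm (G z) > 0" using G_bounds[OF z(2)] const_bounds by auto
  define v where "v = (t / norm (G z)) *\<^sub>R G z"
  have nv: "norm v = t" using t Gb by (simp add: v_def)
  have "z + v \<in> ball z (dd z)" using nv t by (simp add: dist_norm)
  then have "z + v \<in> \<Omega>" using ball_dd_subset[OF z(1)] by blast
  then have "r (z + v) < 0" using mem_iff[OF z(2)] nv t z by simp
  moreover have "\<bar>r (z + v) - r z - G z \<bullet> v\<bar> \<le> M * t\<^sup>2" using r_taylor[OF z(2), of v] nv t z by simp
  moreover have "G z \<bullet> v = t * norm (G z)"
    using Gb by (simp add: v_def power2_norm_eq_inner[symmetric] power2_eq_square)
  moreover have "t * norm (G z) \<ge> t * m" using Gb t by (intro mult_left_mono) auto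
  moreover have "M * t\<^sup>2 \<le> t * m / 2"
  proof -
    have "M * t\<^sup>2 = t * (M * t)" by (simp add: power2_eq_square)
    also have "\<dots> \<le> t * (M * (m / (2 * M)))" using t const_bounds by (intro mult_left_mono) auto
    finally show ?thesis using const_bounds by simp
  qed
  ultimately have "r z < - (t * m / 2)" by linarith
  also have "t * m / 2 = \<kappa> * dd z" by (simp add: t_def \<kappa>_def power2_eq_square)
  finally show ?thesis by simp
qed

lemma r_ge:
  assumes z: "dd z \<le> \<rho>"
  shows "r z \<ge> - (2 * M * dd z)"
proof -
  obtain p where p: "p \<in> frontier \<Omega>" "norm (z - p) = dd z" by (rule nearest_frontier_point)
  have d0: "dd z \<ge> 0" by (rule infdist_nonneg)
  have ip: "dd p \<le> \<rho>" using p const_bounds by simp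
  have "\<bar>r (p + (z - p)) - r p - G p \<bullet> (z - p)\<bar> \<le> M * (norm (z - p))\<^sup>2"
    by (rule r_taylor[OF ip]) (use p z in simp)
  then have "\<bar>r z - G p \<bullet> (z - p)\<bar> \<le> M * (dd z)\<^sup>2" using r_frontier[OF p(1)] p(2) by simp
  moreover have "\<bar>G p \<bullet> (z - p)\<bar> \<le> M * dd z"
    using Cauchy_Schwarz_ineq2[of "G p" "z - p"] G_bounds[OF ip] p(2) d0
    by (smt (verit) mult_right_mono)
  moreover have "M * (dd z)\<^sup>2 \<le> M * dd z"
    using d0 z const_bounds by (intro mult_left_mono) (auto simp: power2_eq_square mult_left_le_one_le)
  ultimately show ?thesis by linarith
qed

text \<open>The two terms of \<open>g_upper\<close> are exploited separately: the quadratic one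
  shows how close \<open>z\<close> is to \<open>p\<close>, the term \<open>r z / 2\<close> gives the
  distance to the boundary through \<open>r_le\<close>.\<close>

lemma g_neg:
  assumes "p \<in> frontier \<Omega>" "z \<in> \<Omega>" "norm (z - p) \<le> \<eta>"
  shows "Re (g p z) < 0" "c * (norm (z - p))\<^sup>2 \<le> - Re (g p z)" "c * (norm (z - p))\<^sup>2 \<le> cmod (g p z)"
    "\<kappa> / 2 * dd z \<le> cmod (g p z)" "cmod (g p z) > 0"
proof -
  have dz: "dd z \<le> \<rho>" using dd_le[OF assms(1), of z] assms(3) const_bounds by linarith
  note u = g_upper[OF assms]
  note rn = r_neg[OF assms(2) dz]
  have n: "0 \<le> c * (norm (z - p))\<^sup>2" using const_bounds by simp
  have cm: "- Re (g p z) \<le> cmod (g p z)" using abs_Re_le_cmod[of "g p z"] by linarith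
  show 1: "Re (g p z) < 0" using u rn n by linarith
  show "c * (norm (z - p))\<^sup>2 \<le> - Re (g p z)" using u rn by linarith
  then show "c * (norm (z - p))\<^sup>2 \<le> cmod (g p z)" using cm by linarith
  show "\<kappa> / 2 * dd z \<le> cmod (g p z)" using r_le[OF assms(2) dz] u n cm by simp
  show "cmod (g p z) > 0" using 1 cm by linarith
qed

text \<open>If \<open>p\<close> is a boundary point nearest to \<open>z\<close>, this and the fourth
  part of \<open>g_neg\<close> make \<open>cmod (g p z)\<close> comparable with
  \<open>dd z\<close>.\<close>

lemma g_le:
  assumes p: "p \<in> frontier \<Omega>" "norm (z - p) \<le> \<eta>"
  shows "cmod (g p z) \<le> 2 * M * norm (z - p)"
proof -
  have "dd p \<le> \<rho>" using p const_bounds by simp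
  then have "cmod (herm (G p) (z - p)) \<le> M * norm (z - p)"
    using G_bounds[of p] by (intro order_trans[OF norm_herm_le] mult_right_mono) auto
  moreover have "norm (z - p) \<le> 1" using p(2) const_bounds by linarith
  then have "M * (norm (z - p))\<^sup>2 \<le> M * norm (z - p)"
    using const_bounds by (intro mult_left_mono) (auto simp: power2_eq_square mult_left_le_one_le)
  moreover note g_approx[OF p] norm_triangle_ineq2[of "g p z" "herm (G p) (z - p)"]
  ultimately show ?thesis by linarith
qed

lemma continuous_g: "continuous_on S (g p)"
  using g_differentiable differentiable_imp_continuous_within continuous_at_imp_continuous_on by blast

section \<open>Peak functions confine discs\<close>

lemma diameter_bound:
  obtains R where "R \<ge> 1" "\<And>z p. z \<in> \<Omega> \<Longrightarrow> p \<in> frontier \<Omega> \<Longrightarrow> norm (z - p) \<le> R"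
proof -
  have "bounded (frontier \<Omega>)" using bounded_dom compact_frontier_bounded compact_imp_bounded by blast
  then obtain a b where "\<And>z. z \<in> \<Omega> \<Longrightarrow> norm z \<le> a" "\<And>p. p \<in> frontier \<Omega> \<Longrightarrow> norm p \<le> b"
    using bounded_dom unfolding bounded_iff by metis
  then have "norm (z - p) \<le> max 1 (a + b)" if "z \<in> \<Omega>" "p \<in> frontier \<Omega>" for z p
    using norm_triangle_ineq4[of z p] that by (smt (verit))
  then show ?thesis using that[of "max 1 (a + b)"] by simp
qed

text \<open>In the disc, \<open>w = c2 * |f - p|^2\<close> is subharmonic and lies between 0 and the
  superharmonic \<open>- u\<close>. Then \<open>holo_supported_between_bound\<close> gives
  \<open>w b * (1 - cmod b) \<le> 2 * cmod (g p (f 0))\<close>, so \<open>f b\<close> can be far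
  from \<open>p\<close> only for \<open>b\<close> near the unit circle.\<close>

lemma peak_disc_localization:
  obtains C where "C > 0"
    "\<And>p f b. p \<in> frontier \<Omega> \<Longrightarrow> holomorphic_disc \<Omega> f \<Longrightarrow> norm (f 0 - p) < \<eta> \<Longrightarrow>
       cmod b < 1 - C * cmod (g p (f 0)) \<Longrightarrow> norm (f b - p) < \<eta>"
proof -
  obtain R where R: "R \<ge> 1" "\<And>z p. z \<in> \<Omega> \<Longrightarrow> p \<in> frontier \<Omega> \<Longrightarrow> norm (z - p) \<le> R"
    by (rule diameter_bound) (rule that)
  \<comment> \<open>\<open>- c1\<close> is the level that \<open>Re (g p)\<close> cannot exceed at
    distance \<open>\<eta> / 2\<close> or more. \<open>c2\<close> is so small that
    \<open>c2 * |z - p|^2\<close> stays below \<open>c * |z - p|^2\<close> near \<open>p\<close> and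
    below \<open>c1\<close> on all of \<Omega>, where \<open>|z - p| \<le> R\<close>.\<close>
  define c1 where "c1 = c * \<eta>\<^sup>2 / 4"
  have c1: "c1 > 0" using const_bounds by (simp add: c1_def)
  define c2 where "c2 = min c (c1 / R\<^sup>2)"
  have c2: "c2 > 0" "c2 \<le> c" "c2 * R\<^sup>2 \<le> c1" 
    using c1 R(1) const_bounds by (auto simp: c2_def pos_le_divide_eq[symmetric])
  \<comment> \<open>With this value \<open>1 - cmod b > C * cmod (g p (f 0))\<close> turns the final
    estimate into \<open>|f b - p|^2 < \<eta>^2\<close>.\<close>
  define C where "C = 2 / (c2 * \<eta>\<^sup>2)"
  have "C > 0" using c2 const_bounds by (simp add: C_def)
  moreover have "norm (f b - p) < \<eta>"
    if p: "p \<in> frontier \<Omega>" and f: "holomorphic_disc \<Omega> f" and f0: "norm (f 0 - p) < \<eta>"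
      and b: "cmod b < 1 - C * cmod (g p (f 0))" for p f b
  proof -
    have hol: "(\<lambda>\<zeta>. f \<zeta> $ i) holomorphic_on ball 0 1" for i using f by (simp add: holomorphic_disc_def)
    have fO: "f \<zeta> \<in> \<Omega>" if "\<zeta> \<in> ball 0 1" for \<zeta> using f that by (auto simp: holomorphic_disc_def)
    have cf: "continuous_on (ball 0 1) f"
    proof -
      have "continuous_on (ball 0 1) (\<lambda>\<zeta>. \<chi> i. f \<zeta> $ i)"
        by (intro continuous_on_vec_lambda holomorphic_on_imp_continuous_on hol)
      then show ?thesis by simp
    qed
    txt \<open>
      The following function is plurisubharmonic on the whole domain, because \<open>Re (g p)\<close> is below
      \<open>- c1\<close> on the shell \<open>\<eta> / 2 < norm (z - p) < \<eta>\<close>.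
    \<close>
    define \<psi> where "\<psi> = (\<lambda>z. if norm (z - p) < \<eta> then max (Re (g p z)) (- c1) else - c1)"
    define u where "u = (\<lambda>\<zeta>. \<psi> (f \<zeta>))"
    have far: "\<psi> z = - c1" if "z \<in> \<Omega>" "norm (z - p) > \<eta> / 2" for z
    proof (cases "norm (z - p) < \<eta>")
      case True
      have "(\<eta> / 2)\<^sup>2 \<le> (norm (z - p))\<^sup>2" using that const_bounds by (intro power_mono) auto
      then have "c * (\<eta> / 2)\<^sup>2 \<le> c * (norm (z - p))\<^sup>2" using const_bounds by (intro mult_left_mono) auto
      also have "\<dots> \<le> - Re (g p z)" using g_neg(2)[OF p that(1)] True by simp
      finally show ?thesis using True by (simp add: \<psi>_def c1_def power_divide)
    qed (simp add: \<psi>_def)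
    \<comment> \<open>Two overlapping open sets that cover the disc: on \<open>S1\<close> the
      function \<open>u\<close> is a maximum involving \<open>g p\<close>, on \<open>S2\<close> it
      is the constant \<open>- c1\<close>.\<close>
    define S1 where "S1 = {\<zeta>\<in>ball 0 1. norm (f \<zeta> - p) < \<eta>}"
    define S2 where "S2 = {\<zeta>\<in>ball 0 1. norm (f \<zeta> - p) > \<eta> / 2}"
    have cn: "continuous_on (ball 0 1) (\<lambda>\<zeta>. norm (f \<zeta> - p))" by (intro continuous_intros cf)
    have o1: "open S1"
    proof -
      have "S1 = ball 0 1 \<inter> (\<lambda>\<zeta>. norm (f \<zeta> - p)) -` {..<\<eta>}" by (auto simp: S1_def)
      then show ?thesis using continuous_open_preimage[OF cn open_ball open_lessThan] by metis
    qed
    have o2: "open S2"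
    proof -
      have "S2 = ball 0 1 \<inter> (\<lambda>\<zeta>. norm (f \<zeta> - p)) -` {\<eta> / 2<..}" by (auto simp: S2_def)
      then show ?thesis using continuous_open_preimage[OF cn open_ball open_greaterThan] by metis
    qed
    have un: "ball 0 1 = S1 \<union> S2" using const_bounds by (auto simp: S1_def S2_def)
    have hg: "(\<lambda>\<zeta>. g p (f \<zeta>)) holomorphic_on X" if "X \<subseteq> ball 0 1" for X
      by (rule g_holomorphic) (use holomorphic_on_subset[OF hol that] in blast)
    have cu: "continuous_on (ball 0 1) u"
      unfolding un
    proof (rule continuous_on_open_Un[OF o1 o2])
      have S1s: "S1 \<subseteq> ball 0 1" by (auto simp: S1_def)
      have "continuous_on S1 (\<lambda>\<zeta>. max (Re (g p (f \<zeta>))) (- c1))"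
        by (intro continuous_intros holomorphic_on_imp_continuous_on hg S1s)
      then show "continuous_on S1 u"
        by (rule continuous_on_eq) (auto simp: u_def \<psi>_def S1_def)
      show "continuous_on S2 u"
        by (rule continuous_on_eq[OF continuous_on_const[of _ "- c1"]]) (use far fO in \<open>auto simp: u_def S2_def\<close>)
    qed
    have uge: "u \<zeta> \<ge> - c1" for \<zeta> by (simp add: u_def \<psi>_def)
    have su: "holo_supported u (ball 0 1)"
      unfolding holo_supported_def
    proof (intro conjI ballI cu)
      fix a :: complex assume a: "a \<in> ball 0 1"
      show "\<exists>f e. e > 0 \<and> ball a e \<subseteq> ball 0 1 \<and> f holomorphic_on ball a e \<and> Re (f a) = u a \<and>
          (\<forall>x\<in>ball a e. Re (f x) \<le> u x)"
      \<comment> \<open>Where \<open>u\<close> has its least value a constant supports it; elsewhere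
        \<open>g p\<close> composed with the disc does.\<close>
      proof (cases "u a = - c1")
        case True
        obtain e where "e > 0" "ball a e \<subseteq> ball 0 1" using a open_contains_ball[of "ball (0::complex) 1"] open_ball by blast
        then show ?thesis using True uge
          by (intro exI[of _ "\<lambda>_. of_real (- c1)"] exI[of _ e]) (auto simp del: of_real_minus)
      next
        case False
        then have aS: "a \<in> S1" using a by (auto simp: S1_def u_def \<psi>_def split: if_splits)
        then have ua: "Re (g p (f a)) = u a" using False by (auto simp: S1_def u_def \<psi>_def max_def)
        obtain e where e: "e > 0" "ball a e \<subseteq> S1" using aS o1 open_contains_ball by blast
        have sub: "ball a e \<subseteq> ball 0 1" using e(2) by (auto simp: S1_def)
        have "Re (g p (f x)) \<le> u x" if "x \<in> ball a e" for x
          using e(2) that by (auto simp: S1_def u_def \<psi>_def)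
        then show ?thesis using e(1) sub ua hg[OF sub] by (intro exI[of _ "\<lambda>\<zeta>. g p (f \<zeta>)"] exI[of _ e]) auto
      qed
    qed
    define w where "w = (\<lambda>\<zeta>. c2 * (\<Sum>i\<in>UNIV. (cmod (f \<zeta> $ i - p $ i))\<^sup>2))"
    have weq: "w \<zeta> = c2 * (norm (f \<zeta> - p))\<^sup>2" for \<zeta>
      unfolding w_def norm_vec_def L2_set_def by (simp add: sum_nonneg)
    have sw: "holo_supported w (ball 0 1)"
      unfolding w_def
      by (intro holo_supported_cmult holo_supported_sum holo_supported_norm_power2 holomorphic_intros hol)
         (use c2 in auto)
    have le: "0 \<le> w \<zeta> \<and> w \<zeta> \<le> - u \<zeta>" if z: "\<zeta> \<in> ball 0 1" for \<zeta>
    proof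
      show "0 \<le> w \<zeta>" using c2 by (simp add: weq)
      have b1: "c2 * (norm (f \<zeta> - p))\<^sup>2 \<le> c1"
      proof -
        have "(norm (f \<zeta> - p))\<^sup>2 \<le> R\<^sup>2" using R(2)[OF fO[OF z] p] by (intro power_mono) auto
        then have "c2 * (norm (f \<zeta> - p))\<^sup>2 \<le> c2 * R\<^sup>2" using c2 by (intro mult_left_mono) auto
        then show ?thesis using c2(3) by linarith
      qed
      have b2: "c2 * (norm (f \<zeta> - p))\<^sup>2 \<le> - Re (g p (f \<zeta>))" if "norm (f \<zeta> - p) < \<eta>"
        using g_neg(2)[OF p fO[OF z]] that mult_right_mono[OF c2(2), of "(norm (f \<zeta> - p))\<^sup>2"] by simp
      show "w \<zeta> \<le> - u \<zeta>" unfolding weq u_def \<psi>_def using b1 b2 by auto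
    qed
    have z0: "f 0 \<in> \<Omega>" using fO by simp
    have gpos: "cmod (g p (f 0)) > 0" using g_neg(5)[OF p z0] f0 by simp
    have b1: "cmod b < 1" using b gpos \<open>C > 0\<close> by (smt (verit) mult_pos_pos)
    have "holo_supported (\<lambda>x. - (- u x)) (ball 0 1)" using su by simp
    from holo_supported_between_bound[OF sw this le, of b]
    have "w b * (1 - cmod b) \<le> - u 0 * (1 + cmod b)" using b1 by simp
    also have "\<dots> \<le> cmod (g p (f 0)) * 2"
    proof (intro mult_mono)
      show "- u 0 \<le> cmod (g p (f 0))" using f0 abs_Re_le_cmod[of "g p (f 0)"] by (auto simp: u_def \<psi>_def)
    qed (use b1 in auto)
    finally have "c2 * (norm (f b - p))\<^sup>2 * (1 - cmod b) \<le> 2 * cmod (g p (f 0))" by (simp add: weq)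
    also have "\<dots> = c2 * \<eta>\<^sup>2 * (C * cmod (g p (f 0)))"
      using c2 const_bounds by (simp add: C_def)
    also have "\<dots> < c2 * \<eta>\<^sup>2 * (1 - cmod b)"
      using b c2 const_bounds by (intro mult_strict_left_mono) auto
    finally have "(norm (f b - p))\<^sup>2 < \<eta>\<^sup>2"
      using b1 c2 by (simp add: mult_less_cancel_left mult_less_cancel_right)
    then show ?thesis using const_bounds by (simp add: power2_less_imp_less)
  qed
  ultimately show ?thesis using that by blast
qed

lemma kobayashi_metric_lower_bound:
  obtains C where "C > 0"
    "\<And>p z \<xi> D. p \<in> frontier \<Omega> \<Longrightarrow> z \<in> \<Omega> \<Longrightarrow> norm (z - p) < \<eta> \<Longrightarrow> C * cmod (g p z) < 1 \<Longrightarrow>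
       (g p has_derivative D) (at z) \<Longrightarrow>
       (1 - C * cmod (g p z)) * cmod (D \<xi>) / (2 * cmod (g p z)) \<le> kobayashi_metric \<Omega> z \<xi>"
proof -
  obtain C where C: "C > 0"
    "\<And>p f b. p \<in> frontier \<Omega> \<Longrightarrow> holomorphic_disc \<Omega> f \<Longrightarrow> norm (f 0 - p) < \<eta> \<Longrightarrow>
       cmod b < 1 - C * cmod (g p (f 0)) \<Longrightarrow> norm (f b - p) < \<eta>"
    by (rule peak_disc_localization) blast
  have "(1 - C * cmod (g p z)) * cmod (D \<xi>) / (2 * cmod (g p z)) \<le> kobayashi_metric \<Omega> z \<xi>"
    if p: "p \<in> frontier \<Omega>" and z: "z \<in> \<Omega>" "norm (z - p) < \<eta>" and lt: "C * cmod (g p z) < 1"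
      and D: "(g p has_derivative D) (at z)" for p z \<xi> D
  proof (rule kobayashi_metric_ge[OF open_dom z(1)])
    fix \<alpha> f assume a: "\<alpha> > 0" and f: "holomorphic_disc \<Omega> f" and f0: "f 0 = z"
      and f': "disc_deriv f 0 = \<xi> /\<^sub>R \<alpha>"
    \<comment> \<open>On the disc of this radius \<open>f\<close> stays within \<eta> of
      \<open>p\<close>, so \<open>- g p\<close> composed with \<open>f\<close> maps it into the
      right half plane.\<close>
    define R where "R = 1 - C * cmod (g p z)"
    have gp: "cmod (g p z) > 0" using g_neg(5)[OF p z(1)] z(2) by simp
    have R: "R > 0" "R < 1" using lt gp C(1) by (auto simp: R_def)
    have sub: "ball 0 R \<subseteq> ball (0::complex) 1" using R by auto
    have hol: "(\<lambda>\<zeta>. f \<zeta> $ i) holomorphic_on ball 0 R" for i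
      using f holomorphic_on_subset[OF _ sub] unfolding holomorphic_disc_def by blast
    define F where "F = (\<lambda>\<zeta>. - g p (f \<zeta>))"
    have hF: "F holomorphic_on ball 0 R" unfolding F_def by (intro holomorphic_intros g_holomorphic hol)
    have pos: "Re (F b) > 0" if b: "b \<in> ball 0 R" for b
    proof -
      have "f b \<in> \<Omega>" using f sub b unfolding holomorphic_disc_def by blast
      moreover have "norm (f b - p) < \<eta>"
        by (rule C(2)[OF p f]) (use b z(2) f0 in \<open>auto simp: R_def\<close>)
      ultimately show ?thesis using g_neg(1)[OF p, of "f b"] by (simp add: F_def)
    qed
    have le: "cmod (deriv F 0) * R \<le> 2 * Re (F 0)" by (rule half_plane_schwarz(1)[OF hF R(1) pos])
    \<comment> \<open>\<open>D\<close> is a real derivative, so the complex derivative of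
      \<open>F\<close> at 0 is compared with it along the real axis.\<close>
    have cr: "(complex_of_real has_vector_derivative 1) (at 0)"
      using has_vector_derivative_of_real[of "\<lambda>t. t" 1] by (auto intro: derivative_eq_intros)
    have "(F has_field_derivative deriv F 0) (at (of_real 0))"
      using holomorphic_derivI[OF hF open_ball, of 0] R by simp
    then have "((\<lambda>t. F (of_real t)) has_vector_derivative 1 * deriv F 0) (at 0)"
      using field_vector_diff_chain_at[OF cr, of F "deriv F 0"] by (simp add: o_def)
    then have d1: "((\<lambda>t. F (of_real t)) has_vector_derivative deriv F 0) (at 0)" by simp
    have "((\<lambda>t. f (of_real t)) has_vector_derivative 1 *s disc_deriv f (of_real 0)) (at 0)"
      using holomorphic_disc_vector_derivative[OF f, of complex_of_real 1 0 UNIV] cr by simp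
    then have fd: "((\<lambda>t. f (of_real t)) has_derivative (\<lambda>s. s *\<^sub>R (\<xi> /\<^sub>R \<alpha>))) (at 0)"
      by (simp add: has_vector_derivative_def f' vec_eq_iff)
    have "((\<lambda>t. g p (f (of_real t))) has_derivative (\<lambda>s. D (s *\<^sub>R (\<xi> /\<^sub>R \<alpha>)))) (at (0::real))"
      by (rule has_derivative_compose[OF fd]) (use D f0 in simp)
    then have "((\<lambda>t. F (of_real t)) has_derivative (\<lambda>s. - D (s *\<^sub>R (\<xi> /\<^sub>R \<alpha>)))) (at (0::real))"
      unfolding F_def by (rule has_derivative_minus)
    moreover have lD: "linear D" using D has_derivative_linear by blast
    ultimately have "((\<lambda>t. F (of_real t)) has_vector_derivative - D (\<xi> /\<^sub>R \<alpha>)) (at 0)"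
      unfolding has_vector_derivative_def by (simp add: linear_scale)
    then have "deriv F 0 = - D (\<xi> /\<^sub>R \<alpha>)" using d1 vector_derivative_unique_at by blast
    also have "\<dots> = - (D \<xi> /\<^sub>R \<alpha>)" using lD by (simp add: linear_scale)
    finally have "cmod (deriv F 0) = cmod (D \<xi>) / \<alpha>" using a by (simp add: divide_inverse mult.commute)
    then have "cmod (D \<xi>) / \<alpha> * R \<le> 2 * cmod (g p z)"
      using le abs_Re_le_cmod[of "g p z"] by (simp add: F_def f0)
    then show "(1 - C * cmod (g p z)) * cmod (D \<xi>) / (2 * cmod (g p z)) \<le> \<alpha>"
      using gp a unfolding R_def[symmetric] by (simp add: field_simps)
  qed
  then show ?thesis using that C(1) by blast
qed

end

section \<open>Length of a curve near a boundary point\<close>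

context spc_domain
begin

abbreviation kob_length :: "(real \<Rightarrow> complex^'n) \<Rightarrow> real set \<Rightarrow> ennreal" where
  "kob_length \<gamma> A \<equiv> (\<integral>\<^sup>+t\<in>A. ennreal (kobayashi_metric \<Omega> (\<gamma> t) (vector_derivative \<gamma> (at t))) \<partial>lborel)"

text \<open>With \<open>n = |g p|\<close> along the curve, the metric is at least
  \<open>(1 - C * n) * |n'| / (2 * n)\<close>, and \<open>f = ln n / 2 - C * n / 2\<close> is an
  antiderivative of that expression without the absolute value. As \<open>C * n \<le> 1 / 2\<close>,
  the second term of \<open>f\<close> costs less than 1.\<close>

lemma segment_cost:
  obtains C where "C > 0"
    "\<And>p \<gamma> a b. p \<in> frontier \<Omega> \<Longrightarrow> piecewise_C1_curve \<gamma> \<Longrightarrow> 0 \<le> a \<Longrightarrow> a \<le> b \<Longrightarrow> b \<le> 1 \<Longrightarrow>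
       \<forall>t\<in>{a..b}. \<gamma> t \<in> \<Omega> \<and> norm (\<gamma> t - p) < \<eta> \<and> C * cmod (g p (\<gamma> t)) \<le> 1 / 2 \<Longrightarrow>
       ennreal (\<bar>ln (cmod (g p (\<gamma> b))) - ln (cmod (g p (\<gamma> a)))\<bar> / 2 - 1) \<le>
       kob_length \<gamma> {a<..<b}"
proof -
  obtain C where C: "C > 0"
    "\<And>p z \<xi> D. p \<in> frontier \<Omega> \<Longrightarrow> z \<in> \<Omega> \<Longrightarrow> norm (z - p) < \<eta> \<Longrightarrow> C * cmod (g p z) < 1 \<Longrightarrow>
       (g p has_derivative D) (at z) \<Longrightarrow>
       (1 - C * cmod (g p z)) * cmod (D \<xi>) / (2 * cmod (g p z)) \<le> kobayashi_metric \<Omega> z \<xi>"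
    by (rule kobayashi_metric_lower_bound) (rule that)
  have "ennreal (\<bar>ln (cmod (g p (\<gamma> b))) - ln (cmod (g p (\<gamma> a)))\<bar> / 2 - 1) \<le>
       kob_length \<gamma> {a<..<b}"
    if p: "p \<in> frontier \<Omega>" and \<gamma>: "piecewise_C1_curve \<gamma>" and ab: "0 \<le> a" "a \<le> b" "b \<le> 1"
      and in_B': "\<forall>t\<in>{a..b}. \<gamma> t \<in> \<Omega> \<and> norm (\<gamma> t - p) < \<eta> \<and> C * cmod (g p (\<gamma> t)) \<le> 1 / 2"
    for p \<gamma> a b
  proof -
    note in_B = bspec[OF in_B']
    obtain S where S: "finite S" "continuous_on {0..1} \<gamma>"
      "\<And>t. t \<in> {0..1} - S \<Longrightarrow> (\<gamma> has_vector_derivative vector_derivative \<gamma> (at t)) (at t)"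
      using piecewise_C1_curve_imp[OF \<gamma>] by metis
    define n where "n = (\<lambda>t. cmod (g p (\<gamma> t)))"
    have npos: "n t > 0" if "t \<in> {a..b}" for t
      using g_neg(5)[OF p, of "\<gamma> t"] in_B[OF that] by (simp add: n_def)
    have cn: "continuous_on {a..b} n"
      unfolding n_def
      by (intro continuous_intros continuous_on_compose2[OF continuous_g continuous_on_subset[OF S(2)]])
         (use ab in auto)
    define D where "D = (\<lambda>t. frechet_derivative (g p) (at (\<gamma> t)))"
    have D: "(g p has_derivative D t) (at (\<gamma> t))" for t
      unfolding D_def using g_differentiable frechet_derivative_works by blast
    define w where "w = (\<lambda>t. D t (vector_derivative \<gamma> (at t)))"
    define n' where "n' = (\<lambda>t. (g p (\<gamma> t) \<bullet> w t) / n t)"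
    define f where "f = (\<lambda>t. ln (n t) / 2 - C * n t / 2)"
    have nd: "(n has_vector_derivative n' t) (at t)" if t: "t \<in> {a<..<b} - S" for t
    proof -
      have "(\<gamma> has_derivative (\<lambda>s. s *\<^sub>R vector_derivative \<gamma> (at t))) (at t)"
        using S(3)[of t] t ab by (simp add: has_vector_derivative_def)
      from has_derivative_compose[OF this D]
      have gd: "((\<lambda>t. g p (\<gamma> t)) has_derivative (\<lambda>s. s *\<^sub>R w t)) (at t)"
        using has_derivative_linear[OF D[of t]] by (simp add: w_def linear_scale)
      have nz: "g p (\<gamma> t) \<noteq> 0" using npos[of t] t by (auto simp: n_def)
      have "(n has_derivative (\<lambda>s. (s *\<^sub>R w t) \<bullet> sgn (g p (\<gamma> t)))) (at t)"
        unfolding n_def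
        by (rule has_derivative_compose[OF gd has_derivative_norm[OF nz]])
      moreover have "w t \<bullet> sgn (g p (\<gamma> t)) = n' t"
        by (simp add: n'_def n_def sgn_div_norm inner_commute divide_inverse)
      ultimately show ?thesis by (simp add: has_vector_derivative_def)
    qed
    have "ennreal \<bar>f b - f a\<bar> \<le> kob_length \<gamma> {a<..<b}"
    proof (rule nn_integral_ge_increment[OF ab(2) _ S(1)])
      show "continuous_on {a..b} f"
        unfolding f_def using npos by (intro continuous_intros cn) fastforce+
      fix t assume t: "t \<in> {a<..<b} - S"
      have np: "n t > 0" using npos t by simp
      have ib: "\<gamma> t \<in> \<Omega>" "norm (\<gamma> t - p) < \<eta>" "C * n t \<le> 1 / 2" using in_B[of t] t by (auto simp: n_def)
      have "(n has_real_derivative n' t) (at t)"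
        using nd[OF t] by (simp add: has_real_derivative_iff_has_vector_derivative)
      then have "(f has_real_derivative n' t / n t / 2 - C * n' t / 2) (at t)"
        unfolding f_def using np by (auto intro!: derivative_eq_intros)
      moreover have "n' t / n t / 2 - C * n' t / 2 = (1 - C * n t) * n' t / (2 * n t)"
        using np by (simp add: field_simps)
      ultimately show "(f has_vector_derivative (1 - C * n t) * n' t / (2 * n t)) (at t)"
        by (simp add: has_real_derivative_iff_has_vector_derivative)
      have "\<bar>n' t\<bar> \<le> cmod (w t)"
      proof -
        have "\<bar>g p (\<gamma> t) \<bullet> w t\<bar> \<le> n t * cmod (w t)" unfolding n_def by (rule Cauchy_Schwarz_ineq2)
        then show ?thesis using np by (simp add: n'_def abs_divide divide_le_eq mult.commute)
      qed
      then have "\<bar>(1 - C * n t) * n' t / (2 * n t)\<bar> \<le> (1 - C * n t) * cmod (w t) / (2 * n t)"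
        using np ib(3) by (simp add: abs_mult abs_divide divide_right_mono mult_left_mono)
      also have "\<dots> \<le> kobayashi_metric \<Omega> (\<gamma> t) (vector_derivative \<gamma> (at t))"
        using C(2)[OF p ib(1,2) _ D, of "vector_derivative \<gamma> (at t)"] ib(3) by (simp add: n_def w_def)
      finally show "\<bar>(1 - C * n t) * n' t / (2 * n t)\<bar> \<le> kobayashi_metric \<Omega> (\<gamma> t) (vector_derivative \<gamma> (at t))" .
    qed
    moreover have "\<bar>ln (n b) - ln (n a)\<bar> / 2 - 1 \<le> \<bar>f b - f a\<bar>"
    proof -
      have "0 \<le> C * n a" "C * n a \<le> 1 / 2" "0 \<le> C * n b" "C * n b \<le> 1 / 2"
        using in_B[of a] in_B[of b] ab C(1) by (auto simp: n_def)
      moreover have "\<bar>x - y\<bar> / 2 - 1 \<le> \<bar>x / 2 - u / 2 - (y / 2 - v / 2)\<bar>"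
        if "0 \<le> u" "u \<le> 1 / 2" "0 \<le> v" "v \<le> 1 / 2" for x y u v :: real
        using that by (smt (verit) field_sum_of_halves)
      ultimately show ?thesis unfolding f_def by blast
    qed
    ultimately show ?thesis unfolding n_def using order_trans[OF ennreal_leI] by blast
  qed
  then show ?thesis using that C(1) by blast
qed

definition peak_region :: "complex^'n \<Rightarrow> real \<Rightarrow> (complex^'n) set" where
  "peak_region p s = {z\<in>\<Omega>. norm (z - p) < \<eta> \<and> cmod (g p z) < s}"

text \<open>Inside the region \<open>c * |z - p|^2 < s\<close>, so for
  \<open>s \<le> c * \<eta>^2 / 4\<close> the curve stays within \<open>\<eta> / 2\<close> of
  \<open>p\<close> and can leave only through \<open>cmod (g p z) = s\<close>. If it starts outside
  the region, \<tau> is 0; hence the condition in the last claim.\<close>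

lemma exit_time:
  assumes p: "p \<in> frontier \<Omega>" and cont: "continuous_on {0..1::real} \<gamma>" and \<gamma>: "\<And>t. t \<in> {0..1} \<Longrightarrow> \<gamma> t \<in> \<Omega>"
    and start: "norm (\<gamma> 0 - p) < \<eta>" and s: "s \<le> c * \<eta>\<^sup>2 / 4"
    and ex: "\<exists>t\<in>{0..1}. \<gamma> t \<notin> peak_region p s"
  obtains \<tau> where "\<tau> \<in> {0..1}" "\<And>t. t \<in> {0..<\<tau>} \<Longrightarrow> \<gamma> t \<in> peak_region p s"
    "norm (\<gamma> \<tau> - p) < \<eta>" "cmod (g p (\<gamma> \<tau>)) \<ge> s" "\<tau> > 0 \<Longrightarrow> cmod (g p (\<gamma> \<tau>)) \<le> s"
proof -
  define T where "T = {t\<in>{0..1}. \<gamma> t \<notin> peak_region p s}"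
  have cnp: "continuous_on {0..1} (\<lambda>t. norm (\<gamma> t - p))" by (intro continuous_intros cont)
  have cg: "continuous_on {0..1} (\<lambda>t. cmod (g p (\<gamma> t)))"
    by (intro continuous_intros continuous_on_compose2[OF continuous_g cont]) auto
  have "T = ({0..1} \<inter> (\<lambda>t. norm (\<gamma> t - p)) -` {\<eta>..}) \<union> ({0..1} \<inter> (\<lambda>t. cmod (g p (\<gamma> t))) -` {s..})"
    using \<gamma> by (auto simp: T_def peak_region_def)
  moreover have "closed ({0..1} \<inter> (\<lambda>t. norm (\<gamma> t - p)) -` {\<eta>..})"
    by (rule continuous_closed_preimage[OF cnp]) auto
  moreover have "closed ({0..1} \<inter> (\<lambda>t. cmod (g p (\<gamma> t))) -` {s..})"
    by (rule continuous_closed_preimage[OF cg]) auto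
  ultimately have "closed T" by (metis closed_Un)
  moreover have "bounded T" unfolding T_def by (rule bounded_subset[OF bounded_closed_interval[of 0 1]]) auto
  ultimately have "compact T" by (simp add: compact_eq_bounded_closed)
  moreover have "T \<noteq> {}" using ex by (auto simp: T_def)
  ultimately obtain \<tau> where \<tau>: "\<tau> \<in> T" "\<And>t. t \<in> T \<Longrightarrow> \<tau> \<le> t" using compact_attains_inf[of T] by blast
  have \<tau>01: "\<tau> \<in> {0..1}" using \<tau>(1) by (simp add: T_def)
  have before: "\<gamma> t \<in> peak_region p s" if "t \<in> {0..<\<tau>}" for t
  proof (rule ccontr)
    assume "\<gamma> t \<notin> peak_region p s"
    then have "t \<in> T" using that \<tau>01 by (simp add: T_def)
    then show False using \<tau>(2) that by force
  qed
  have lim: "norm (\<gamma> \<tau> - p) < \<eta>" "cmod (g p (\<gamma> \<tau>)) \<le> s" if pos: "\<tau> > 0"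
  proof -
    have cl: "closure {0..<\<tau>} = {0..\<tau>}" using pos by simp
    have sub: "{0..\<tau>} \<subseteq> {0..1}" using \<tau>01 by auto
    show "cmod (g p (\<gamma> \<tau>)) \<le> s"
      by (rule continuous_le_on_closure[of "{0..<\<tau>}" "\<lambda>t. cmod (g p (\<gamma> t))" \<tau> s])
         (use before pos cl continuous_on_subset[OF cg sub] in \<open>auto simp: peak_region_def less_imp_le\<close>)
    have "norm (\<gamma> \<tau> - p) \<le> \<eta> / 2"
    proof (rule continuous_le_on_closure[of "{0..<\<tau>}" "\<lambda>t. norm (\<gamma> t - p)" \<tau> "\<eta> / 2"])
      fix t assume "t \<in> {0..<\<tau>}"
      then have b: "\<gamma> t \<in> \<Omega>" "norm (\<gamma> t - p) < \<eta>" "cmod (g p (\<gamma> t)) < s"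
        using before by (auto simp: peak_region_def)
      have "c * (norm (\<gamma> t - p))\<^sup>2 \<le> c * (\<eta> / 2)\<^sup>2"
        using g_neg(3)[OF p b(1)] b s by (simp add: power_divide)
      then have "(norm (\<gamma> t - p))\<^sup>2 \<le> (\<eta> / 2)\<^sup>2"
        by (rule mult_left_le_imp_le) (rule const_bounds)
      then show "norm (\<gamma> t - p) \<le> \<eta> / 2"
        by (rule power2_le_imp_le) (use const_bounds(7) in linarith)
    qed (use pos cl continuous_on_subset[OF cnp sub] in auto)
    then show "norm (\<gamma> \<tau> - p) < \<eta>" using const_bounds by simp
  qed
  have n: "norm (\<gamma> \<tau> - p) < \<eta>" using lim(1) start \<tau>01 by (cases "\<tau> = 0") auto
  have "cmod (g p (\<gamma> \<tau>)) \<ge> s" using \<tau>(1) n \<gamma>[OF \<tau>01] by (auto simp: T_def peak_region_def)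
  then show ?thesis using that[OF \<tau>01 before n _ lim(2)] by blast
qed

text \<open>The two choices of \<open>\<theta>\<close> give the first exit and the last entrance of the curve.\<close>

lemma exit_cost:
  obtains s1 where "s1 > 0"
    "\<And>p s \<gamma> \<theta>. p \<in> frontier \<Omega> \<Longrightarrow> 0 < s \<Longrightarrow> s \<le> s1 \<Longrightarrow> piecewise_C1_curve \<gamma> \<Longrightarrow> \<gamma> ` {0..1} \<subseteq> \<Omega> \<Longrightarrow>
       \<theta> = (\<lambda>t. t) \<or> \<theta> = (\<lambda>t. 1 - t) \<Longrightarrow>
       norm (\<gamma> (\<theta> 0) - p) < \<eta> \<Longrightarrow> \<exists>t\<in>{0..1}. \<gamma> t \<notin> peak_region p s \<Longrightarrow>
       \<exists>\<tau>\<in>{0..1}. (\<forall>t\<in>{0..<\<tau>}. \<gamma> (\<theta> t) \<in> peak_region p s) \<and>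
         ennreal (ln (s / cmod (g p (\<gamma> (\<theta> 0)))) / 2 - 1) \<le> kob_length \<gamma> (\<theta> ` {0<..<\<tau>})"
proof -
  obtain C where C: "C > 0"
    "\<And>p \<gamma> a b. p \<in> frontier \<Omega> \<Longrightarrow> piecewise_C1_curve \<gamma> \<Longrightarrow> 0 \<le> a \<Longrightarrow> a \<le> b \<Longrightarrow> b \<le> 1 \<Longrightarrow>
       \<forall>t\<in>{a..b}. \<gamma> t \<in> \<Omega> \<and> norm (\<gamma> t - p) < \<eta> \<and> C * cmod (g p (\<gamma> t)) \<le> 1 / 2 \<Longrightarrow>
       ennreal (\<bar>ln (cmod (g p (\<gamma> b))) - ln (cmod (g p (\<gamma> a)))\<bar> / 2 - 1) \<le> kob_length \<gamma> {a<..<b}"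
    by (rule segment_cost) (rule that)
  \<comment> \<open>The first bound is the condition of \<open>exit_time\<close>, the second one
    gives \<open>C * cmod (g p z) \<le> 1 / 2\<close> for \<open>segment_cost\<close>.\<close>
  define s1 where "s1 = min (c * \<eta>\<^sup>2 / 4) (1 / (2 * C))"
  have s1: "s1 > 0" "s1 \<le> c * \<eta>\<^sup>2 / 4" "s1 \<le> 1 / (2 * C)" using C(1) const_bounds by (auto simp: s1_def)
  have Cs: "C * x \<le> 1 / 2" if "x \<le> s" "s \<le> s1" for x s
  proof -
    have "C * x \<le> C * (1 / (2 * C))" using that s1(3) C(1) by (intro mult_left_mono) auto
    then show ?thesis using C(1) by simp
  qed
  show ?thesis
  proof (rule that[OF s1(1)])
    fix p s \<gamma> \<theta> assume p: "p \<in> frontier \<Omega>" and s: "0 < s" "s \<le> s1" and \<gamma>: "piecewise_C1_curve \<gamma>"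
      and im: "\<gamma> ` {0..1} \<subseteq> \<Omega>" and \<theta>: "\<theta> = (\<lambda>t. t) \<or> \<theta> = (\<lambda>t::real. 1 - t)"
      and start: "norm (\<gamma> (\<theta> 0) - p) < \<eta>" and ex: "\<exists>t\<in>{0..1}. \<gamma> t \<notin> peak_region p s"
    have cont: "continuous_on {0..1} \<gamma>" using \<gamma> by (simp add: piecewise_C1_curve_def)
    have \<theta>01: "\<theta> t \<in> {0..1}" "\<theta> (\<theta> t) = t" if "t \<in> {0..1}" for t using \<theta> that by auto
    have c\<delta>: "continuous_on {0..1} (\<lambda>t. \<gamma> (\<theta> t))"
      by (rule continuous_on_compose2[OF cont]) (use \<theta> in \<open>auto intro!: continuous_intros\<close>)
    have im\<delta>: "\<gamma> (\<theta> t) \<in> \<Omega>" if "t \<in> {0..1}" for t using im \<theta>01(1)[OF that] by blast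
    have ex\<delta>: "\<exists>t\<in>{0..1}. \<gamma> (\<theta> t) \<notin> peak_region p s" using ex \<theta>01 by metis
    have s14: "s \<le> c * \<eta>\<^sup>2 / 4" using s s1 by simp
    obtain \<tau> where \<tau>: "\<tau> \<in> {0..1}" "\<And>t. t \<in> {0..<\<tau>} \<Longrightarrow> \<gamma> (\<theta> t) \<in> peak_region p s"
        "norm (\<gamma> (\<theta> \<tau>) - p) < \<eta>" "cmod (g p (\<gamma> (\<theta> \<tau>))) \<ge> s" "\<tau> > 0 \<Longrightarrow> cmod (g p (\<gamma> (\<theta> \<tau>))) \<le> s"
      by (rule exit_time[OF p c\<delta> im\<delta> start s14 ex\<delta>]) (assumption | rule that)+
    have g0: "cmod (g p (\<gamma> (\<theta> 0))) > 0" using g_neg(5)[OF p im\<delta>[of 0]] start by simp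
    have ln0: "ln (s / cmod (g p (\<gamma> (\<theta> 0)))) = ln s - ln (cmod (g p (\<gamma> (\<theta> 0))))"
      by (rule ln_divide_pos[OF s(1) g0])
    have ln\<tau>: "ln s \<le> ln (cmod (g p (\<gamma> (\<theta> \<tau>))))" using s(1) \<tau>(4) by (subst ln_le_cancel_iff) auto
    have "ennreal (ln (s / cmod (g p (\<gamma> (\<theta> 0)))) / 2 - 1) \<le> kob_length \<gamma> (\<theta> ` {0<..<\<tau>})"
    proof (cases "\<tau> = 0")
      case True
      \<comment> \<open>An exit at time 0 means that
        \<open>cmod (g p (\<gamma> (\<theta> 0)))\<close> is already at least \<open>s\<close>; the
        bound is then not positive and \<open>ennreal\<close> makes it 0.\<close>
      then have "ln (s / cmod (g p (\<gamma> (\<theta> 0)))) / 2 - 1 \<le> 0" using ln\<tau> unfolding ln0 by simp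
      then show ?thesis by (simp add: ennreal_neg)
    next
      case False
      have in_B: "\<gamma> (\<theta> t) \<in> \<Omega> \<and> norm (\<gamma> (\<theta> t) - p) < \<eta> \<and> C * cmod (g p (\<gamma> (\<theta> t))) \<le> 1 / 2"
        if t: "t \<in> {0..\<tau>}" for t
      proof (cases "t = \<tau>")
        case True
        then show ?thesis using \<tau> False im\<delta>[of \<tau>] Cs[OF \<tau>(5) s(2)] by auto
      next
        case False
        then have "\<gamma> (\<theta> t) \<in> peak_region p s" using \<tau>(2) t by auto
        then show ?thesis using Cs[OF _ s(2), of "cmod (g p (\<gamma> (\<theta> t)))"] by (auto simp: peak_region_def)
      qed
      have "ennreal (\<bar>ln (cmod (g p (\<gamma> (\<theta> \<tau>)))) - ln (cmod (g p (\<gamma> (\<theta> 0))))\<bar> / 2 - 1) \<le> kob_length \<gamma> (\<theta> ` {0<..<\<tau>})"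
        using \<theta>
      proof
        assume id: "\<theta> = (\<lambda>t. t)"
        show ?thesis using C(2)[OF p \<gamma>, of 0 \<tau>] in_B \<tau>(1) unfolding id by simp
      next
        assume rev: "\<theta> = (\<lambda>t. 1 - t)"
        have "t \<in> \<theta> ` {0<..<\<tau>}" if "t \<in> {1 - \<tau><..<1}" for t
          using that unfolding rev by (intro image_eqI[of _ _ "1 - t"]) auto
        then have im\<theta>: "\<theta> ` {0<..<\<tau>} = {1 - \<tau><..<1}" unfolding rev by auto
        have "\<forall>t\<in>{1 - \<tau>..1}. \<gamma> t \<in> \<Omega> \<and> norm (\<gamma> t - p) < \<eta> \<and> C * cmod (g p (\<gamma> t)) \<le> 1 / 2"
          using in_B[of "1 - t" for t] unfolding rev by auto
        from C(2)[OF p \<gamma> _ _ _ this] show ?thesis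
          unfolding im\<theta> using \<tau>(1) by (simp add: rev abs_minus_commute)
      qed
      moreover have "ln (s / cmod (g p (\<gamma> (\<theta> 0)))) / 2 - 1 \<le>
          \<bar>ln (cmod (g p (\<gamma> (\<theta> \<tau>)))) - ln (cmod (g p (\<gamma> (\<theta> 0))))\<bar> / 2 - 1"
        unfolding ln0
        using ln\<tau> abs_ge_self[of "ln (cmod (g p (\<gamma> (\<theta> \<tau>)))) - ln (cmod (g p (\<gamma> (\<theta> 0))))"]
        by (intro diff_right_mono divide_right_mono) linarith+
      ultimately show ?thesis using order_trans[OF ennreal_leI] by blast
    qed
    then show "\<exists>\<tau>\<in>{0..1}. (\<forall>t\<in>{0..<\<tau>}. \<gamma> (\<theta> t) \<in> peak_region p s) \<and>
         ennreal (ln (s / cmod (g p (\<gamma> (\<theta> 0)))) / 2 - 1) \<le> kob_length \<gamma> (\<theta> ` {0<..<\<tau>})"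
      using \<tau>(1,2) by blast
  qed
qed

end

section \<open>Lower bound for the Kobayashi distance\<close>

context spc_domain
begin

text \<open>
  The Kobayashi distance of \<open>P\<close> and \<open>Q\<close> differs from
  \<open>ln (h / dd P) / 2 + ln (h / dd Q) / 2\<close> with \<open>h = sep P Q\<close> by a bounded amount, as long as \<open>h\<close> is
  small. The squared modulus measures the complex tangential part of \<open>Q - P\<close> and the Hermitian
  product its complex normal part.
\<close>

definition sep :: "complex^'n \<Rightarrow> complex^'n \<Rightarrow> real" where
  "sep P Q = Max {dd P, dd Q, (norm (Q - P))\<^sup>2, cmod (herm (G P) (Q - P))}"

lemma sep_less_iff: "sep P Q < h \<longleftrightarrow> dd P < h \<and> dd Q < h \<and> (norm (Q - P))\<^sup>2 < h \<and> cmod (herm (G P) (Q - P)) < h"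
  unfolding sep_def by (subst Max_less_iff) auto

lemma sep_ge: "dd P \<le> sep P Q" "dd Q \<le> sep P Q" "(norm (Q - P))\<^sup>2 \<le> sep P Q" "cmod (herm (G P) (Q - P)) \<le> sep P Q"
  unfolding sep_def by (intro Max_ge; simp)+

text \<open>Let \<open>x^2 = \<epsilon> * h\<close>. A common point \<open>z\<close> has distance
  \<open>O(x)\<close> from \<open>p\<close> and \<open>q\<close>, and its complex normal
  displacement from each is \<open>O(x^2)\<close>. The triangle inequality passes this on to
  \<open>P\<close> and \<open>Q\<close>, so every quantity in \<open>sep P Q\<close> is
  \<open>O(\<epsilon> * h)\<close>.\<close>

lemma peak_regions_disjoint:
  obtains \<epsilon> h0 where "0 < \<epsilon>" "\<epsilon> < 1" "0 < h0"
    "\<And>P Q p q h z. p \<in> frontier \<Omega> \<Longrightarrow> q \<in> frontier \<Omega> \<Longrightarrow> 0 < h \<Longrightarrow> h \<le> h0 \<Longrightarrow>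
       norm (P - p) \<le> \<epsilon> * h \<Longrightarrow> norm (Q - q) \<le> \<epsilon> * h \<Longrightarrow>
       z \<in> peak_region p (\<epsilon> * h) \<Longrightarrow> z \<in> peak_region q (\<epsilon> * h) \<Longrightarrow> sep P Q < h"
proof -
  \<comment> \<open>A convenient number with \<open>k \<ge> 1\<close> and
    \<open>k^2 \<ge> 1 / c\<close>; it turns \<open>c * |z - a|^2 \<le> x^2\<close> into
    \<open>|z - a| \<le> k * x\<close>.\<close>
  define k where "k = 1 + 1 / c"
  have k: "k \<ge> 1" "1 / c \<le> k\<^sup>2"
  proof -
    have i: "0 \<le> 1 / c" using const_bounds by simp
    then show "k \<ge> 1" by (simp add: k_def)
    have "x \<le> (1 + x)\<^sup>2" if "0 \<le> x" for x :: real
      using that mult_nonneg_nonneg[OF that that] by (simp add: power2_eq_square algebra_simps)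
    then show "1 / c \<le> k\<^sup>2" using i by (simp add: k_def)
  qed
  \<comment> \<open>Then \<open>h = 32 * M * k^2 * x^2\<close>, while the estimates below add up to
    at most \<open>12 * M * k^2 * x^2\<close> for the normal part and \<open>16 * k^2 * x^2\<close>
    for the squared distance.\<close>
  define \<epsilon> where "\<epsilon> = 1 / (32 * M * k\<^sup>2)"
  have Mk: "1 \<le> M * k\<^sup>2" "k \<le> k\<^sup>2" "1 \<le> k\<^sup>2" "M \<le> M * k\<^sup>2" "M * k \<le> M * k\<^sup>2" "k\<^sup>2 \<le> M * k\<^sup>2"
  proof -
    show 1: "k \<le> k\<^sup>2" using k by (simp add: power2_eq_square)
    then show 2: "1 \<le> k\<^sup>2" using k by linarith
    then show "M \<le> M * k\<^sup>2" using const_bounds by simp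
    then show "1 \<le> M * k\<^sup>2" using const_bounds by linarith
    show "M * k \<le> M * k\<^sup>2" using 1 const_bounds by (intro mult_left_mono) auto
    show "k\<^sup>2 \<le> M * k\<^sup>2" using mult_right_mono[OF const_bounds(5), of "k\<^sup>2"] by simp
  qed
  have eps: "0 < \<epsilon>" "\<epsilon> < 1" using Mk(1) by (auto simp: \<epsilon>_def divide_less_eq)
  have epsk: "32 * (M * k\<^sup>2) * \<epsilon> = 1" using k(1) const_bounds by (simp add: \<epsilon>_def)
  \<comment> \<open>Ensures \<open>2 * k * x \<le> \<eta>\<close>, so all displacements are in the
    range of the Lipschitz and peak estimates.\<close>
  define h0 where "h0 = (\<eta> / (2 * k))\<^sup>2"
  have h0: "h0 > 0" using const_bounds k by (simp add: h0_def)
  have "sep P Q < h"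
    if p: "p \<in> frontier \<Omega>" and q: "q \<in> frontier \<Omega>" and h: "0 < h" "h \<le> h0"
      and Pp: "norm (P - p) \<le> \<epsilon> * h" and Qq: "norm (Q - q) \<le> \<epsilon> * h"
      and zp: "z \<in> peak_region p (\<epsilon> * h)" and zq: "z \<in> peak_region q (\<epsilon> * h)" for P Q p q h z
  proof -
    define x where "x = sqrt (\<epsilon> * h)"
    have x2: "x\<^sup>2 = \<epsilon> * h" using eps h by (simp add: x_def)
    have x0: "x > 0" using eps h by (simp add: x_def)
    have "x\<^sup>2 \<le> (\<eta> / (2 * k))\<^sup>2"
    proof -
      have "\<epsilon> * h \<le> 1 * h" using eps h by (intro mult_right_mono) auto
      then show ?thesis unfolding h0_def[symmetric] x2 using h by linarith
    qed
    then have xe: "x \<le> \<eta> / (2 * k)" using const_bounds k by (intro power2_le_imp_le[of x]) auto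
    then have kx: "2 * (k * x) \<le> \<eta>" using k by (simp add: field_simps)
    have xk: "x \<le> k * x" using k x0 by simp
    have x1: "x \<le> 1" using kx xk x0 const_bounds by linarith
    have xx: "x\<^sup>2 \<le> x" using x0 x1 by (simp add: power2_eq_square)
    have near: "norm (z - a) \<le> k * x" if a: "a \<in> frontier \<Omega>" "z \<in> peak_region a (\<epsilon> * h)" for a
    proof -
      have "c * (norm (z - a))\<^sup>2 \<le> x\<^sup>2"
        using g_neg(3)[OF a(1), of z] a(2) unfolding x2 by (auto simp: peak_region_def)
      then have "(norm (z - a))\<^sup>2 \<le> 1 / c * x\<^sup>2" using const_bounds by (simp add: field_simps)
      also have "\<dots> \<le> k\<^sup>2 * x\<^sup>2" using k by (intro mult_right_mono) auto
      finally have "(norm (z - a))\<^sup>2 \<le> (k * x)\<^sup>2" by (simp add: power_mult_distrib)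
      then show ?thesis using k x0 by (intro power2_le_imp_le[of "norm (z - a)"]) auto
    qed
    have hz: "cmod (herm (G a) (z - a)) \<le> x\<^sup>2 + M * (k * x)\<^sup>2" if a: "a \<in> frontier \<Omega>" "z \<in> peak_region a (\<epsilon> * h)" for a
    proof -
      have n: "norm (z - a) \<le> k * x" by (rule near[OF a])
      have "cmod (g a z - herm (G a) (z - a)) \<le> M * (norm (z - a))\<^sup>2"
        by (rule g_approx) (use a n in \<open>auto simp: peak_region_def\<close>)
      also have "\<dots> \<le> M * (k * x)\<^sup>2" using n const_bounds by (intro mult_left_mono power_mono) auto
      finally have "cmod (g a z - herm (G a) (z - a)) \<le> M * (k * x)\<^sup>2" .
      moreover have "cmod (g a z) \<le> x\<^sup>2" using a(2) unfolding x2 by (simp add: peak_region_def)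
      moreover have "cmod (herm (G a) (z - a)) \<le> cmod (g a z) + cmod (g a z - herm (G a) (z - a))"
        using norm_triangle_ineq4[of "g a z" "g a z - herm (G a) (z - a)"] by simp
      ultimately show ?thesis by linarith
    qed
    have pq: "norm (q - p) \<le> 2 * (k * x)"
      using norm_triangle_ineq4[of "z - p" "z - q"] near[OF p zp] near[OF q zq] by simp
    have Pp': "norm (P - p) \<le> x\<^sup>2" "norm (Q - q) \<le> x\<^sup>2" using Pp Qq by (auto simp: x2)
    have PQ: "norm (Q - P) \<le> 4 * (k * x)"
    proof -
      have "Q - P = (q - p) + ((Q - q) - (P - p))" by simp
      then have "norm (Q - P) \<le> norm (q - p) + (norm (Q - q) + norm (P - p))"
        using norm_triangle_ineq[of "q - p" "(Q - q) - (P - p)"] norm_triangle_ineq4[of "Q - q" "P - p"] by simp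
      then show ?thesis using pq Pp' xx xk by linarith
    qed
    have ip: "dd p \<le> \<rho>" "dd q \<le> \<rho>" using p q const_bounds by auto
    have dG: "norm (G P - G p) \<le> M * x\<^sup>2"
    proof -
      have "norm (G (p + (P - p)) - G p) \<le> M * norm (P - p)"
        by (rule G_lipschitz[OF ip(1)]) (use Pp' xx x0 kx xk const_bounds in linarith)
      also have "\<dots> \<le> M * x\<^sup>2" using Pp' const_bounds by (intro mult_left_mono) auto
      finally show ?thesis by simp
    qed
    have dGq: "norm (G p - G q) \<le> M * (2 * (k * x))"
    proof -
      have "norm (G (p + (q - p)) - G p) \<le> M * norm (q - p)"
        by (rule G_lipschitz[OF ip(1)]) (use pq kx const_bounds in linarith)
      also have "\<dots> \<le> M * (2 * (k * x))" using pq const_bounds by (intro mult_left_mono) auto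
      finally show ?thesis by (simp add: norm_minus_commute)
    qed
    have b1: "cmod (herm (G P - G p) (Q - P)) \<le> (M * x\<^sup>2) * (4 * 1)"
    proof -
      have "norm (Q - P) \<le> 4 * 1" using PQ kx const_bounds by linarith
      then show ?thesis
        using dG const_bounds by (intro order_trans[OF norm_herm_le] mult_mono) auto
    qed
    have b2: "cmod (herm (G p - G q) (z - q)) \<le> (M * (2 * (k * x))) * (k * x)"
      using dGq near[OF q zq] const_bounds k x0 by (intro order_trans[OF norm_herm_le] mult_mono) auto
    have b3: "cmod (herm (G p) v) \<le> M * x\<^sup>2" if "norm v \<le> x\<^sup>2" for v
      using that G_bounds[OF ip(1)] const_bounds by (intro order_trans[OF norm_herm_le] mult_mono) auto
    \<comment> \<open>The gradient is moved from \<open>P\<close> to \<open>p\<close> and, for the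
      displacement \<open>z - q\<close>, from \<open>p\<close> to \<open>q\<close>. The first change
      is \<open>O(x^2)\<close> and meets a bounded vector, the second is \<open>O(x)\<close> and
      meets a vector of size \<open>O(x)\<close>.\<close>
    have dec: "herm (G P) (Q - P) = herm (G P - G p) (Q - P) + herm (G p) (z - p)
        - (herm (G q) (z - q) + herm (G p - G q) (z - q)) + herm (G p) (Q - q) - herm (G p) (P - p)"
      by (simp add: herm_diff)
    have tri: "cmod (a + b - (d + e) + f - u) \<le> cmod a + cmod b + (cmod d + cmod e) + cmod f + cmod u" for a b d e f u
      using norm_triangle_ineq4[of "a + b - (d + e) + f" u] norm_triangle_ineq[of "a + b - (d + e)" f]
        norm_triangle_ineq4[of "a + b" "d + e"] norm_triangle_ineq[of a b] norm_triangle_ineq[of d e]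
      by linarith
    have "x\<^sup>2 * (32 * (M * k\<^sup>2)) = (32 * (M * k\<^sup>2) * \<epsilon>) * h" unfolding x2 by (simp only: ac_simps)
    then have xh: "x\<^sup>2 * (32 * (M * k\<^sup>2)) = h" using epsk by simp
    have hPQ: "cmod (herm (G P) (Q - P)) \<le> (M * x\<^sup>2) * 4 + (x\<^sup>2 + M * (k * x)\<^sup>2) +
        ((x\<^sup>2 + M * (k * x)\<^sup>2) + (M * (2 * (k * x))) * (k * x)) + M * x\<^sup>2 + M * x\<^sup>2"
      unfolding dec
      by (rule order_trans[OF tri]) (intro add_mono b1[simplified] hz p q zp zq b2 b3 Pp')
    also have "\<dots> = x\<^sup>2 * (6 * M + 2 + 4 * (M * k\<^sup>2))" by (simp add: power2_eq_square algebra_simps)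
    also have "\<dots> \<le> x\<^sup>2 * (12 * (M * k\<^sup>2))" using Mk by (intro mult_left_mono) auto
    also have "\<dots> < x\<^sup>2 * (32 * (M * k\<^sup>2))" using Mk x0 by (intro mult_strict_left_mono) auto
    also have "\<dots> = h" by (rule xh)
    finally have 4: "cmod (herm (G P) (Q - P)) < h" .
    have "(norm (Q - P))\<^sup>2 \<le> (4 * (k * x))\<^sup>2" using PQ by (intro power_mono) auto
    also have "\<dots> = x\<^sup>2 * (16 * k\<^sup>2)" by (simp add: power_mult_distrib)
    also have "\<dots> < x\<^sup>2 * (32 * (M * k\<^sup>2))" using Mk x0 by (intro mult_strict_left_mono) auto
    also have "\<dots> = h" by (rule xh)
    finally have 3: "(norm (Q - P))\<^sup>2 < h" .
    have "\<epsilon> * h < h" using eps h by simp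
    then have "dd P < h" "dd Q < h" using dd_le[OF p, of P] dd_le[OF q, of Q] Pp Qq by linarith+
    then show ?thesis using 3 4 by (simp add: sep_less_iff)
  qed
  then show ?thesis using that eps h0 by blast
qed

text \<open>An end point deeper than \<open>\<epsilon>' * h\<close> contributes only a bounded
  logarithm (\<open>deep\<close>). If both end points are shallow, the curve pays in two disjoint
  regions at scale \<open>\<epsilon> * h\<close>. If only one is shallow, its region at the smaller
  scale \<open>\<theta> * h\<close> misses the deep end point, so the curve pays there.\<close>

lemma kobayashi_dist_lower_bound:
  obtains h1 C where "h1 > 0" "C > 0"
    "\<And>P Q h. P \<in> \<Omega> \<Longrightarrow> Q \<in> \<Omega> \<Longrightarrow> 0 < h \<Longrightarrow> h \<le> h1 \<Longrightarrow> h \<le> sep P Q \<Longrightarrow>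
       ennreal (ln (h / dd P) / 2 + ln (h / dd Q) / 2 - C) \<le> kobayashi_dist \<Omega> P Q"
proof -
  obtain s1 where s1: "s1 > 0"
    "\<And>p s \<gamma> \<theta>. p \<in> frontier \<Omega> \<Longrightarrow> 0 < s \<Longrightarrow> s \<le> s1 \<Longrightarrow> piecewise_C1_curve \<gamma> \<Longrightarrow> \<gamma> ` {0..1} \<subseteq> \<Omega> \<Longrightarrow>
       \<theta> = (\<lambda>t. t) \<or> \<theta> = (\<lambda>t. 1 - t) \<Longrightarrow>
       norm (\<gamma> (\<theta> 0) - p) < \<eta> \<Longrightarrow> \<exists>t\<in>{0..1}. \<gamma> t \<notin> peak_region p s \<Longrightarrow>
       \<exists>\<tau>\<in>{0..1}. (\<forall>t\<in>{0..<\<tau>}. \<gamma> (\<theta> t) \<in> peak_region p s) \<and>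
         ennreal (ln (s / cmod (g p (\<gamma> (\<theta> 0)))) / 2 - 1) \<le> kob_length \<gamma> (\<theta> ` {0<..<\<tau>})"
    by (rule exit_cost) (rule that)
  obtain \<epsilon> h0 where e: "0 < \<epsilon>" "\<epsilon> < 1" "0 < h0"
    "\<And>P Q p q h z. p \<in> frontier \<Omega> \<Longrightarrow> q \<in> frontier \<Omega> \<Longrightarrow> 0 < h \<Longrightarrow> h \<le> h0 \<Longrightarrow>
       norm (P - p) \<le> \<epsilon> * h \<Longrightarrow> norm (Q - q) \<le> \<epsilon> * h \<Longrightarrow>
       z \<in> peak_region p (\<epsilon> * h) \<Longrightarrow> z \<in> peak_region q (\<epsilon> * h) \<Longrightarrow> sep P Q < h"
    by (rule peak_regions_disjoint) (rule that)
  \<comment> \<open>By \<open>g_le\<close> a point with \<open>dd Z \<le> \<epsilon>' * h\<close>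
    has \<open>cmod (g a Z) \<le> \<epsilon> * h / 2\<close> for its nearest boundary point
    \<open>a\<close>, so it lies in its own region.\<close>
  define \<epsilon>' where "\<epsilon>' = \<epsilon> / (4 * M)"
  have e': "0 < \<epsilon>'" "\<epsilon>' \<le> \<epsilon>" "\<epsilon>' < 1" using e const_bounds by (auto simp: \<epsilon>'_def divide_simps)
  \<comment> \<open>By the fourth part of \<open>g_neg\<close> a point with
    \<open>dd Z > \<epsilon>' * h\<close> lies outside the region of any boundary point at scale
    \<open>\<theta> * h\<close>.\<close>
  define \<theta> where "\<theta> = min \<epsilon> (\<kappa> / 2 * \<epsilon>')"
  have th: "0 < \<theta>" "\<theta> \<le> \<epsilon>" "\<theta> \<le> \<kappa> / 2 * \<epsilon>'" using e e' kappa_pos by (auto simp: \<theta>_def)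
  define h1 where "h1 = min h0 (min s1 (\<eta> / 2))"
  have h1: "0 < h1" "h1 \<le> h0" "h1 \<le> s1" "h1 \<le> \<eta> / 2" using e s1(1) const_bounds by (auto simp: h1_def)
  define C0 where "C0 = \<bar>ln (\<theta> / (2 * M))\<bar> / 2 + \<bar>ln (1 / \<epsilon>')\<bar> / 2 + 1"
  have C0: "C0 > 0" by (simp add: C0_def add_nonneg_pos)
  have low: "ennreal (ln (h / dd P) / 2 + ln (h / dd Q) / 2 - 2 * C0) \<le>
      kob_length \<gamma> {0..1}"
    if P: "P \<in> \<Omega>" and Q: "Q \<in> \<Omega>" and h: "0 < h" "h \<le> h1" and hs: "h \<le> sep P Q"
      and \<gamma>: "\<gamma> \<in> curves_between \<Omega> P Q" for P Q h \<gamma>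
  proof -
    define F where "F = (\<lambda>t. ennreal (kobayashi_metric \<Omega> (\<gamma> t) (vector_derivative \<gamma> (at t))))"
    have pc: "piecewise_C1_curve \<gamma>" and im: "\<gamma> ` {0..1} \<subseteq> \<Omega>" and g01: "\<gamma> 0 = P" "\<gamma> 1 = Q"
      using \<gamma> by (auto simp: curves_between_def)
    obtain p where p: "p \<in> frontier \<Omega>" "norm (P - p) = dd P" by (rule nearest_frontier_point)
    obtain q where q: "q \<in> frontier \<Omega>" "norm (Q - q) = dd Q" by (rule nearest_frontier_point)
    have dP: "dd P > 0" and dQ: "dd Q > 0" using dd_pos P Q by auto
    have eh: "\<epsilon>' * h \<le> h" "\<epsilon> * h \<le> h" using e e' h by auto
    have deep: "ln (h / dd Z) / 2 \<le> C0 - 1" if "dd Z > \<epsilon>' * h" for Z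
    proof -
      have dZ: "dd Z > 0" using that mult_pos_pos[OF e'(1) h(1)] by linarith
      have "h / dd Z \<le> 1 / \<epsilon>'" using that dZ e' h by (simp add: field_simps less_imp_le)
      then have "ln (h / dd Z) \<le> ln (1 / \<epsilon>')"
        by (subst ln_le_cancel_iff) (use dZ h e' in auto)
      then show ?thesis unfolding C0_def by linarith
    qed
    have shallow: "ln (h / dd Z) / 2 - C0 \<le> ln (s / cmod (g a Z)) / 2 - 1"
      if "Z \<in> \<Omega>" "a \<in> frontier \<Omega>" "norm (Z - a) = dd Z" "dd Z \<le> \<epsilon>' * h" "s \<ge> \<theta> * h" for Z a s
    proof -
      have dZ: "dd Z > 0" using dd_pos that by simp
      have near: "norm (Z - a) \<le> \<eta>" using that eh h h1 const_bounds by linarith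
      have gl: "cmod (g a Z) \<le> 2 * M * dd Z" using g_le[OF that(2) near] that(3) by simp
      have gp: "cmod (g a Z) > 0" using g_neg(5)[OF that(2,1) near] .
      have "ln (h / dd Z * (\<theta> / (2 * M))) = ln (h / dd Z) + ln (\<theta> / (2 * M))"
        by (rule ln_mult_pos) (use dZ h th const_bounds in auto)
      moreover have "h / dd Z * (\<theta> / (2 * M)) = \<theta> * h / (2 * M * dd Z)" by (simp add: ac_simps)
      ultimately have "ln (h / dd Z) + ln (\<theta> / (2 * M)) = ln (\<theta> * h / (2 * M * dd Z))" by metis
      also have "\<dots> \<le> ln (s / cmod (g a Z))"
      proof -
        have "\<theta> * h / (2 * M * dd Z) \<le> s / cmod (g a Z)"
          using that(5) gl gp mult_pos_pos[OF th(1) h(1)] by (intro frac_le) linarith+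
        moreover have "0 < \<theta> * h / (2 * M * dd Z)" using dZ h th const_bounds by simp
        ultimately show ?thesis by simp
      qed
      finally show ?thesis unfolding C0_def by linarith
    qed
    have small: "Z \<in> peak_region a (\<epsilon> * h)"
      if "Z \<in> \<Omega>" "a \<in> frontier \<Omega>" "norm (Z - a) = dd Z" "dd Z \<le> \<epsilon>' * h" for Z a
    proof -
      have near: "norm (Z - a) < \<eta>" using that eh h h1 const_bounds by linarith
      have "cmod (g a Z) \<le> 2 * M * dd Z" using g_le[OF that(2), of Z] near that(3) by simp
      also have "\<dots> \<le> 2 * M * (\<epsilon>' * h)" using that const_bounds by (intro mult_left_mono) auto
      also have "\<dots> = \<epsilon> * h / 2" using const_bounds by (simp add: \<epsilon>'_def)
      also have "\<dots> < \<epsilon> * h" using e h by simp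
      finally show ?thesis using near that(1) by (simp add: peak_region_def)
    qed
    have outside: "Z \<notin> peak_region a (\<theta> * h)" if "Z \<in> \<Omega>" "a \<in> frontier \<Omega>" "dd Z > \<epsilon>' * h" for Z a
    proof
      assume "Z \<in> peak_region a (\<theta> * h)"
      then have n: "norm (Z - a) < \<eta>" "cmod (g a Z) < \<theta> * h" by (auto simp: peak_region_def)
      have "\<kappa> / 2 * (\<epsilon>' * h) \<le> \<kappa> / 2 * dd Z" using that(3) kappa_pos by (intro mult_left_mono) auto
      also have "\<dots> \<le> cmod (g a Z)" using g_neg(4)[OF that(2,1)] n by simp
      also have "\<dots> < \<theta> * h" by (rule n)
      also have "\<dots> \<le> \<kappa> / 2 * \<epsilon>' * h" using th h by (intro mult_right_mono) auto
      finally show False by simp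
    qed
    have neP: "norm (\<gamma> 0 - p) < \<eta>" if "dd P \<le> \<epsilon>' * h"
      unfolding g01 p(2) using that eh(1) h(2) h1(4) const_bounds(7) by linarith
    have neQ: "norm (\<gamma> 1 - q) < \<eta>" if "dd Q \<le> \<epsilon>' * h"
      unfolding g01 q(2) using that eh(1) h(2) h1(4) const_bounds(7) by linarith
    have eps_h: "\<epsilon> * h > 0" "\<epsilon> * h \<le> s1" "\<theta> * h > 0" "\<theta> * h \<le> s1" "\<theta> * h \<le> \<epsilon> * h"
    proof -
      show 1: "\<epsilon> * h > 0" "\<theta> * h > 0" using e(1) th(1) h(1) by simp_all
      show 2: "\<theta> * h \<le> \<epsilon> * h" using th(2) h(1) by (intro mult_right_mono) auto
      show "\<epsilon> * h \<le> s1" using eh(2) h(2) h1(3) by linarith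
      then show "\<theta> * h \<le> s1" using 2 by linarith
    qed
    have leave: "\<exists>\<tau>\<in>{0..1}. (\<forall>t\<in>{0..<\<tau>}. \<gamma> t \<in> peak_region p s) \<and>
         ennreal (ln (s / cmod (g p P)) / 2 - 1) \<le> (\<integral>\<^sup>+t\<in>{0<..<\<tau>}. F t \<partial>lborel)"
      if "0 < s" "s \<le> s1" "dd P \<le> \<epsilon>' * h" "\<exists>t\<in>{0..1}. \<gamma> t \<notin> peak_region p s" for s
      using s1(2)[OF p(1) that(1,2) pc im, of "\<lambda>t. t"] neP that by (simp add: F_def g01)
    have arrive: "\<exists>\<sigma>\<in>{0..1}. (\<forall>t\<in>{\<sigma><..1}. \<gamma> t \<in> peak_region q s) \<and>
         ennreal (ln (s / cmod (g q Q)) / 2 - 1) \<le> (\<integral>\<^sup>+t\<in>{\<sigma><..<1}. F t \<partial>lborel)"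
      if s: "0 < s" "s \<le> s1" and near: "dd Q \<le> \<epsilon>' * h" and ex: "\<exists>t\<in>{0..1}. \<gamma> t \<notin> peak_region q s" for s
    proof -
      obtain \<tau> where \<tau>: "\<tau> \<in> {0..1}" "\<forall>t\<in>{0..<\<tau>}. \<gamma> (1 - t) \<in> peak_region q s"
        "ennreal (ln (s / cmod (g q Q)) / 2 - 1) \<le> (\<integral>\<^sup>+t\<in>(\<lambda>t. 1 - t) ` {0<..<\<tau>}. F t \<partial>lborel)"
        using s1(2)[OF q(1) s pc im, of "\<lambda>t. 1 - t"] neQ[OF near] ex by (auto simp: F_def g01)
      have "\<gamma> t \<in> peak_region q s" if "t \<in> {1 - \<tau><..1}" for t
        using \<tau>(2)[rule_format, of "1 - t"] that by simp
      moreover have "(\<integral>\<^sup>+t\<in>(\<lambda>t. 1 - t) ` {0<..<\<tau>}. F t \<partial>lborel) \<le> (\<integral>\<^sup>+t\<in>{1 - \<tau><..<1}. F t \<partial>lborel)"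
        by (intro nn_integral_mono) (auto split: split_indicator)
      ultimately show ?thesis using \<tau>(1,3) by (intro bexI[of _ "1 - \<tau>"]) auto
    qed
    have sub: "(\<integral>\<^sup>+t\<in>{a<..<b}. F t \<partial>lborel) \<le> (\<integral>\<^sup>+t\<in>{0..1}. F t \<partial>lborel)" if "0 \<le> a" "b \<le> 1" for a b
      using that by (intro nn_integral_mono) (auto split: split_indicator)
    have "ennreal (ln (h / dd P) / 2 + ln (h / dd Q) / 2 - 2 * C0) \<le> (\<integral>\<^sup>+t\<in>{0..1}. F t \<partial>lborel)"
    proof (cases "dd P \<le> \<epsilon>' * h")
      case sP: True
      show ?thesis
      proof (cases "dd Q \<le> \<epsilon>' * h")
        case sQ: True
        have Ph: "norm (P - p) \<le> \<epsilon> * h" "norm (Q - q) \<le> \<epsilon> * h"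
          using sP sQ p q mult_right_mono[OF e'(2), of h] h by linarith+
        have hh0: "h \<le> h0" using h h1 by linarith
        have disj: "z \<notin> peak_region q (\<epsilon> * h)" if "z \<in> peak_region p (\<epsilon> * h)" for z
          using e(4)[OF p(1) q(1) h(1) hh0 Ph that] hs by force
        have Pin: "P \<in> peak_region p (\<epsilon> * h)" by (rule small[OF P p sP])
        have Qin: "Q \<in> peak_region q (\<epsilon> * h)" by (rule small[OF Q q sQ])
        have "\<exists>t\<in>{0..1}. \<gamma> t \<notin> peak_region p (\<epsilon> * h)"
          using disj Qin g01 by (intro bexI[of _ 1]) auto
        from leave[OF eps_h(1,2) sP this]
        obtain \<tau> where \<tau>: "\<tau> \<in> {0..1}" "\<forall>t\<in>{0..<\<tau>}. \<gamma> t \<in> peak_region p (\<epsilon> * h)"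
          "ennreal (ln (\<epsilon> * h / cmod (g p P)) / 2 - 1) \<le> (\<integral>\<^sup>+t\<in>{0<..<\<tau>}. F t \<partial>lborel)"
          by blast
        have "\<exists>t\<in>{0..1}. \<gamma> t \<notin> peak_region q (\<epsilon> * h)"
          using disj Pin g01 by (intro bexI[of _ 0]) auto
        from arrive[OF eps_h(1,2) sQ this]
        obtain \<sigma> where \<sigma>: "\<sigma> \<in> {0..1}" "\<forall>t\<in>{\<sigma><..1}. \<gamma> t \<in> peak_region q (\<epsilon> * h)"
          "ennreal (ln (\<epsilon> * h / cmod (g q Q)) / 2 - 1) \<le> (\<integral>\<^sup>+t\<in>{\<sigma><..<1}. F t \<partial>lborel)"
          by blast
        \<comment> \<open>Otherwise the curve would be in both disjoint regions at the midpoint of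
          \<sigma> and \<tau>. Hence the two parts of the curve use disjoint time intervals.\<close>
        have ts: "\<tau> \<le> \<sigma>"
        proof (rule ccontr)
          assume "\<not> \<tau> \<le> \<sigma>"
          then have "(\<sigma> + \<tau>) / 2 \<in> {0..<\<tau>}" "(\<sigma> + \<tau>) / 2 \<in> {\<sigma><..1}" using \<tau>(1) \<sigma>(1) by auto
          then show False using disj \<tau>(2) \<sigma>(2) by blast
        qed
        have "ln (h / dd P) / 2 + ln (h / dd Q) / 2 - 2 * C0 \<le>
            (ln (\<epsilon> * h / cmod (g p P)) / 2 - 1) + (ln (\<epsilon> * h / cmod (g q Q)) / 2 - 1)"
          using shallow[OF P p sP eps_h(5)] shallow[OF Q q sQ eps_h(5)] by linarith
        then have "ennreal (ln (h / dd P) / 2 + ln (h / dd Q) / 2 - 2 * C0) \<le>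
            ennreal (ln (\<epsilon> * h / cmod (g p P)) / 2 - 1) + ennreal (ln (\<epsilon> * h / cmod (g q Q)) / 2 - 1)"
          by (rule order_trans[OF ennreal_leI ennreal_add_le])
        also have "\<dots> \<le> (\<integral>\<^sup>+t\<in>{0<..<\<tau>}. F t \<partial>lborel) + (\<integral>\<^sup>+t\<in>{\<sigma><..<1}. F t \<partial>lborel)"
          by (intro add_mono \<tau>(3) \<sigma>(3))
        also have "\<dots> \<le> (\<integral>\<^sup>+t. F t * indicator {0<..<\<tau>} t + F t * indicator {\<sigma><..<1} t \<partial>lborel)"
          by (rule nn_integral_superadditive)
        also have "\<dots> \<le> (\<integral>\<^sup>+t\<in>{0..1}. F t \<partial>lborel)"
          using ts \<tau>(1) \<sigma>(1) by (intro nn_integral_mono) (auto split: split_indicator)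
        finally show ?thesis .
      next
        case dQ: False
        then have dQ: "dd Q > \<epsilon>' * h" by simp
        have "\<exists>t\<in>{0..1}. \<gamma> t \<notin> peak_region p (\<theta> * h)"
          using outside[OF Q p(1) dQ] g01 by (intro bexI[of _ 1]) auto
        from leave[OF eps_h(3,4) sP this]
        obtain \<tau> where \<tau>: "\<tau> \<in> {0..1}"
          "ennreal (ln (\<theta> * h / cmod (g p P)) / 2 - 1) \<le> (\<integral>\<^sup>+t\<in>{0<..<\<tau>}. F t \<partial>lborel)"
          by blast
        have "ln (h / dd P) / 2 + ln (h / dd Q) / 2 - 2 * C0 \<le> ln (\<theta> * h / cmod (g p P)) / 2 - 1"
          using shallow[OF P p sP order_refl] deep[OF dQ] by linarith
        then show ?thesis using \<tau> sub[of 0 \<tau>] by (meson atLeastAtMost_iff ennreal_leI order_refl order_trans)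
      qed
    next
      case False
      then have dP: "dd P > \<epsilon>' * h" by simp
      show ?thesis
      proof (cases "dd Q \<le> \<epsilon>' * h")
        case sQ: True
        have "\<exists>t\<in>{0..1}. \<gamma> t \<notin> peak_region q (\<theta> * h)"
          using outside[OF P q(1) dP] g01 by (intro bexI[of _ 0]) auto
        from arrive[OF eps_h(3,4) sQ this]
        obtain \<sigma> where \<sigma>: "\<sigma> \<in> {0..1}"
          "ennreal (ln (\<theta> * h / cmod (g q Q)) / 2 - 1) \<le> (\<integral>\<^sup>+t\<in>{\<sigma><..<1}. F t \<partial>lborel)"
          by blast
        have "ln (h / dd P) / 2 + ln (h / dd Q) / 2 - 2 * C0 \<le> ln (\<theta> * h / cmod (g q Q)) / 2 - 1"
          using shallow[OF Q q sQ order_refl] deep[OF dP] by linarith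
        then show ?thesis using \<sigma> sub[of \<sigma> 1] by (meson atLeastAtMost_iff ennreal_leI order_refl order_trans)
      next
        case False
        then have "ln (h / dd P) / 2 + ln (h / dd Q) / 2 - 2 * C0 \<le> 0"
          using deep[OF dP] deep[of Q] by linarith
        then show ?thesis by (simp add: ennreal_neg)
      qed
    qed
    then show ?thesis by (simp add: F_def)
  qed
  show ?thesis
  proof (rule that[OF h1(1)])
    show "2 * C0 > 0" using C0 by simp
    fix P Q h assume "P \<in> \<Omega>" "Q \<in> \<Omega>" "0 < h" "h \<le> h1" "h \<le> sep P Q"
    then show "ennreal (ln (h / dd P) / 2 + ln (h / dd Q) / 2 - 2 * C0) \<le> kobayashi_dist \<Omega> P Q"
      unfolding kobayashi_dist_def integrated_dist_def by (intro INF_greatest low)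
  qed
qed

end

section \<open>Short chains\<close>

text \<open>The bound is a real number so that it can be computed with logarithms. Asking for
  \<open>L \<ge> 0\<close> keeps \<open>ennreal\<close> from truncating it, so that bounds add up
  under concatenation.\<close>

definition joinable :: "(complex^'n) set \<Rightarrow> complex^'n \<Rightarrow> complex^'n \<Rightarrow> nat \<Rightarrow> real \<Rightarrow> bool" where
  "joinable \<Omega> P Q k L \<longleftrightarrow>
     L \<ge> 0 \<and> (\<exists>\<phi> a b. kobayashi_chain \<Omega> P Q k \<phi> a b \<and> chain_length k a b \<le> ennreal L)"

lemma joinable_mono: "joinable \<Omega> P Q k L \<Longrightarrow> L \<le> L' \<Longrightarrow> joinable \<Omega> P Q k L'"
  unfolding joinable_def by (meson ennreal_leI order_trans)

lemma joinable_trans: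
  assumes "joinable \<Omega> P Q k L" "joinable \<Omega> Q R l L'"
  shows "joinable \<Omega> P R (k + l) (L + L')"
proof -
  obtain \<phi> a b where 1: "kobayashi_chain \<Omega> P Q k \<phi> a b" "chain_length k a b \<le> ennreal L" and L: "L \<ge> 0"
    using assms(1) unfolding joinable_def by blast
  obtain \<psi> a' b' where 2: "kobayashi_chain \<Omega> Q R l \<psi> a' b'" "chain_length l a' b' \<le> ennreal L'" and L': "L' \<ge> 0"
    using assms(2) unfolding joinable_def by blast
  define \<phi>'' where "\<phi>'' j = (if j \<le> k then \<phi> j else \<psi> (j - k))" for j
  define a'' where "a'' j = (if j \<le> k then a j else a' (j - k))" for j
  define b'' where "b'' j = (if j \<le> k then b j else b' (j - k))" for j
  have k: "k \<ge> 1" "l \<ge> 1" using 1(1) 2(1) by (auto simp: kobayashi_chain_def)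
  have "kobayashi_chain \<Omega> P R (k + l) \<phi>'' a'' b''"
    unfolding kobayashi_chain_def
  proof (intro conjI ballI)
    show "1 \<le> k + l" using k by simp
    fix j assume j: "j \<in> {1..k + l}"
    then have "j \<in> {1..k} \<or> (\<not> j \<le> k \<and> j - k \<in> {1..l})" by auto
    then show "holomorphic_disc \<Omega> (\<phi>'' j)" "a'' j \<in> ball 0 1" "b'' j \<in> ball 0 1"
      using 1(1) 2(1) unfolding kobayashi_chain_def \<phi>''_def a''_def b''_def by auto
  next
    show "\<phi>'' 1 (a'' 1) = P" using 1(1) k by (simp add: \<phi>''_def a''_def kobayashi_chain_def)
    show "\<phi>'' (k + l) (b'' (k + l)) = R" using 2(1) k by (simp add: \<phi>''_def b''_def kobayashi_chain_def)
    fix j assume j: "j \<in> {1..<k + l}"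
    consider "j \<in> {1..<k}" | "j = k" | "j > k" "j - k \<in> {1..<l}" using j by fastforce
    then show "\<phi>'' j (b'' j) = \<phi>'' (Suc j) (a'' (Suc j))"
    proof cases
      case 1
      then show ?thesis using \<open>kobayashi_chain \<Omega> P Q k \<phi> a b\<close> by (simp add: \<phi>''_def a''_def b''_def kobayashi_chain_def)
    next
      case 2
      then show ?thesis using \<open>kobayashi_chain \<Omega> P Q k \<phi> a b\<close> \<open>kobayashi_chain \<Omega> Q R l \<psi> a' b'\<close>
        by (simp add: \<phi>''_def a''_def b''_def kobayashi_chain_def)
    next
      case 3
      then have "\<psi> (j - k) (b' (j - k)) = \<psi> (Suc (j - k)) (a' (Suc (j - k)))"
        using \<open>kobayashi_chain \<Omega> Q R l \<psi> a' b'\<close> by (simp add: kobayashi_chain_def)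
      then show ?thesis using 3 by (simp add: \<phi>''_def a''_def b''_def Suc_diff_le)
    qed
  qed
  moreover have "chain_length (k + l) a'' b'' \<le> ennreal (L + L')"
  proof -
    have "chain_length (k + l) a'' b'' = (\<Sum>j=1..k. poincare_dist (a'' j) (b'' j)) + (\<Sum>j=k+1..k+l. poincare_dist (a'' j) (b'' j))"
      unfolding chain_length_def by (rule sum.ub_add_nat) (use k in simp)
    also have "(\<Sum>j=1..k. poincare_dist (a'' j) (b'' j)) = chain_length k a b"
      unfolding chain_length_def by (intro sum.cong) (auto simp: a''_def b''_def)
    also have "(\<Sum>j=k+1..k+l. poincare_dist (a'' j) (b'' j)) = (\<Sum>j=1..l. poincare_dist (a'' (j + k)) (b'' (j + k)))"
      using sum.shift_bounds_cl_nat_ivl[of "\<lambda>j. poincare_dist (a'' j) (b'' j)" 1 k l] by (simp add: add.commute)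
    also have "\<dots> = chain_length l a' b'"
      unfolding chain_length_def by (intro sum.cong) (auto simp: a''_def b''_def)
    also have "chain_length k a b + chain_length l a' b' \<le> ennreal L + ennreal L'"
      by (intro add_mono 1(2) 2(2))
    finally show ?thesis using L L' by simp
  qed
  moreover have "L + L' \<ge> 0" using L L' by simp
  ultimately show ?thesis unfolding joinable_def by blast
qed

text \<open>The second claim uses the disc composed with \<open>- \<zeta>\<close>, which restores
  the order of the two real parameters.\<close>

lemma joinable_disc:
  assumes \<phi>: "holomorphic_disc \<Omega> \<phi>" and xy: "-1 < x" "x \<le> y" "y < 1"
    and P: "\<phi> (of_real x) = P" and Q: "\<phi> (of_real y) = Q" and L: "artanh y - artanh x \<le> L" "0 \<le> L"
  shows "joinable \<Omega> P Q 1 L" "joinable \<Omega> Q P 1 L"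
proof -
  have one: "joinable \<Omega> P Q 1 L"
    if \<phi>: "holomorphic_disc \<Omega> \<phi>" and xy: "-1 < x" "x \<le> y" "y < 1"
    and P: "\<phi> (of_real x) = P" and Q: "\<phi> (of_real y) = Q" and L: "artanh y - artanh x \<le> L" "0 \<le> L"
    for \<phi> P Q and x y L :: real
  proof -
    have "kobayashi_chain \<Omega> P Q 1 (\<lambda>_. \<phi>) (\<lambda>_. of_real x) (\<lambda>_. of_real y)"
      using that by (auto simp: kobayashi_chain_def)
    moreover have "chain_length 1 (\<lambda>_. of_real x) (\<lambda>_. of_real y) \<le> ennreal L"
      using order_trans[OF poincare_dist_of_real_le[OF xy] ennreal_leI[OF L(1)]] by (simp add: chain_length_def)
    ultimately show ?thesis unfolding joinable_def using L by blast
  qed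
  show "joinable \<Omega> P Q 1 L" by (rule one[OF assms])
  show "joinable \<Omega> Q P 1 L"
  proof (rule one[of "\<lambda>\<zeta>. \<phi> (- \<zeta>)" "-y" "-x"])
    show "holomorphic_disc \<Omega> (\<lambda>\<zeta>. \<phi> (- \<zeta>))"
      unfolding holomorphic_disc_def
    proof (intro conjI allI)
      fix i
      have "(\<lambda>\<zeta>. \<phi> \<zeta> $ i) \<circ> uminus holomorphic_on ball 0 1"
        by (rule holomorphic_on_compose_gen[where t = "ball 0 1"])
           (use \<phi> in \<open>auto simp: holomorphic_disc_def intro!: holomorphic_intros\<close>)
      then show "(\<lambda>\<zeta>. \<phi> (- \<zeta>) $ i) holomorphic_on ball 0 1" by (simp add: o_def)
      have "- \<zeta> \<in> ball (0::complex) 1" if "\<zeta> \<in> ball (0::complex) 1" for \<zeta> using that by simp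
      then show "(\<lambda>\<zeta>. \<phi> (- \<zeta>)) ` ball 0 1 \<subseteq> \<Omega>" using \<phi> unfolding holomorphic_disc_def by blast
    qed
    show "artanh (- x) - artanh (- y) \<le> L" using L xy by (simp add: artanh_minus_real)
  qed (use xy P Q L in auto)
qed

section \<open>Chains in the interior\<close>

context spc_domain
begin

text \<open>The affine disc centred at \<open>z\<close> that reaches \<open>w\<close> at parameter
  1/2 has image radius \<open>2 * norm (w - z)\<close>, hence stays in the ball of radius
  \<open>dd z\<close>.\<close>

lemma joinable_nearby:
  assumes z: "z \<in> \<Omega>" and w: "norm (w - z) \<le> dd z / 2"
  shows "joinable \<Omega> z w 1 (artanh (1 / 2))" "joinable \<Omega> w z 1 (artanh (1 / 2))"
proof -
  have "z + \<zeta> *s (2 *\<^sub>R (w - z)) \<in> \<Omega>" if \<zeta>: "cmod \<zeta> < 1" for \<zeta>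
  proof -
    have "norm (\<zeta> *s (2 *\<^sub>R (w - z))) \<le> cmod \<zeta> * dd z"
      unfolding norm_vector_scalar_mult using w by (intro mult_left_mono) auto
    also have "\<dots> < dd z" using \<zeta> dd_pos[OF z] by simp
    finally have "z + \<zeta> *s (2 *\<^sub>R (w - z)) \<in> ball z (dd z)"
      by (simp only: mem_ball dist_norm norm_minus_commute) simp
    then show ?thesis using ball_dd_subset[OF z] by blast
  qed
  note d = holomorphic_disc_affine(1)[OF this]
  have e: "z + complex_of_real (1 / 2) *s (2 *\<^sub>R (w - z)) = w" unfolding of_real_vector_scalar_mult by simp
  have e0: "z + complex_of_real 0 *s (2 *\<^sub>R (w - z)) = z" unfolding of_real_vector_scalar_mult by simp
  have a: "artanh (1 / 2 :: real) - artanh 0 \<le> artanh (1 / 2)" "0 \<le> artanh (1 / 2 :: real)"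
    by (simp_all add: artanh_def)
  show "joinable \<Omega> z w 1 (artanh (1 / 2))" "joinable \<Omega> w z 1 (artanh (1 / 2))"
    by (rule joinable_disc[OF d _ _ _ e0 e a]; simp)+
qed

text \<open>The points reachable from \<open>x0\<close> by finitely many steps of
  \<open>joinable_nearby\<close> form an open set with open complement in \<Omega>, hence all of
  \<Omega>. The sets reachable in at most \<open>n\<close> steps increase, and finitely many of
  their interiors cover the compact core.\<close>

lemma compact_core_joinable:
  assumes d: "d > 0"
  obtains K L where "\<And>z w. z \<in> \<Omega> \<Longrightarrow> w \<in> \<Omega> \<Longrightarrow> d \<le> dd z \<Longrightarrow> d \<le> dd w \<Longrightarrow> \<exists>k\<le>K. joinable \<Omega> z w k L"
proof -
  define L1 where "L1 = artanh (1 / 2 :: real)"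
  have L1: "L1 \<ge> 0" by (simp add: L1_def artanh_def)
  obtain x0 where x0: "x0 \<in> \<Omega>" using dom_nonempty by blast
  \<comment> \<open>Both directions are recorded, because two core points are joined through
    \<open>x0\<close>.\<close>
  define U where "U n = {w\<in>\<Omega>. \<exists>k\<le>n. joinable \<Omega> x0 w k (k * L1) \<and> joinable \<Omega> w x0 k (k * L1)}" for n :: nat
  have step: "v \<in> U (Suc n)" if wU: "w \<in> U n" and v: "v \<in> \<Omega>" and vw: "norm (v - w) \<le> dd w / 2" for v w n
  proof -
    obtain k where k: "k \<le> n" "joinable \<Omega> x0 w k (k * L1)" "joinable \<Omega> w x0 k (k * L1)" and w: "w \<in> \<Omega>"
      using wU unfolding U_def by blast
    note j = joinable_nearby[OF w vw, folded L1_def]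
    have "joinable \<Omega> x0 v (k + 1) (k * L1 + L1)" by (rule joinable_trans[OF k(2) j(1)])
    moreover have "joinable \<Omega> v x0 (1 + k) (L1 + k * L1)" by (rule joinable_trans[OF j(2) k(3)])
    ultimately show ?thesis using k(1) v unfolding U_def
      by (intro CollectI conjI exI[of _ "Suc k"]) (simp_all add: algebra_simps)
  qed
  have mono: "U n \<subseteq> U n'" if "n \<le> n'" for n n' using that by (auto simp: U_def intro: order_trans)
  have "norm (x0 - x0) \<le> dd x0 / 2" using dd_pos[OF x0] by simp
  then have "x0 \<in> U 1"
    using joinable_nearby[OF x0, of x0] x0 by (auto simp: U_def L1_def intro!: exI[of _ 1])
  define V where "V = (\<Union>n. U n)"
  have V\<Omega>: "V \<subseteq> \<Omega>" by (auto simp: V_def U_def)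
  have nb: "\<exists>e>0. ball w e \<subseteq> U (Suc n)" if "w \<in> U n" for w n
  proof -
    have w: "w \<in> \<Omega>" using that by (simp add: U_def)
    have "ball w (dd w / 2) \<subseteq> U (Suc n)"
    proof
      fix v assume v: "v \<in> ball w (dd w / 2)"
      then have "v \<in> ball w (dd w)" using dd_pos[OF w] by simp
      then have "v \<in> \<Omega>" using ball_dd_subset[OF w] by blast
      then show "v \<in> U (Suc n)" by (rule step[OF that]) (use v in \<open>simp add: dist_norm norm_minus_commute\<close>)
    qed
    then show ?thesis using dd_pos[OF w] by (intro exI[of _ "dd w / 2"]) simp
  qed
  have oV: "open V"
    unfolding open_contains_ball
  proof
    fix w assume "w \<in> V"
    then obtain n where "w \<in> U n" by (auto simp: V_def)
    then obtain e where "e > 0" "ball w e \<subseteq> U (Suc n)" using nb by blast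
    then show "\<exists>e>0. ball w e \<subseteq> V" unfolding V_def by blast
  qed
  have oW: "open (\<Omega> - V)"
    unfolding open_contains_ball
  proof
    fix v assume v: "v \<in> \<Omega> - V"
    \<comment> \<open>With a quarter of the radius, \<open>dd w\<close> exceeds
      \<open>3 / 4 * dd v\<close>, so \<open>v\<close> is within \<open>dd w / 2\<close> of
      \<open>w\<close>: if \<open>w\<close> were reachable, \<open>v\<close> would be too.\<close>
    have "ball v (dd v / 4) \<subseteq> \<Omega> - V"
    proof
      fix w assume w: "w \<in> ball v (dd v / 4)"
      have dv: "dd v > 0" using dd_pos v by blast
      have "w \<in> ball v (dd v)" using w dv by simp
      then have w\<Omega>: "w \<in> \<Omega>" using ball_dd_subset v by blast
      have "dd v \<le> dd w + dist v w" by (rule infdist_triangle)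
      moreover have "dist v w < dd v / 4" using w by simp
      ultimately have "dist v w \<le> dd w / 2" using zero_le_dist[of v w] by linarith
      then have n: "norm (v - w) \<le> dd w / 2" by (simp add: dist_norm)
      have "w \<notin> V"
      proof
        assume "w \<in> V"
        then obtain n where "w \<in> U n" by (auto simp: V_def)
        then have "v \<in> U (Suc n)" using step n v by blast
        then show False using v by (auto simp: V_def)
      qed
      then show "w \<in> \<Omega> - V" using w\<Omega> by blast
    qed
    then show "\<exists>e>0. ball v e \<subseteq> \<Omega> - V" using dd_pos[of v] v by (intro exI[of _ "dd v / 4"]) simp
  qed
  have x0V: "x0 \<in> V" using \<open>x0 \<in> U 1\<close> unfolding V_def by blast
  have "V \<inter> \<Omega> = {} \<or> (\<Omega> - V) \<inter> \<Omega> = {}"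
    by (rule connectedD[OF connected_dom oV oW]) blast+
  then have "V = \<Omega>" using x0 x0V V\<Omega> by blast
  define T where "T = {z\<in>\<Omega>. d \<le> dd z}"
  have "T = closure \<Omega> \<inter> {z. d \<le> dd z}"
  proof -
    have "z \<in> \<Omega>" if "z \<in> closure \<Omega>" "d \<le> dd z" for z
    proof (rule ccontr)
      assume "z \<notin> \<Omega>"
      then have "z \<in> frontier \<Omega>" using that(1) open_dom by (simp add: frontier_def interior_open)
      then show False using that(2) d by simp
    qed
    then show ?thesis using closure_subset by (auto simp: T_def)
  qed
  moreover have "closed {z. d \<le> dd z}" by (intro closed_Collect_le continuous_intros)
  ultimately have cT: "compact T"
    using bounded_dom by (simp add: compact_Int_closed compact_closure)
  have sub: "T \<subseteq> (\<Union>n\<in>UNIV. interior (U n))"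
  proof
    fix z assume "z \<in> T"
    then have "z \<in> V" using \<open>V = \<Omega>\<close> by (simp add: T_def)
    then obtain n where "z \<in> U n" by (auto simp: V_def)
    then have "z \<in> interior (U (Suc n))" using nb[of z n] mem_interior by blast
    then show "z \<in> (\<Union>n\<in>UNIV. interior (U n))" by blast
  qed
  obtain N where N: "finite N" "T \<subseteq> (\<Union>n\<in>N. interior (U n))"
    by (rule compactE_image[OF cT open_interior sub]) (rule that)
  define n0 where "n0 = Max (insert 0 N)"
  have TU: "z \<in> U n0" if zT: "z \<in> T" for z
  proof -
    obtain n where "n \<in> N" "z \<in> interior (U n)" using zT N(2) by blast
    then have n: "n \<in> N" "z \<in> U n" using interior_subset by auto
    then have "n \<le> n0" using N(1) by (simp add: n0_def)
    then show ?thesis using mono n by blast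
  qed
  show ?thesis
  proof (rule that[of "2 * n0" "2 * n0 * L1"])
    fix z w assume "z \<in> \<Omega>" "w \<in> \<Omega>" "d \<le> dd z" "d \<le> dd w"
    then have "z \<in> U n0" "w \<in> U n0" using TU by (auto simp: T_def)
    then obtain k l where k: "k \<le> n0" "joinable \<Omega> z x0 k (k * L1)" and l: "l \<le> n0" "joinable \<Omega> x0 w l (l * L1)"
      by (auto simp: U_def)
    have "real k * L1 + real l * L1 \<le> n0 * L1 + n0 * L1"
      using k(1) l(1) L1 by (intro add_mono mult_right_mono) auto
    then have "joinable \<Omega> z w (k + l) (2 * n0 * L1)"
      by (intro joinable_mono[OF joinable_trans[OF k(2) l(2)]]) (simp add: algebra_simps)
    then show "\<exists>k\<le>2 * n0. joinable \<Omega> z w k (2 * n0 * L1)" using k(1) l(1) by (intro exI[of _ "k + l"]) auto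
  qed
qed

section \<open>Discs near the boundary\<close>

text \<open>
  The disc lies in the complex normal line at \<open>z\<close>; its centre is at the constant height \<open>R\<close> above
  \<open>z\<close> and its radius exceeds \<open>R\<close> by a multiple \<open>s\<close> of the boundary distance of \<open>z\<close>.
\<close>

lemma vertical_disc:
  obtains h2 C where "0 < h2" "h2 * M \<le> \<rho>" "h2 \<le> 1 / (4 * M)" "C \<ge> 0"
    "\<And>z h. z \<in> \<Omega> \<Longrightarrow> dd z \<le> h2 \<Longrightarrow> 0 \<le> h \<Longrightarrow> h \<le> h2 \<Longrightarrow>
       z - h *\<^sub>R G z \<in> \<Omega> \<and> joinable \<Omega> z (z - h *\<^sub>R G z) 1 (ln ((h + dd z) / dd z) / 2 + C) \<and>
       joinable \<Omega> (z - h *\<^sub>R G z) z 1 (ln ((h + dd z) / dd z) / 2 + C)"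
proof -
  \<comment> \<open>The first bound keeps the whole disc in the range of the Taylor formula, the
    second gives \<open>M * R \<le> 1 / 4\<close>, by which the linear term controls the quadratic
    one.\<close>
  define R where "R = min (\<rho> / (3 * M)) (1 / (4 * M))"
  have R: "R > 0" "R \<le> \<rho> / (3 * M)" "R \<le> 1 / (4 * M)" using const_bounds by (auto simp: R_def)
  have RM: "3 * R * M \<le> \<rho>" "M * R \<le> 1 / 4" using R const_bounds by (auto simp: field_simps)
  have "R \<le> R * M" using R(1) const_bounds by simp
  then have R\<rho>: "R \<le> \<rho>" "R * M \<le> \<rho>" using RM(1) R(1) by linarith+
  \<comment> \<open>For \<open>s = k * dd z\<close> the overshoot raises \<open>r\<close> by at most
    \<open>2 * M^2 * s = \<kappa> / 2 * dd z\<close>, half of what \<open>r_le\<close>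
    provides.\<close>
  define k where "k = \<kappa> / (4 * M\<^sup>2)"
  have k: "k > 0" using kappa_pos const_bounds by (simp add: k_def)
  have "\<kappa> \<le> 1"
    using const_bounds power_le_one[of m 2] by (simp add: \<kappa>_def divide_le_eq)
  moreover have M2: "M\<^sup>2 \<ge> 1" using const_bounds by simp
  ultimately have k1: "k \<le> 1" unfolding k_def by (simp add: divide_le_eq)
  define C where "C = ln (2 / k) / 2"
  have C: "C \<ge> 0" using k k1 by (simp add: C_def)
  have main: "z - h *\<^sub>R G z \<in> \<Omega> \<and> joinable \<Omega> z (z - h *\<^sub>R G z) 1 (ln ((h + dd z) / dd z) / 2 + C) \<and>
       joinable \<Omega> (z - h *\<^sub>R G z) z 1 (ln ((h + dd z) / dd z) / 2 + C)"
    if z: "z \<in> \<Omega>" and dz: "dd z \<le> R" and h: "0 \<le> h" "h \<le> R" for z h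
  proof -
    have d0: "dd z > 0" using dd_pos[OF z] .
    have d\<rho>: "dd z \<le> \<rho>" using dz R\<rho>(1) by linarith
    define s where "s = k * dd z"
    have s: "s > 0" "s \<le> dd z" "s \<le> R"
    proof -
      show "s > 0" using k d0 by (simp add: s_def)
      show "s \<le> dd z" using k1 d0 by (simp add: s_def)
      then show "s \<le> R" using dz by linarith
    qed
    define n where "n = norm (G z)"
    have n: "m \<le> n" "n \<le> M" "n > 0" using G_bounds[OF d\<rho>] const_bounds by (auto simp: n_def)
    have inside: "z - \<xi> *s G z \<in> \<Omega>" if \<xi>: "cmod (\<xi> - of_real R) < R + s" for \<xi>
    proof -
      define x where "x = Re \<xi>"
      have "\<bar>Re (\<xi> - of_real R)\<bar> < R + s" using abs_Re_le_cmod \<xi> by (rule le_less_trans)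
      then have xs: "x > - s" by (auto simp: x_def)
      \<comment> \<open>The disc is almost tangent to the imaginary axis at 0, so the square of
        \<open>cmod \<xi>\<close> is bounded by \<open>2 * R * Re \<xi>\<close> up to
        \<open>3 * R * s\<close>. The quadratic Taylor error is thus controlled by the linear
        decrease, even at the points nearest to the boundary.\<close>
      have "(cmod (\<xi> - of_real R))\<^sup>2 < (R + s)\<^sup>2" using \<xi> by (intro power_strict_mono) auto
      moreover have "(cmod (\<xi> - of_real R))\<^sup>2 = (cmod \<xi>)\<^sup>2 - 2 * R * x + R\<^sup>2"
        unfolding cmod_power2 x_def by (simp add: power2_eq_square algebra_simps)
      moreover have "(R + s)\<^sup>2 \<le> R\<^sup>2 + 3 * R * s"
        using mult_right_mono[OF s(3), of s] s(1) by (simp add: power2_eq_square algebra_simps)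
      ultimately have c2: "(cmod \<xi>)\<^sup>2 < 2 * R * x + 3 * R * s" by linarith
      have "cmod \<xi> \<le> cmod (\<xi> - of_real R) + cmod (of_real R)"
        using norm_triangle_ineq[of "\<xi> - of_real R" "of_real R"] by simp
      then have cx: "cmod \<xi> \<le> 3 * R" using \<xi> s R by simp
      define v where "v = - (\<xi> *s G z)"
      have nv: "norm v = cmod \<xi> * n" by (simp add: v_def n_def norm_vector_scalar_mult)
      have "cmod \<xi> * n \<le> 3 * R * M" using cx n R const_bounds by (intro mult_mono) auto
      then have v\<rho>: "norm v \<le> \<rho>" using nv RM by simp
      have "G z \<bullet> v = - Re (herm (G z) (\<xi> *s G z))" by (simp add: v_def Re_herm)
      also have "\<dots> = - (x * n\<^sup>2)" unfolding herm_scale herm_self by (simp add: x_def n_def del: of_real_power)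
      finally have Gv: "G z \<bullet> v = - (x * n\<^sup>2)" .
      have "r (z + v) \<le> r z + G z \<bullet> v + M * (norm v)\<^sup>2" using r_taylor[OF d\<rho> v\<rho>] by linarith
      also have "\<dots> = r z + n\<^sup>2 * (M * (cmod \<xi>)\<^sup>2 - x)" by (simp add: Gv nv power_mult_distrib algebra_simps)
      also have "\<dots> \<le> r z + n\<^sup>2 * (2 * s)"
      proof -
        have "M * (cmod \<xi>)\<^sup>2 \<le> M * (2 * R * x + 3 * R * s)" using c2 const_bounds by (intro mult_left_mono) auto
        also have "\<dots> = 2 * (M * R) * x + 3 * (M * R) * s" by (simp add: algebra_simps)
        finally have 1: "M * (cmod \<xi>)\<^sup>2 - x \<le> - ((1 - 2 * (M * R)) * x) + 3 * (M * R) * s" by (simp add: algebra_simps)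
        have "(1 - 2 * (M * R)) * (- x) \<le> (1 - 2 * (M * R)) * s" using xs RM(2) by (intro mult_left_mono) auto
        also have "\<dots> \<le> 1 * s" using s R const_bounds by (intro mult_right_mono) auto
        finally have 2: "- ((1 - 2 * (M * R)) * x) \<le> s" by simp
        have "3 * (M * R) * s \<le> 1 * s" using RM(2) s by (intro mult_right_mono) auto
        then show ?thesis using 1 2 by (intro add_left_mono mult_left_mono) auto
      qed
      also have "n\<^sup>2 * (2 * s) \<le> M\<^sup>2 * (2 * s)" using n s by (intro mult_right_mono power_mono) auto
      also have "M\<^sup>2 * (2 * s) = \<kappa> / 2 * dd z" using const_bounds by (simp add: s_def k_def)
      finally have "r (z + v) \<le> - (\<kappa> * dd z) / 2" using r_le[OF z d\<rho>] by simp
      also have "\<dots> < 0" using kappa_pos d0 by simp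
      finally show ?thesis using mem_iff[OF d\<rho> v\<rho>] by (simp add: v_def)
    qed
    define \<phi> where "\<phi> \<zeta> = (z - R *\<^sub>R G z) + \<zeta> *s (- ((R + s) *\<^sub>R G z))" for \<zeta>
    have \<phi>eq: "\<phi> \<zeta> = z - (of_real R + of_real (R + s) * \<zeta>) *s G z" for \<zeta>
      unfolding \<phi>_def by (simp add: vec_eq_iff, simp add: scaleR_conv_of_real algebra_simps)
    have d: "holomorphic_disc \<Omega> \<phi>"
      unfolding \<phi>_def
    proof (rule holomorphic_disc_affine(1))
      fix \<zeta> :: complex assume \<zeta>: "cmod \<zeta> < 1"
      have "cmod (of_real (R + s) * \<zeta>) < R + s"
        using \<zeta> s R by (simp add: norm_mult del: of_real_add)
      then have "z - (of_real R + of_real (R + s) * \<zeta>) *s G z \<in> \<Omega>" by (intro inside) simp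
      then show "(z - R *\<^sub>R G z) + \<zeta> *s (- ((R + s) *\<^sub>R G z)) \<in> \<Omega>"
        unfolding \<phi>eq[symmetric] unfolding \<phi>_def .
    qed
    define x where "x = - R / (R + s)"
    define y where "y = (h - R) / (R + s)"
    have Rs: "R + s > 0" using R s by simp
    have xy: "-1 < x" "x \<le> y" "y < 1" using Rs R s h by (auto simp: x_def y_def field_simps)
    have real_pt: "\<phi> (of_real t) = z - (R + (R + s) * t) *\<^sub>R G z" for t
      unfolding \<phi>eq of_real_vector_scalar_mult[symmetric] by simp
    have px: "\<phi> (of_real x) = z" unfolding real_pt using Rs by (simp add: x_def)
    have py: "\<phi> (of_real y) = z - h *\<^sub>R G z" unfolding real_pt using Rs by (simp add: y_def)
    have in\<Omega>: "z - h *\<^sub>R G z \<in> \<Omega>"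
      using d xy unfolding py[symmetric] holomorphic_disc_def by auto
    have "artanh y - artanh x = (ln ((h + s) / (2 * R + s - h)) - ln (s / (2 * R + s))) / 2"
    proof -
      have "(1 + y) / (1 - y) = (h + s) / (2 * R + s - h)" "(1 + x) / (1 - x) = s / (2 * R + s)"
      proof -
        have "1 + y = (h + s) / (R + s)" "1 - y = (2 * R + s - h) / (R + s)"
          "1 + x = s / (R + s)" "1 - x = (2 * R + s) / (R + s)"
          using Rs by (simp_all add: x_def y_def add_divide_distrib[symmetric] field_simps)
        then show "(1 + y) / (1 - y) = (h + s) / (2 * R + s - h)" "(1 + x) / (1 - x) = s / (2 * R + s)"
          using Rs by simp_all
      qed
      then show ?thesis by (simp add: artanh_def diff_divide_distrib)
    qed
    also have "\<dots> = ln ((h + s) / s * ((2 * R + s) / (2 * R + s - h))) / 2"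
    proof -
      have "ln ((h + s) / (2 * R + s - h)) - ln (s / (2 * R + s)) = ln ((h + s) / (2 * R + s - h) / (s / (2 * R + s)))"
        using h s R by (intro ln_divide_pos[symmetric]) auto
      then show ?thesis by (simp add: mult.commute)
    qed
    \<comment> \<open>Replacing \<open>s\<close> by \<open>dd z\<close> costs at most the factor
      \<open>1 / k\<close>, and the part of the quotient due to the far end of the disc is at most 2
      because \<open>h \<le> R\<close>.\<close>
    also have "\<dots> \<le> ln ((h + dd z) / dd z * (2 / k)) / 2"
    proof -
      have "(h + s) / s \<le> (h + dd z) / (k * dd z)"
        unfolding s_def[symmetric] using s by (intro divide_right_mono) auto
      moreover have "(2 * R + s) / (2 * R + s - h) \<le> 2" using h s R by (simp add: divide_le_eq)
      ultimately have "(h + s) / s * ((2 * R + s) / (2 * R + s - h)) \<le> (h + dd z) / (k * dd z) * 2"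
        using h s R d0 k by (intro mult_mono) auto
      also have "\<dots> = (h + dd z) / dd z * (2 / k)" by simp
      finally have le: "(h + s) / s * ((2 * R + s) / (2 * R + s - h)) \<le> (h + dd z) / dd z * (2 / k)" .
      have "0 < (h + s) / s * ((2 * R + s) / (2 * R + s - h))" using h s R by simp
      then show ?thesis using le by simp
    qed
    also have "ln ((h + dd z) / dd z * (2 / k)) = ln ((h + dd z) / dd z) + ln (2 / k)"
      by (rule ln_mult_pos) (use h d0 k in auto)
    finally have le: "artanh y - artanh x \<le> ln ((h + dd z) / dd z) / 2 + C" by (simp add: C_def)
    have "ln ((h + dd z) / dd z) \<ge> 0" using h d0 by (simp add: ln_ge_zero)
    then have "0 \<le> ln ((h + dd z) / dd z) / 2 + C" using C by simp
    then show ?thesis using in\<Omega> joinable_disc[OF d xy px py le] by blast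
  qed
  show ?thesis by (rule that[OF R(1) R\<rho>(2) R(3) C main])
qed

text \<open>
  Lifting both points by a large multiple of \<open>h\<close> makes a single disc in the complex line through
  them fit into the domain.
\<close>

lemma horizontal_disc:
  obtains A h3 where "A \<ge> 1" "0 < h3"
    "\<And>P Q h. P \<in> \<Omega> \<Longrightarrow> sep P Q \<le> h \<Longrightarrow> h \<le> h3 \<Longrightarrow>
      joinable \<Omega> (P - (A * h) *\<^sub>R G P) (Q - (A * h) *\<^sub>R G Q) 1 (artanh (1 / 2))"
proof -
  \<comment> \<open>Lifting by \<open>A * h\<close> lowers the linear part of \<open>r\<close> by at
    least \<open>30 * M * h\<close>, while the disc raises it by at most
    \<open>2 * h + 2 * M * h\<close> and the quadratic error is at most
    \<open>25 * M * h\<close>.\<close>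
  define A where "A = 30 * M / m\<^sup>2"
  have m2: "m\<^sup>2 > 0" "m\<^sup>2 \<le> 1" using const_bounds by (auto simp: power_le_one)
  have A: "A \<ge> 1" using m2 const_bounds by (simp add: A_def le_divide_eq)
  have Am: "A * m\<^sup>2 = 30 * M" using m2 by (simp add: A_def)
  \<comment> \<open>For \<open>x = sqrt h\<close> the first bound makes the lift at most
    \<open>x\<close> in length, and the second keeps all displacements, at most
    \<open>5 * x\<close>, in the collar estimates.\<close>
  define x0 where "x0 = min (1 / (A * M)) (\<rho> / 5)"
  have x0: "x0 > 0" "x0 \<le> 1 / (A * M)" "x0 \<le> \<rho> / 5" using A const_bounds by (auto simp: x0_def)
  have main: "joinable \<Omega> (P - (A * h) *\<^sub>R G P) (Q - (A * h) *\<^sub>R G Q) 1 (artanh (1 / 2))"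
    if P: "P \<in> \<Omega>" and hs: "sep P Q \<le> h" and h: "h \<le> x0\<^sup>2" for P Q h
  proof -
    have s: "dd P \<le> h" "(norm (Q - P))\<^sup>2 \<le> h" "cmod (herm (G P) (Q - P)) \<le> h"
      using sep_ge[where P = P and Q = Q] hs by (meson order_trans)+
    have h0: "h > 0" using dd_pos[OF P] s by linarith
    define x where "x = sqrt h"
    have x: "x > 0" "x\<^sup>2 = h" using h0 by (auto simp: x_def)
    have xx0: "x \<le> x0" using h x x0 by (intro power2_le_imp_le[of x x0]) auto
    have AMx: "A * M * x \<le> 1"
    proof -
      have "A * M * x \<le> A * M * (1 / (A * M))" using xx0 x0 A const_bounds by (intro mult_left_mono) auto
      then show ?thesis using A const_bounds by simp
    qed
    have x5: "5 * x \<le> \<rho>" using xx0 x0 by linarith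
    have x1: "x \<le> 1" using x5 x const_bounds by linarith
    have hx: "h \<le> x" using x x1 by (simp add: x(2)[symmetric] power2_eq_square)
    have dP: "dd P \<le> \<rho>" using s(1) hx x5 x(1) by linarith
    have nPQ: "norm (Q - P) \<le> x" using s(2) x by (intro power2_le_imp_le[of "norm (Q - P)" x]) auto
    have dG: "norm (G Q - G P) \<le> M * x"
    proof -
      have "norm (G (P + (Q - P)) - G P) \<le> M * norm (Q - P)"
        by (rule G_lipschitz[OF dP]) (use nPQ x5 x(1) in linarith)
      also have "\<dots> \<le> M * x" using nPQ const_bounds by (intro mult_left_mono) auto
      finally show ?thesis by simp
    qed
    define H where "H = A * h"
    have H: "H > 0" "H = A * x * x" using A h0 by (auto simp: H_def x(2)[symmetric] power2_eq_square)
    have HM: "H * M \<le> x"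
    proof -
      have "H * M = (A * M * x) * x" by (simp add: H(2))
      also have "\<dots> \<le> 1 * x" using AMx x by (intro mult_right_mono) auto
      finally show ?thesis by simp
    qed
    \<comment> \<open>The difference of the lifted points. The disc runs in direction
      \<open>2 *\<^sub>R D\<close>, so its parameters 0 and 1/2 give the two points.\<close>
    define D where "D = (Q - P) - H *\<^sub>R (G Q - G P)"
    have HdG: "norm (H *\<^sub>R (G Q - G P)) \<le> x * x"
    proof -
      have "norm (H *\<^sub>R (G Q - G P)) \<le> H * (M * x)" using dG H(1) by (simp add: mult_left_mono)
      also have "\<dots> = (H * M) * x" by simp
      also have "\<dots> \<le> x * x" using HM x by (intro mult_right_mono) auto
      finally show ?thesis .
    qed
    have xx: "x * x \<le> x" using x x1 by simp
    have nD: "norm D \<le> 2 * x" unfolding D_def using norm_triangle_ineq4[of "Q - P" "H *\<^sub>R (G Q - G P)"] nPQ HdG xx by linarith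
    have Gb: "m \<le> norm (G P)" "norm (G P) \<le> M" using G_bounds[OF dP] by auto
    have hD: "cmod (herm (G P) D) \<le> h + M * h"
    proof -
      have hDeq: "herm (G P) D = herm (G P) (Q - P) - herm (G P) (H *\<^sub>R (G Q - G P))"
        unfolding D_def by (rule herm_diff(1))
      have "cmod (herm (G P) (H *\<^sub>R (G Q - G P))) \<le> M * (x * x)"
        using HdG Gb const_bounds by (intro order_trans[OF norm_herm_le] mult_mono) auto
      moreover have "x * x = h" using x(2) by (simp add: power2_eq_square)
      ultimately show ?thesis
        unfolding hDeq using s(3) norm_triangle_ineq4[of "herm (G P) (Q - P)" "herm (G P) (H *\<^sub>R (G Q - G P))"]
        by simp
    qed
    have inside: "(P - H *\<^sub>R G P) + \<zeta> *s (2 *\<^sub>R D) \<in> \<Omega>" if \<zeta>: "cmod \<zeta> < 1" for \<zeta>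
    proof -
      define v where "v = \<zeta> *s (2 *\<^sub>R D) - H *\<^sub>R G P"
      have n1: "norm (\<zeta> *s (2 *\<^sub>R D)) \<le> 4 * x"
      proof -
        have "norm (\<zeta> *s (2 *\<^sub>R D)) \<le> 1 * norm (2 *\<^sub>R D)"
          unfolding norm_vector_scalar_mult using \<zeta> by (intro mult_right_mono) auto
        then show ?thesis using nD by simp
      qed
      have "norm (H *\<^sub>R G P) \<le> H * M" using Gb H by (simp add: mult_left_mono)
      then have nv: "norm v \<le> 5 * x" unfolding v_def
        using norm_triangle_ineq4[of "\<zeta> *s (2 *\<^sub>R D)" "H *\<^sub>R G P"] n1 HM by linarith
      then have v\<rho>: "norm v \<le> \<rho>" using x5 by linarith
      have "(norm v)\<^sup>2 \<le> (5 * x)\<^sup>2" using nv by (intro power_mono) auto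
      then have "M * (norm v)\<^sup>2 \<le> M * (25 * h)"
        using const_bounds by (intro mult_left_mono) (auto simp: power_mult_distrib x(2))
      then have nv2: "M * (norm v)\<^sup>2 \<le> 25 * (M * h)" by simp
      have h2D: "herm (G P) (2 *\<^sub>R D) = 2 * herm (G P) D"
        using herm_scale[of "G P" "of_real 2" D] unfolding of_real_vector_scalar_mult by simp
      have "G P \<bullet> (\<zeta> *s (2 *\<^sub>R D)) \<le> cmod (herm (G P) (\<zeta> *s (2 *\<^sub>R D)))"
        unfolding Re_herm[symmetric] by (rule complex_Re_le_cmod)
      also have "\<dots> = cmod \<zeta> * (2 * cmod (herm (G P) D))" by (simp add: herm_scale h2D norm_mult)
      also have "\<dots> \<le> 1 * (2 * (h + M * h))" using \<zeta> hD by (intro mult_mono) auto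
      finally have 1: "G P \<bullet> (\<zeta> *s (2 *\<^sub>R D)) \<le> 2 * h + 2 * (M * h)" by simp
      have "m\<^sup>2 \<le> (norm (G P))\<^sup>2" using Gb const_bounds by (intro power_mono) auto
      then have "H * m\<^sup>2 \<le> H * (norm (G P))\<^sup>2" using H by (intro mult_left_mono) auto
      moreover have "H * m\<^sup>2 = 30 * M * h" using Am by (simp add: H_def mult.commute mult.left_commute)
      ultimately have 2: "G P \<bullet> (H *\<^sub>R G P) \<ge> 30 * (M * h)" by (simp add: power2_norm_eq_inner)
      have "r (P + v) \<le> r P + G P \<bullet> v + M * (norm v)\<^sup>2" using r_taylor[OF dP v\<rho>] by linarith
      moreover have "G P \<bullet> v = G P \<bullet> (\<zeta> *s (2 *\<^sub>R D)) - G P \<bullet> (H *\<^sub>R G P)" by (simp add: v_def inner_diff_right)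
      moreover have "h \<le> M * h" using const_bounds h0 by simp
      moreover have "r P < 0" by (rule r_neg[OF P dP])
      ultimately have "r (P + v) < 0" using 1 2 nv2 h0 by linarith
      then have "P + v \<in> \<Omega>" using mem_iff[OF dP v\<rho>] by simp
      then show ?thesis by (simp add: v_def algebra_simps)
    qed
    note d = holomorphic_disc_affine(1)[OF inside]
    have e: "(P - H *\<^sub>R G P) + complex_of_real (1 / 2) *s (2 *\<^sub>R D) = Q - H *\<^sub>R G Q"
      unfolding of_real_vector_scalar_mult D_def by (simp add: algebra_simps)
    have e0: "(P - H *\<^sub>R G P) + complex_of_real 0 *s (2 *\<^sub>R D) = P - H *\<^sub>R G P"
      unfolding of_real_vector_scalar_mult by simp
    have a: "artanh (1 / 2 :: real) - artanh 0 \<le> artanh (1 / 2)" "0 \<le> artanh (1 / 2 :: real)"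
      by (simp_all add: artanh_def)
    have "joinable \<Omega> (P - H *\<^sub>R G P) (Q - H *\<^sub>R G Q) 1 (artanh (1 / 2))"
      by (rule joinable_disc(1)[OF d _ _ _ e0 e a]; simp)
    then show ?thesis by (simp add: H_def)
  qed
  have "x0\<^sup>2 > 0" using x0 by simp
  then show ?thesis using that[OF A _ main] by blast
qed

section \<open>Upper bounds for chains and conclusion\<close>

lemma near_points_joinable:
  obtains h4 C where "h4 > 0" "C \<ge> 0"
    "\<And>P Q. P \<in> \<Omega> \<Longrightarrow> Q \<in> \<Omega> \<Longrightarrow> sep P Q \<le> h4 \<Longrightarrow>
       joinable \<Omega> P Q 3 (ln (sep P Q / dd P) / 2 + ln (sep P Q / dd Q) / 2 + C)"
proof -
  obtain h2 C2 where h2: "0 < h2" "h2 * M \<le> \<rho>" "h2 \<le> 1 / (4 * M)" "C2 \<ge> 0"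
    "\<And>z h. z \<in> \<Omega> \<Longrightarrow> dd z \<le> h2 \<Longrightarrow> 0 \<le> h \<Longrightarrow> h \<le> h2 \<Longrightarrow>
       z - h *\<^sub>R G z \<in> \<Omega> \<and> joinable \<Omega> z (z - h *\<^sub>R G z) 1 (ln ((h + dd z) / dd z) / 2 + C2) \<and>
       joinable \<Omega> (z - h *\<^sub>R G z) z 1 (ln ((h + dd z) / dd z) / 2 + C2)"
    by (rule vertical_disc) (rule that)
  obtain A h3 where A: "A \<ge> 1" "0 < h3"
    "\<And>P Q h. P \<in> \<Omega> \<Longrightarrow> sep P Q \<le> h \<Longrightarrow> h \<le> h3 \<Longrightarrow>
      joinable \<Omega> (P - (A * h) *\<^sub>R G P) (Q - (A * h) *\<^sub>R G Q) 1 (artanh (1 / 2))"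
    by (rule horizontal_disc) (rule that)
  define h4 where "h4 = min h3 (h2 / A)"
  have h4: "h4 > 0" "h4 \<le> h3" "h4 \<le> h2 / A" using h2 A by (auto simp: h4_def)
  define C where "C = ln (A + 1) + 2 * C2 + artanh (1 / 2)"
  have a0: "artanh (1 / 2 :: real) \<ge> 0" by (simp add: artanh_def)
  have C: "C \<ge> 0" using A h2(4) a0 by (simp add: C_def)
  have "joinable \<Omega> P Q 3 (ln (sep P Q / dd P) / 2 + ln (sep P Q / dd Q) / 2 + C)"
    if P: "P \<in> \<Omega>" and Q: "Q \<in> \<Omega>" and hs: "sep P Q \<le> h4" for P Q
  proof -
    define h where "h = sep P Q"
    have dPQ: "dd P \<le> h" "dd Q \<le> h" "dd P > 0" "dd Q > 0" using sep_ge[where P = P and Q = Q] dd_pos P Q by (auto simp: h_def)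
    have h0: "h > 0" using dPQ by linarith
    have Ah: "A * h \<le> h2" "0 \<le> A * h" "h \<le> A * h"
    proof -
      have "A * h \<le> A * (h2 / A)" using hs h4(3) A(1) by (intro mult_left_mono) (auto simp: h_def)
      then show "A * h \<le> h2" using A(1) by simp
    qed (use A(1) h0 in auto)
    \<comment> \<open>Since \<open>dd Z \<le> h\<close>, the height \<open>A * h\<close> costs no
      more than the height \<open>h\<close> up to the additive constant
      \<open>ln (A + 1)\<close>.\<close>
    have lift: "ln ((A * h + dd Z) / dd Z) \<le> ln (A + 1) + ln (h / dd Z)" if "dd Z \<le> h" "dd Z > 0" for Z
    proof -
      have "(A * h + dd Z) / dd Z \<le> (A + 1) * (h / dd Z)"
        using that by (simp add: divide_right_mono algebra_simps)
      moreover have "0 < (A * h + dd Z) / dd Z" using Ah that by (simp add: add_nonneg_pos)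
      ultimately have "ln ((A * h + dd Z) / dd Z) \<le> ln ((A + 1) * (h / dd Z))" by simp
      also have "\<dots> = ln (A + 1) + ln (h / dd Z)" by (rule ln_mult_pos) (use A h0 that in auto)
      finally show ?thesis .
    qed
    have v1: "joinable \<Omega> P (P - (A * h) *\<^sub>R G P) 1 (ln ((A * h + dd P) / dd P) / 2 + C2)"
      using h2(5)[OF P _ Ah(2,1)] dPQ Ah by auto
    have v2: "joinable \<Omega> (Q - (A * h) *\<^sub>R G Q) Q 1 (ln ((A * h + dd Q) / dd Q) / 2 + C2)"
      using h2(5)[OF Q _ Ah(2,1)] dPQ Ah by auto
    have hor: "joinable \<Omega> (P - (A * h) *\<^sub>R G P) (Q - (A * h) *\<^sub>R G Q) 1 (artanh (1 / 2))"
      by (rule A(3)[OF P]) (use hs h4 in \<open>auto simp: h_def\<close>)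
    have "joinable \<Omega> P Q (1 + 1 + 1) (ln ((A * h + dd P) / dd P) / 2 + C2 + artanh (1 / 2) + (ln ((A * h + dd Q) / dd Q) / 2 + C2))"
      by (rule joinable_trans[OF joinable_trans[OF v1 hor] v2])
    then have "joinable \<Omega> P Q (1 + 1 + 1) (ln (h / dd P) / 2 + ln (h / dd Q) / 2 + C)"
      by (rule joinable_mono) (use lift[OF dPQ(1,3)] lift[OF dPQ(2,4)] in \<open>simp add: C_def\<close>)
    then show ?thesis by (simp add: h_def numeral_3_eq_3)
  qed
  then show ?thesis using that h4(1) C by blast
qed

text \<open>Either end point is raised by one disc to a fixed height or is already deep, and the
  core is crossed by \<open>compact_core_joinable\<close>. The scale \<open>h\<close> is fixed, so
  writing the bound with \<open>h\<close> in place of that height changes only the constant; in this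
  form it matches the lower bound.\<close>

lemma far_points_joinable:
  assumes h: "h > 0"
  obtains K C where "C \<ge> 0"
    "\<And>P Q. P \<in> \<Omega> \<Longrightarrow> Q \<in> \<Omega> \<Longrightarrow> \<exists>k\<le>K. joinable \<Omega> P Q k (ln (h / dd P) / 2 + ln (h / dd Q) / 2 + C)"
proof -
  obtain t C2 where t: "0 < t" "t * M \<le> \<rho>" "t \<le> 1 / (4 * M)" "C2 \<ge> 0"
    "\<And>z h. z \<in> \<Omega> \<Longrightarrow> dd z \<le> t \<Longrightarrow> 0 \<le> h \<Longrightarrow> h \<le> t \<Longrightarrow>
       z - h *\<^sub>R G z \<in> \<Omega> \<and> joinable \<Omega> z (z - h *\<^sub>R G z) 1 (ln ((h + dd z) / dd z) / 2 + C2) \<and>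
       joinable \<Omega> (z - h *\<^sub>R G z) z 1 (ln ((h + dd z) / dd z) / 2 + C2)"
    by (rule vertical_disc) (rule that)
  have t\<rho>: "t \<le> \<rho>"
    using mult_left_mono[OF const_bounds(5), of t] t(1,2) by linarith
  obtain R where R: "R \<ge> 1" "\<And>z p. z \<in> \<Omega> \<Longrightarrow> p \<in> frontier \<Omega> \<Longrightarrow> norm (z - p) \<le> R"
    by (rule diameter_bound) (rule that)
  obtain p0 where p0: "p0 \<in> frontier \<Omega>" using frontier_nonempty by blast
  have ddR: "dd z \<le> R" if "z \<in> \<Omega>" for z using dd_le[OF p0, of z] R(2)[OF that p0] by linarith
  \<comment> \<open>A point lifted by \<open>t\<close> has \<open>r \<le> - (t * m^2 / 2)\<close>,
    and by \<open>r_ge\<close> it then lies at least \<open>t * m^2 / (4 * M)\<close> from the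
    boundary. Points with \<open>dd Z > t\<close> satisfy the bound already.\<close>
  define d where "d = min t (t * m\<^sup>2 / (4 * M))"
  have m2: "m\<^sup>2 > 0" using const_bounds by simp
  have d: "d > 0" using t m2 const_bounds by (simp add: d_def)
  obtain K L where KL: "\<And>z w. z \<in> \<Omega> \<Longrightarrow> w \<in> \<Omega> \<Longrightarrow> d \<le> dd z \<Longrightarrow> d \<le> dd w \<Longrightarrow> \<exists>k\<le>K. joinable \<Omega> z w k L"
    by (rule compact_core_joinable[OF d]) (rule that)
  \<comment> \<open>The first entry is for points to be lifted, where
    \<open>(t + dd Z) / dd Z \<le> 2 * t / dd Z\<close>. The second is for deep points: they use a
    one-element chain to themselves, and \<open>ln (h / dd Z)\<close> is bounded below because
    \<open>dd Z \<le> R\<close>.\<close>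
  define C3 where "C3 = max (\<bar>ln (2 * t / h)\<bar> / 2 + C2) (\<bar>ln (R / h)\<bar> / 2 + artanh (1 / 2))"
  have up: "\<exists>Z'\<in>\<Omega>. d \<le> dd Z' \<and> joinable \<Omega> Z Z' 1 (ln (h / dd Z) / 2 + C3) \<and> joinable \<Omega> Z' Z 1 (ln (h / dd Z) / 2 + C3)"
    if Z: "Z \<in> \<Omega>" for Z
  proof (cases "dd Z \<le> t")
    case True
    have d0: "dd Z > 0" by (rule dd_pos[OF Z])
    have d\<rho>: "dd Z \<le> \<rho>" using True t\<rho> by linarith
    define Z' where "Z' = Z - t *\<^sub>R G Z"
    note v = t(5)[OF Z True less_imp_le[OF t(1)] order_refl, folded Z'_def]
    have "d \<le> dd Z'"
    proof (cases "dd Z' \<le> \<rho>")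
      case dZ': True
      define n where "n = norm (G Z)"
      have n: "m \<le> n" "n \<le> M" using G_bounds[OF d\<rho>] by (auto simp: n_def)
      have tM: "t * M \<le> 1 / 4" using t(3) const_bounds by (simp add: field_simps)
      have "norm (- (t *\<^sub>R G Z)) = t * n" using t(1) by (simp add: n_def)
      then have nv: "norm (- (t *\<^sub>R G Z)) \<le> \<rho>"
        using mult_left_mono[OF n(2), of t] t(1,2) by linarith
      have "r Z' \<le> r Z + G Z \<bullet> (- (t *\<^sub>R G Z)) + M * (t * n)\<^sup>2"
        using r_taylor[OF d\<rho> nv] \<open>norm (- (t *\<^sub>R G Z)) = t * n\<close> by (simp add: Z'_def)
      also have "\<dots> = r Z - t * n\<^sup>2 * (1 - t * M)" by (simp add: n_def power2_norm_eq_inner[symmetric] power2_eq_square algebra_simps)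
      also have "\<dots> \<le> - (t * m\<^sup>2 / 2)"
      proof -
        have "m\<^sup>2 \<le> n\<^sup>2" using n const_bounds by (intro power_mono) auto
        then have "t * m\<^sup>2 * (1 / 2) \<le> t * n\<^sup>2 * (1 - t * M)" using t tM by (intro mult_mono) auto
        then show ?thesis using r_neg[OF Z d\<rho>] by simp
      qed
      finally have "t * m\<^sup>2 / 2 \<le> 2 * M * dd Z'" using r_ge[OF dZ'] by simp
      then have "t * m\<^sup>2 / (4 * M) \<le> dd Z'" using const_bounds by (simp add: divide_le_eq ac_simps)
      then show ?thesis by (simp add: d_def)
    next
      case False
      then show ?thesis using t\<rho> by (simp add: d_def)
    qed
    moreover have "ln ((t + dd Z) / dd Z) / 2 + C2 \<le> ln (h / dd Z) / 2 + C3"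
    proof -
      have "(t + dd Z) / dd Z \<le> (2 * t / h) * (h / dd Z)" using True d0 h by (simp add: divide_right_mono)
      moreover have "0 < (t + dd Z) / dd Z" using d0 t by simp
      ultimately have "ln ((t + dd Z) / dd Z) \<le> ln ((2 * t / h) * (h / dd Z))" by simp
      also have "\<dots> = ln (2 * t / h) + ln (h / dd Z)" by (rule ln_mult_pos) (use t h d0 in auto)
      finally have "ln ((t + dd Z) / dd Z) / 2 + C2 \<le> ln (h / dd Z) / 2 + (\<bar>ln (2 * t / h)\<bar> / 2 + C2)" by linarith
      also have "\<dots> \<le> ln (h / dd Z) / 2 + C3" unfolding C3_def by (intro add_left_mono max.cobounded1)
      finally show ?thesis .
    qed
    ultimately show ?thesis using v joinable_mono by blast
  next
    case False
    have d0: "dd Z > 0" by (rule dd_pos[OF Z])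
    have dZ: "d \<le> dd Z" using False by (simp add: d_def)
    have "0 \<le> dd Z / 2" using d0 by simp
    then have j: "joinable \<Omega> Z Z 1 (artanh (1 / 2))" using joinable_nearby(1)[OF Z, of Z] by simp
    have "ln (dd Z / h) \<le> ln (R / h)" using ddR[OF Z] d0 h by (subst ln_le_cancel_iff) (auto simp: divide_right_mono)
    moreover have "ln (dd Z / h) = - ln (h / dd Z)" using d0 h by (simp add: ln_divide_pos)
    ultimately have "artanh (1 / 2) \<le> ln (h / dd Z) / 2 + (\<bar>ln (R / h)\<bar> / 2 + artanh (1 / 2))" by linarith
    also have "\<dots> \<le> ln (h / dd Z) / 2 + C3" unfolding C3_def by (intro add_left_mono max.cobounded2)
    finally show ?thesis using joinable_mono[OF j] Z dZ by blast
  qed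
  show ?thesis
  proof (rule that[of "max 0 (2 * C3 + L)" "2 + K"])
    fix P Q assume P: "P \<in> \<Omega>" and Q: "Q \<in> \<Omega>"
    obtain P' where P': "P' \<in> \<Omega>" "d \<le> dd P'" "joinable \<Omega> P P' 1 (ln (h / dd P) / 2 + C3)" using up[OF P] by blast
    obtain Q' where Q': "Q' \<in> \<Omega>" "d \<le> dd Q'" "joinable \<Omega> Q' Q 1 (ln (h / dd Q) / 2 + C3)" using up[OF Q] by blast
    obtain k where k: "k \<le> K" "joinable \<Omega> P' Q' k L" using KL[OF P'(1) Q'(1) P'(2) Q'(2)] by blast
    have "joinable \<Omega> P Q (1 + k + 1) (ln (h / dd P) / 2 + C3 + L + (ln (h / dd Q) / 2 + C3))"
      by (rule joinable_trans[OF joinable_trans[OF P'(3) k(2)] Q'(3)])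
    then have "joinable \<Omega> P Q (1 + k + 1) (ln (h / dd P) / 2 + ln (h / dd Q) / 2 + max 0 (2 * C3 + L))"
      by (rule joinable_mono) (simp add: algebra_simps)
    then show "\<exists>k\<le>2 + K. joinable \<Omega> P Q k (ln (h / dd P) / 2 + ln (h / dd Q) / 2 + max 0 (2 * C3 + L))"
      using k(1) by (intro exI[of _ "1 + k + 1"]) auto
  qed simp
qed

text \<open>The scale \<open>s\<close> is \<open>sep P Q\<close> if this is at most
  \<open>h\<close>, and \<open>h\<close> otherwise. At this scale the chain and the lower bound
  involve the same two logarithms, so the difference is bounded however close \<open>P\<close> and
  \<open>Q\<close> are to the boundary.\<close>

lemma bounded_chain_approximation:
  "\<exists>\<epsilon>::real. \<epsilon> > 0 \<and> (\<exists>K::nat. \<forall>P\<in>\<Omega>. \<forall>Q\<in>\<Omega>.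
           \<exists>k \<phi> a b. k \<le> K \<and> kobayashi_chain \<Omega> P Q k \<phi> a b \<and>
             kobayashi_dist \<Omega> P Q \<le> chain_length k a b + ennreal \<epsilon> \<and>
             chain_length k a b \<le> kobayashi_dist \<Omega> P Q + ennreal \<epsilon>)"
proof -
  obtain h1 C1 where 1: "h1 > 0" "C1 > 0"
    "\<And>P Q h. P \<in> \<Omega> \<Longrightarrow> Q \<in> \<Omega> \<Longrightarrow> 0 < h \<Longrightarrow> h \<le> h1 \<Longrightarrow> h \<le> sep P Q \<Longrightarrow>
       ennreal (ln (h / dd P) / 2 + ln (h / dd Q) / 2 - C1) \<le> kobayashi_dist \<Omega> P Q"
    by (rule kobayashi_dist_lower_bound) (rule that)
  obtain h4 C4 where 4: "h4 > 0" "C4 \<ge> 0"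
    "\<And>P Q. P \<in> \<Omega> \<Longrightarrow> Q \<in> \<Omega> \<Longrightarrow> sep P Q \<le> h4 \<Longrightarrow>
       joinable \<Omega> P Q 3 (ln (sep P Q / dd P) / 2 + ln (sep P Q / dd Q) / 2 + C4)"
    by (rule near_points_joinable) (rule that)
  define h where "h = min h1 h4"
  have h: "h > 0" "h \<le> h1" "h \<le> h4" using 1 4 by (auto simp: h_def)
  obtain K C5 where 5: "C5 \<ge> 0"
    "\<And>P Q. P \<in> \<Omega> \<Longrightarrow> Q \<in> \<Omega> \<Longrightarrow> \<exists>k\<le>K. joinable \<Omega> P Q k (ln (h / dd P) / 2 + ln (h / dd Q) / 2 + C5)"
    by (rule far_points_joinable[OF h(1)]) (rule that)
  define \<epsilon> where "\<epsilon> = C1 + C4 + C5"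
  have e: "\<epsilon> > 0" using 1 4 5 by (simp add: \<epsilon>_def)
  have main: "\<exists>k \<phi> a b. k \<le> max 3 K \<and> kobayashi_chain \<Omega> P Q k \<phi> a b \<and>
             kobayashi_dist \<Omega> P Q \<le> chain_length k a b + ennreal \<epsilon> \<and>
             chain_length k a b \<le> kobayashi_dist \<Omega> P Q + ennreal \<epsilon>"
    if P: "P \<in> \<Omega>" and Q: "Q \<in> \<Omega>" for P Q
  proof -
    have "\<exists>k s. k \<le> max 3 K \<and> 0 < s \<and> s \<le> h1 \<and> s \<le> sep P Q \<and>
        joinable \<Omega> P Q k (ln (s / dd P) / 2 + ln (s / dd Q) / 2 + (C4 + C5))"
    proof (cases "sep P Q \<le> h")
      case True
      have "sep P Q > 0" using sep_ge(1)[where P = P and Q = Q] dd_pos[OF P] by linarith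
      moreover have "joinable \<Omega> P Q 3 (ln (sep P Q / dd P) / 2 + ln (sep P Q / dd Q) / 2 + (C4 + C5))"
        by (rule joinable_mono[OF 4(3)[OF P Q]]) (use True h 5(1) in auto)
      ultimately show ?thesis using True h by (intro exI[of _ 3] exI[of _ "sep P Q"]) auto
    next
      case False
      obtain k where k: "k \<le> K" "joinable \<Omega> P Q k (ln (h / dd P) / 2 + ln (h / dd Q) / 2 + C5)"
        using 5(2)[OF P Q] by blast
      have "joinable \<Omega> P Q k (ln (h / dd P) / 2 + ln (h / dd Q) / 2 + (C4 + C5))"
        using k(2) 4(2) by (intro joinable_mono[OF k(2)]) auto
      then show ?thesis using False h k(1) by (intro exI[of _ k] exI[of _ h]) auto
    qed
    then obtain k s where ks: "k \<le> max 3 K" "0 < s" "s \<le> h1" "s \<le> sep P Q"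
      "joinable \<Omega> P Q k (ln (s / dd P) / 2 + ln (s / dd Q) / 2 + (C4 + C5))" by blast
    then obtain \<phi> a b where ch: "kobayashi_chain \<Omega> P Q k \<phi> a b"
      "chain_length k a b \<le> ennreal (ln (s / dd P) / 2 + ln (s / dd Q) / 2 + (C4 + C5))"
      unfolding joinable_def by blast
    have "kobayashi_dist \<Omega> P Q \<le> chain_length k a b + ennreal \<epsilon>"
      by (rule order_trans[OF kobayashi_dist_le_chain_length[OF open_dom ch(1)]]) simp
    moreover have "chain_length k a b \<le> kobayashi_dist \<Omega> P Q + ennreal \<epsilon>"
    proof -
      \<comment> \<open>The length is split inside \<open>ennreal\<close>, since the lower bound in
        the first bracket may be negative; \<open>ennreal_add_le\<close> covers that case.\<close>
      have "chain_length k a b \<le> ennreal ((ln (s / dd P) / 2 + ln (s / dd Q) / 2 - C1) + \<epsilon>)"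
        using ch(2) by (simp add: \<epsilon>_def algebra_simps)
      also have "\<dots> \<le> ennreal (ln (s / dd P) / 2 + ln (s / dd Q) / 2 - C1) + ennreal \<epsilon>" by (rule ennreal_add_le)
      also have "\<dots> \<le> kobayashi_dist \<Omega> P Q + ennreal \<epsilon>" by (intro add_right_mono 1(3) P Q ks)
      finally show ?thesis .
    qed
    ultimately show ?thesis using ks(1) ch(1) by blast
  qed
  show ?thesis using e main by blast
qed

end

theorem theorem18:
  fixes \<Omega> :: "(complex^'n) set"
  assumes "open \<Omega>" and "connected \<Omega>" and "bounded \<Omega>"
    and "strongly_pseudoconvex_C2 \<Omega>"
  shows "\<exists>\<epsilon>::real. \<epsilon> > 0 \<and> (\<exists>K::nat. \<forall>P\<in>\<Omega>. \<forall>Q\<in>\<Omega>.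
           \<exists>k \<phi> a b. k \<le> K \<and> kobayashi_chain \<Omega> P Q k \<phi> a b \<and>
             kobayashi_dist \<Omega> P Q \<le> chain_length k a b + ennreal \<epsilon> \<and>
             chain_length k a b \<le> kobayashi_dist \<Omega> P Q + ennreal \<epsilon>)"
proof (cases "\<Omega> = {}")
  case True
  then show ?thesis by (intro exI[of _ 1]) auto
next
  case False
  obtain r G g \<rho> m M c \<eta> where "spc_domain \<Omega> r G g \<rho> m M c \<eta>"
    using spc_domain_exists[OF assms(1-3) False assms(4)] by blast
  then interpret spc_domain \<Omega> r G g \<rho> m M c \<eta> .
  show ?thesis by (rule bounded_chain_approximation)
qed

end
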